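(* There exists an integer $N$ such that the following holds. Let $\mathrm{P}\subset\mathbb{R}^2$ be a simple non-convex polygon with vertex set $X$. Assume that $\mathrm{P}$ admits a single reflex vertex and that $\mathrm{P}$ is balanced with respect to that vertex. If $|X|\geq N$, then there exists a line segment $\varepsilon$ such that $\mathcal{F}_\varepsilon(\mathrm{P},X)$ is not a strongly convex subgraph of $\mathcal{F}(\mathrm{P},X)$.
   Context: A simple polygon is a compact subset $\mathrm{P}$ of $\mathbb{R}^2$ whose boundary is a Jordan curve that is a union of finitely many line segments (its edges) with pairwise disjoint relative interiors; the endpoints of the edges are the vertices. A vertex has interior angle different from $\pi$, and it is reflex when its interior angle is greater than $\pi$. A simple polygon $\mathrm{P}$ is balanced with respect to a point $x$ when the number of vertices of $\mathrm{P}$ in any open half-plane bounded by a line through $x$ is never greater than $3/2$ times the smallest number of vertices of $\mathrm{P}$ in any such half-plane. Let $X$ be a finite subset of $\mathrm{P}$ containing all the vertices of $\mathrm{P}$. Two line segments are crossing when their relative interiors are non-disjoint. A triangulation of $\mathrm{P}$ with vertex set $X$ is an inclusion-wise maximal set of pairwise non-crossing line segments (called arcs), each of them contained in $\mathrm{P}$, having two distinct endpoints in $X$, and containing no point of $X$ in its relative interior. Such a set decomposes $\mathrm{P}$ into triangles. The flip-graph $\mathcal{F}(\mathrm{P},X)$ is the graph whose vertices are the triangulations of $\mathrm{P}$ with vertex set $X$ and whose edges connect two triangulations that differ by a single arc (that is, one is obtained from the other by removing one arc and inserting another one). For a line segment $\varepsilon$, $\mathcal{F}_\varepsilon(\mathrm{P},X)$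 is the subgraph of $\mathcal{F}(\mathrm{P},X)$ induced by the triangulations that contain $\varepsilon$. It is strongly convex in $\mathcal{F}(\mathrm{P},X)$ when every geodesic (shortest path) in $\mathcal{F}(\mathrm{P},X)$ between two vertices of $\mathcal{F}_\varepsilon(\mathrm{P},X)$ remains entirely in $\mathcal{F}_\varepsilon(\mathrm{P},X)$. *)

theory Defs
  imports
    "HOL-Analysis.Analysis"
    "Graph_Theory.Digraph_Component"
    "Graph_Theory.Vertex_Walk"
begin

type_synonym plane = "real ^ 2"

definition segments :: "plane set set" where
  "segments = {closed_segment a b | a b. a \<noteq> b}"

definition crossing :: "plane set \<Rightarrow> plane set \<Rightarrow> bool" where
  "crossing s t \<longleftrightarrow> rel_interior s \<inter> rel_interior t \<noteq> {}"

definition non_crossing :: "plane set set \<Rightarrow> bool" where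
  "non_crossing S \<longleftrightarrow> pairwise (\<lambda>s t. \<not> crossing s t) S"

definition Jordan_curve :: "plane set \<Rightarrow> bool" where
  "Jordan_curve C \<longleftrightarrow>
     (\<exists>g :: real \<Rightarrow> plane. simple_path g \<and> pathfinish g = pathstart g \<and> path_image g = C)"

definition edge_endpoints :: "plane set set \<Rightarrow> plane set" where
  "edge_endpoints E = {a. \<exists>b. a \<noteq> b \<and> closed_segment a b \<in> E}"

text \<open>The interior angle of \<open>P\<close> at \<open>v\<close>, in radians: the Lebesgue measure of the set of
  directions that point from \<open>v\<close> into \<open>P\<close>.\<close>

definition interior_angle :: "plane set \<Rightarrow> plane \<Rightarrow> real" where
  "interior_angle P v =
     measure lebesgue
       {\<theta> \<in> {0..<2 * pi}.
          \<exists>\<delta>>0. \<forall>t. 0 < t \<and> t < \<delta> \<longrightarrow> v + t *\<^sub>R vector [cos \<theta>, sin \<theta>] \<in> P}"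

text \<open>\<open>simple_polygon P E\<close>: \<open>P\<close> is a simple polygon with set of edges \<open>E\<close>. Without the condition
  that the interior be nonempty, a polygonal Jordan curve would itself qualify as \<open>P\<close>, being compact
  and equal to its own frontier.\<close>

definition simple_polygon :: "plane set \<Rightarrow> plane set set \<Rightarrow> bool" where
  "simple_polygon P E \<longleftrightarrow>
     compact P \<and> interior P \<noteq> {} \<and> Jordan_curve (frontier P) \<and>
     finite E \<and> E \<subseteq> segments \<and> non_crossing E \<and> \<Union>E = frontier P \<and>
     (\<forall>v \<in> edge_endpoints E. interior_angle P v \<noteq> pi)"

definition reflex_vertices :: "plane set \<Rightarrow> plane set set \<Rightarrow> plane set" where
  "reflex_vertices P E = {v \<in> edge_endpoints E. interior_angle P v > pi}"

definition open_halfplanes :: "plane \<Rightarrow> plane set set" where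
  "open_halfplanes x = {{y. u \<bullet> (y - x) > 0} | u. u \<noteq> 0}"

text \<open>For a polygon, \<open>V\<close> is its set of vertices. The infimum is that of a nonempty set of natural
  numbers, hence a minimum.\<close>

definition balanced :: "plane set \<Rightarrow> plane \<Rightarrow> bool" where
  "balanced V x \<longleftrightarrow>
     (\<forall>H \<in> open_halfplanes x.
        real (card (V \<inter> H)) \<le> 3 / 2 * real (INF H' \<in> open_halfplanes x. card (V \<inter> H')))"

definition arcs_in :: "plane set \<Rightarrow> plane set \<Rightarrow> plane set set" where
  "arcs_in P X =
     {closed_segment a b | a b. a \<in> X \<and> b \<in> X \<and> a \<noteq> b \<and>
        closed_segment a b \<subseteq> P \<and> rel_interior (closed_segment a b) \<inter> X = {}}"

definition triangulations :: "plane set \<Rightarrow> plane set \<Rightarrow> plane set set set" where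
  "triangulations P X =
     {T. T \<subseteq> arcs_in P X \<and> non_crossing T \<and>
         (\<forall>T'. T' \<subseteq> arcs_in P X \<and> non_crossing T' \<and> T \<subseteq> T' \<longrightarrow> T' = T)}"

definition flip :: "plane set set \<Rightarrow> plane set set \<Rightarrow> bool" where
  "flip S T \<longleftrightarrow> (\<exists>a b. a \<in> S \<and> b \<notin> S \<and> T = insert b (S - {a}))"

text \<open>Undirected graphs are represented, as usual in the graph library, by symmetric digraphs.\<close>

definition flip_graph ::
    "plane set \<Rightarrow> plane set \<Rightarrow> (plane set set, plane set set \<times> plane set set) pre_digraph" where
  "flip_graph P X =
     \<lparr> verts = triangulations P X,
       arcs = {(S, T). S \<in> triangulations P X \<and> T \<in> triangulations P X \<and> flip S T},
       tail = fst, head = snd \<rparr>"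

lemma flip_sym: "flip S T \<Longrightarrow> flip T S"
proof -
  assume "flip S T"
  then obtain a b where "a \<in> S" "b \<notin> S" "T = insert b (S - {a})"
    unfolding flip_def by blast
  then have "b \<in> T" "a \<notin> T" "S = insert a (T - {b})" by auto
  then show "flip T S" unfolding flip_def by blast
qed

lemma symmetric_flip_graph: "symmetric (flip_graph P X)"
  by (auto simp: symmetric_def arcs_ends_def arc_to_ends_def flip_graph_def flip_sym
        intro!: symI)

definition flip_subgraph ::
    "plane set \<Rightarrow> plane set \<Rightarrow> plane set \<Rightarrow> (plane set set, plane set set \<times> plane set set) pre_digraph" where
  "flip_subgraph \<epsilon> P X = flip_graph P X \<restriction> {T \<in> triangulations P X. \<epsilon> \<in> T}"

definition geodesic :: "('a, 'b) pre_digraph \<Rightarrow> 'a vwalk \<Rightarrow> bool" where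
  "geodesic G p \<longleftrightarrow>
     vwalk p G \<and>
     (\<forall>q. vwalk q G \<and> hd q = hd p \<and> last q = last p \<longrightarrow> vwalk_length p \<le> vwalk_length q)"

definition strongly_convex :: "('a, 'b) pre_digraph \<Rightarrow> ('a, 'b) pre_digraph \<Rightarrow> bool" where
  "strongly_convex H G \<longleftrightarrow>
     (\<forall>p. geodesic G p \<and> hd p \<in> verts H \<and> last p \<in> verts H \<longrightarrow> vwalk p H)"

end

theory Submission
  imports Defs
begin

text \<open>
  Let \<open>x\<close> be the reflex vertex. The polygon is star-shaped from \<open>x\<close> and, apart from \<open>x\<close>, locally
  convex. So once the vertices are labelled by their angle around \<open>x\<close> (with \<open>x\<close> itself labelled \<open>0\<close>),
  two vertices other than \<open>x\<close> see each other exactly when their angles differ by less than \<open>\<pi>\<close>, and two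
  arcs cross exactly when their labels interleave. The flip graph therefore depends only on which pairs
  of labels are visible; this information is the content of the locale \<open>chord_model\<close>.

  Balance enters only by counting. Every open half-plane bounded by a line through \<open>x\<close> contains between
  \<open>m\<close> and \<open>3m/2\<close> vertices for some \<open>m\<close>, and if there are sufficiently many vertices this makes it
  possible to pick \<open>116\<close> of them, \<open>x\<close> included, with one fixed pattern of visibility, called the gadget
  (\<open>gadget_vertices\<close>). Among them an arc \<open>\<epsilon>\<close> is fixed that cuts off a single vertex \<open>c\<close> of the gadget.
  From \<open>c\<close> all vertices of the gadget can be seen. The two ends of \<open>\<epsilon>\<close> do not see all of them.

  Two triangulations \<open>T\<^sub>1\<close> and \<open>T\<^sub>2\<close> containing \<open>\<epsilon>\<close> are joined by an explicit path of \<open>152\<close> flips whose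
  first flip removes \<open>\<epsilon>\<close>, so as to use \<open>c\<close> as a hub; that it is a path is checked by evaluation
  (\<open>run_ok\<close>). Conversely, any walk from \<open>T\<^sub>1\<close> to \<open>T\<^sub>2\<close> all of whose members contain \<open>\<epsilon>\<close> takes at
  least \<open>152\<close> steps (\<open>gad_distance\<close>). If every arc defined a strongly convex subgraph, then a geodesic
  from \<open>T\<^sub>1\<close> to \<open>T\<^sub>2\<close> would keep \<open>\<epsilon>\<close> as well as the chords between consecutive vertices of the gadget,
  so it would restrict to a walk of triangulations of the gadget and have length at least \<open>152\<close>. Then
  the explicit path would be a geodesic too, and it leaves the triangulations containing \<open>\<epsilon>\<close>: a
  contradiction (\<open>escaping_geodesic\<close>).

  The lower bound counts disjoint sets of steps. In \<open>T\<^sub>1\<close> a long row of arcs ends at the vertex \<open>94\<close>, in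
  \<open>T\<^sub>2\<close> a long row of arcs ends at the vertex \<open>114\<close>. Either no step exchanges an arc of the first row for
  one of the second, and then there are already \<open>153\<close> steps, or such an exchange takes place at
  some step. This forces blocking arcs to have disappeared before, and splits the
  rest of the work into a part before that step, inside the chord to \<open>94\<close>, and a part after it, inside
  the chord to \<open>114\<close>. These two parts are bounded by a sum over triangles which a flip changes by at
  most one (\<open>pot_quad\<close>).

  The geometry rests on the Jordan curve theorem. Near a boundary point the boundary consists of exactly
  two rays, because three rays with a common origin do not embed in a simple closed curve
  (\<open>loop_no_triod\<close>); the interior angle then decides whether the polygon is locally a convex wedge, a
  half-plane or a reflex wedge. An open segment inside the polygon that avoids \<open>x\<close> must lie wholly in the
  interior or wholly in the boundary (\<open>segment_dichotomy\<close>), and star-shapedness and visibility follow from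
  this by connectedness arguments.
\<close>

section \<open>The combinatorial model of a star-shaped polygon\<close>

definition crosses :: "int \<times> int \<Rightarrow> int \<times> int \<Rightarrow> bool" where
  "crosses e f \<longleftrightarrow> (fst e < fst f \<and> fst f < snd e \<and> snd e < snd f) \<or>
                  (fst f < fst e \<and> fst e < snd f \<and> snd f < snd e)"

lemma crosses_sym: "crosses e f \<longleftrightarrow> crosses f e"
  by (auto simp: crosses_def)

definition flip_step :: "'b set \<Rightarrow> 'b set \<Rightarrow> bool" where
  "flip_step S T \<longleftrightarrow> (\<exists>a b. a \<in> S \<and> b \<notin> S \<and> T = insert b (S - {a}))"

text \<open>The label \<open>ap\<close> stands for the apex, which sees every other vertex. A pair \<open>(a, d)\<close> with \<open>a \<noteq> ap\<close> is
  an arc when the two angles differ by less than \<open>\<pi>\<close>, and then the same is true of any two labels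
  between \<open>a\<close> and \<open>d\<close>; this is \<open>sub_chord\<close>.\<close>

locale chord_model =
  fixes V :: "int set" and A :: "(int \<times> int) set" and ap :: int
  assumes finite_V: "finite V"
    and A_vertices: "(a, b) \<in> A \<Longrightarrow> a \<in> V \<and> b \<in> V \<and> a < b"
    and ap_least: "a \<in> V \<Longrightarrow> ap \<le> a"
    and ap_V: "ap \<in> V"
    and ap_sees: "b \<in> V \<Longrightarrow> ap < b \<Longrightarrow> (ap, b) \<in> A"
    and sub_chord: "(a, d) \<in> A \<Longrightarrow> a \<noteq> ap \<Longrightarrow> a \<le> b \<Longrightarrow> b < c \<Longrightarrow> c \<le> d \<Longrightarrow> b \<in> V \<Longrightarrow> c \<in> V \<Longrightarrow> (b, c) \<in> A"
begin

definition tri :: "(int \<times> int) set \<Rightarrow> bool" where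
  "tri T \<longleftrightarrow> T \<subseteq> A \<and> (\<forall>e\<in>T. \<forall>f\<in>T. \<not> crosses e f) \<and>
     (\<forall>e\<in>A. (\<forall>f\<in>T. \<not> crosses e f) \<longrightarrow> e \<in> T)"

lemma tri_arc: "tri T \<Longrightarrow> e \<in> T \<Longrightarrow> e \<in> A"
  by (auto simp: tri_def)

lemma tri_noncrossing: "tri T \<Longrightarrow> e \<in> T \<Longrightarrow> f \<in> T \<Longrightarrow> \<not> crosses e f"
  by (auto simp: tri_def)

lemma tri_maximal: "tri T \<Longrightarrow> e \<in> A \<Longrightarrow> (\<And>f. f \<in> T \<Longrightarrow> \<not> crosses e f) \<Longrightarrow> e \<in> T"
  by (auto simp: tri_def)

lemma finite_A: "finite A"
proof -
  have "A \<subseteq> V \<times> V" using A_vertices by auto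
  then show ?thesis using finite_V finite_subset by blast
qed

lemma tri_extend:
  assumes "S \<subseteq> A" "\<And>e f. e \<in> S \<Longrightarrow> f \<in> S \<Longrightarrow> \<not> crosses e f"
  shows "\<exists>T. tri T \<and> S \<subseteq> T"
proof -
  let ?F = "{T. S \<subseteq> T \<and> T \<subseteq> A \<and> (\<forall>e\<in>T. \<forall>f\<in>T. \<not> crosses e f)}"
  have fin: "finite ?F" using finite_A by (auto intro: finite_subset[of _ "Pow A"])
  have "S \<in> ?F" using assms by auto
  then obtain T where T: "T \<in> ?F" "\<And>T'. T' \<in> ?F \<Longrightarrow> T \<subseteq> T' \<Longrightarrow> T' = T"
    using finite_has_maximal2[OF fin] by (metis (no_types, lifting))
  have "e \<in> T" if "e \<in> A" "\<forall>f\<in>T. \<not> crosses e f" for e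
  proof -
    have "\<not> crosses e e" by (auto simp: crosses_def)
    moreover have "\<forall>f\<in>T. \<not> crosses f e" using that(2) crosses_sym by metis
    ultimately have "insert e T \<in> ?F" using T(1) that by auto
    then show ?thesis using T(2) by blast
  qed
  then have "tri T" using T(1) by (auto simp: tri_def)
  then show ?thesis using T(1) by auto
qed

text \<open>The only side of the quadrilateral that visibility does not provide at once is \<open>(a, d)\<close>. If it were not
  an arc, nothing in the triangulation could cross the spoke from the apex to \<open>c\<close>: an arc that crosses it
  but neither diagonal would span \<open>(a, d)\<close>. By maximality the spoke would be present, yet it crosses \<open>(b, d)\<close>.\<close>

lemma exchange_sides:
  assumes T: "tri (insert (a, c) S)" and T': "tri (insert (b, d) S)"
    and o: "a < b" "b < c" "c < d" and n: "(a, c) \<notin> S" "(b, d) \<notin> S"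
  shows "(a, b) \<in> S \<and> (b, c) \<in> S \<and> (c, d) \<in> S \<and> (a, d) \<in> S"
proof -
  have acA: "(a, c) \<in> A" and bdA: "(b, d) \<in> A" using T T' by (auto simp: tri_def)
  have vs: "a \<in> V" "b \<in> V" "c \<in> V" "d \<in> V" using A_vertices[OF acA] A_vertices[OF bdA] by auto
  have apb: "b \<noteq> ap" using ap_least[OF vs(1)] o by auto
  have bcA: "(b, c) \<in> A" using sub_chord[OF bdA apb, of b c] o vs by auto
  have cdA: "(c, d) \<in> A" using sub_chord[OF bdA apb, of c d] o vs by auto
  have abA: "(a, b) \<in> A"
    using ap_sees[of b] sub_chord[OF acA _, of a b] o vs by (cases "a = ap") auto
  have S1: "\<not> crosses (a, c) g" "\<not> crosses (b, d) g" if "g \<in> S" for g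
    using tri_noncrossing[OF T, of "(a, c)" g] tri_noncrossing[OF T', of "(b, d)" g] that by auto
  have adA: "(a, d) \<in> A"
  proof (cases "a = ap")
    case True then show ?thesis using ap_sees[of d] vs o by auto
  next
    case False
    show ?thesis
    proof (rule ccontr)
      assume no: "(a, d) \<notin> A"
      have apa: "ap < a" using False ap_least[OF vs(1)] by auto
      have "\<not> crosses (ap, c) g" if g: "g \<in> insert (a, c) S" for g
      proof
        assume cr: "crosses (ap, c) g"
        obtain s t where st: "g = (s, t)" by (cases g)
        have gA: "(s, t) \<in> A" using g st T by (auto simp: tri_def)
        have sV: "s \<in> V" "t \<in> V" using A_vertices[OF gA] by auto
        have gS: "g \<in> S" using g cr st by (auto simp: crosses_def)
        have 1: "ap < s" "s < c" "c < t" using cr st ap_least[OF sV(1)] by (auto simp: crosses_def)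
        have 2: "s \<le> a" using S1(1)[OF gS] 1 st by (auto simp: crosses_def)
        have 3: "d \<le> t" using S1(2)[OF gS] 1 2 st o by (auto simp: crosses_def)
        have "(a, d) \<in> A" using sub_chord[OF gA, of a d] 1 2 3 o vs by auto
        then show False using no by simp
      qed
      moreover have "(ap, c) \<in> A" using ap_sees[of c] vs apa o by auto
      ultimately have "(ap, c) \<in> insert (a, c) S"
        using tri_maximal[OF T] by blast
      then have "(ap, c) \<in> S" using apa by auto
      then show False using S1(2)[of "(ap, c)"] apa o by (auto simp: crosses_def)
    qed
  qed
  have in_S: "e \<in> S" if "e \<in> {(a, b), (b, c), (c, d), (a, d)}" for e
  proof -
    have eA: "e \<in> A" using that abA bcA cdA adA by auto
    have "\<not> crosses e g" if "g \<in> insert (a, c) S" for g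
    proof (cases "g = (a, c)")
      case True then show ?thesis using \<open>e \<in> {(a, b), (b, c), (c, d), (a, d)}\<close> o by (auto simp: crosses_def)
    next
      case False
      then have gS: "g \<in> S" using that by auto
      obtain s t where st: "g = (s, t)" by (cases g)
      have "s < t" using gS st T A_vertices by (auto simp: tri_def)
      then show ?thesis using S1[OF gS] \<open>e \<in> {(a, b), (b, c), (c, d), (a, d)}\<close> o st
        unfolding crosses_def by (smt (verit) fst_conv snd_conv insert_iff empty_iff)
    qed
    then have "e \<in> insert (a, c) S" using tri_maximal[OF T eA] by blast
    then show ?thesis using that o by auto
  qed
  then show ?thesis by blast
qed

lemma flip_quadrilateral:
  assumes T: "tri T" and T': "tri T'" and e: "e \<in> T" "f \<notin> T" "T' = insert f (T - {e})"
  obtains a b c d where "a < b" "b < c" "c < d"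
    "e = (a, c) \<and> f = (b, d) \<or> e = (b, d) \<and> f = (a, c)"
    "(a, b) \<in> T - {e}" "(b, c) \<in> T - {e}" "(c, d) \<in> T - {e}" "(a, d) \<in> T - {e}"
proof -
  have "crosses e f"
  proof (rule ccontr)
    assume "\<not> crosses e f"
    then have "\<And>g. g \<in> T \<Longrightarrow> \<not> crosses f g"
      using tri_noncrossing[OF T', of f] e crosses_sym by (metis Diff_iff insertCI insertE empty_iff)
    then have "f \<in> T" using tri_maximal[OF T, of f] tri_arc[OF T', of f] e by auto
    then show False using e by simp
  qed
  then obtain a b c d where o: "a < b" "b < c" "c < d"
      "e = (a, c) \<and> f = (b, d) \<or> e = (b, d) \<and> f = (a, c)"
    unfolding crosses_def by (metis prod.collapse)
  have TS: "T = insert e (T - {e})" using e by auto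
  have nS: "e \<notin> T - {e}" "f \<notin> T - {e}" using e by auto
  have "(a, b) \<in> T - {e} \<and> (b, c) \<in> T - {e} \<and> (c, d) \<in> T - {e} \<and> (a, d) \<in> T - {e}"
    using o(4)
  proof
    assume ef: "e = (a, c) \<and> f = (b, d)"
    show ?thesis
      by (rule exchange_sides[OF _ _ o(1-3)]) (use T T' TS nS e(3) ef in auto)
  next
    assume ef: "e = (b, d) \<and> f = (a, c)"
    show ?thesis
      by (rule exchange_sides[OF _ _ o(1-3)]) (use T T' TS nS e(3) ef in auto)
  qed
  then show ?thesis using that[OF o] by blast
qed

text \<open>An arc that crosses one diagonal but none of the four sides is the other diagonal, so exchanging the
  diagonals preserves maximality.\<close>

lemma flip_tri:
  assumes T: "tri T" and o: "a < b" "b < c" "c < d"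
    and ef: "e = (a, c) \<and> f = (b, d) \<or> e = (b, d) \<and> f = (a, c)" and fA: "f \<in> A" and eT: "e \<in> T"
    and sides: "(a, b) \<in> T" "(b, c) \<in> T" "(c, d) \<in> T" "(a, d) \<in> T"
  shows "tri (insert f (T - {e}))" "f \<notin> T"
proof -
  have cr: "crosses e f" using ef o by (auto simp: crosses_def)
  show "f \<notin> T" using tri_noncrossing[OF T eT, of f] cr by blast
  have nc: "\<not> crosses f g" if g: "g \<in> T - {e}" for g
  proof
    assume cr: "crosses f g"
    obtain s t where st: "g = (s, t)" by (cases g)
    have gT: "g \<in> T" and ge: "g \<noteq> e" using g by auto
    have "\<not> crosses (a, b) g" "\<not> crosses (b, c) g" "\<not> crosses (c, d) g" "\<not> crosses (a, d) g" "\<not> crosses e g"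
      using tri_noncrossing[OF T _ gT] sides eT by auto
    then show False using cr st ef o ge unfolding crosses_def fst_conv snd_conv by (smt (verit) fst_conv snd_conv)
  qed
  have mx: "g \<in> insert f (T - {e})" if gA: "g \<in> A" and g: "\<forall>h \<in> insert f (T - {e}). \<not> crosses g h" for g
  proof (cases "crosses g e")
    case False
    then have "g \<in> T" using tri_maximal[OF T gA] g by (metis Diff_iff insertCI singletonD)
    moreover have "g \<noteq> e" using g cr by auto
    ultimately show ?thesis by simp
  next
    case True
    obtain s t where st: "g = (s, t)" by (cases g)
    have side: "\<not> crosses g (a, b)" "\<not> crosses g (b, c)" "\<not> crosses g (c, d)" "\<not> crosses g (a, d)"
      using g sides ef o by auto
    have "g = f" using side True st ef o unfolding crosses_def by (smt (verit) fst_conv snd_conv)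
    then show ?thesis by simp
  qed
  show "tri (insert f (T - {e}))"
    unfolding tri_def
  proof (intro conjI ballI impI)
    show "insert f (T - {e}) \<subseteq> A" using T fA by (auto simp: tri_def)
    show "\<not> crosses g h" if "g \<in> insert f (T - {e})" "h \<in> insert f (T - {e})" for g h
    proof -
      have "\<not> crosses f f" by (auto simp: crosses_def)
      then show ?thesis using that nc tri_noncrossing[OF T, of g h] crosses_sym[of g f] by blast
    qed
  qed (use mx in blast)
qed

end

section \<open>The gadget and a path of 152 flips\<close>

text \<open>The gadget consists of the apex \<open>0\<close>, the vertex \<open>1\<close> of smallest angle, two blocks \<open>2..103\<close> and
  \<open>105..114\<close>, the hub \<open>104\<close>, and the vertex \<open>115\<close> of largest angle. The two blocks and the hub see each other;
  \<open>1\<close> is hidden from the second block and \<open>115\<close> from the first; the hub sees everything.\<close>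

definition sees :: "int \<Rightarrow> int \<Rightarrow> bool" where
  "sees i j \<longleftrightarrow> i = 0 \<or> i = 1 \<and> j \<le> 104 \<or> 2 \<le> i \<and> j \<le> 114 \<or> 104 \<le> i"

definition gad_arcs :: "(int \<times> int) set" where
  "gad_arcs = {(i, j). 0 \<le> i \<and> i < j \<and> j \<le> 115 \<and> sees i j}"

interpretation gad: chord_model "{0..115}" gad_arcs 0
  by unfold_locales (auto simp: gad_arcs_def sees_def)

text \<open>These arcs, with the boundary of the gadget, form the triangulation \<open>T\<^sub>1\<close>; \<open>(103, 105)\<close> is \<open>\<epsilon>\<close>.
  The vertices \<open>1\<close>, \<open>115\<close> and \<open>94\<close> are centres of fans, and a zigzag fills the region below \<open>(78, 94)\<close>.\<close>

definition start_list :: "(int \<times> int) list" where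
  "start_list = (103, 105) # (0, 103) # (0, 105) # map (\<lambda>j. (1, j)) [94..103] @ map (\<lambda>j. (j, 115)) [105..113]
     @ map (\<lambda>l. (l, 94)) [2..78] @ map (\<lambda>i. (78 + i, 93 - i)) [0..7] @ map (\<lambda>i. (78 + i, 94 - i)) [1..7]"

text \<open>In \<open>T\<^sub>2\<close> the vertex \<open>114\<close> is the centre of the long fan, and the zigzags fill the regions below
  \<open>(78, 114)\<close> and \<open>(86, 103)\<close>.\<close>

definition goal_list :: "(int \<times> int) list" where
  "goal_list = (103, 105) # (0, 2) # (0, 114) # map (\<lambda>l. (l, 114)) [2..78]
     @ map (\<lambda>i. (78 + i, 114 - i)) [0..8] @ map (\<lambda>i. (78 + i, 113 - i)) [0..8]
     @ map (\<lambda>i. (94 - i, 94 + i)) [1..8] @ map (\<lambda>i. (94 - i, 95 + i)) [1..8]"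

definition held :: "(int \<times> int) list \<Rightarrow> int \<times> int \<Rightarrow> bool" where
  "held L e \<longleftrightarrow> snd e = fst e + 1 \<or> e = (0, 115) \<or> List.member L e"

text \<open>An entry \<open>(a, b, c, d, r)\<close> flips one diagonal of the quadrilateral \<open>a, b, c, d\<close> into the other.
  It is checked that the sides and the old diagonal are present and that the new diagonal is visible,
  which by \<open>flip_tri\<close> is all that is needed.\<close>

fun run_flips :: "(int \<times> int) list \<Rightarrow> (int \<times> int \<times> int \<times> int \<times> bool) list \<Rightarrow> (int \<times> int) list option" where
  "run_flips L [] = Some L"
| "run_flips L ((a, b, c, d, r) # qs) =
     (let e = (if r then (a, c) else (b, d)); f = (if r then (b, d) else (a, c))
      in if 0 \<le> a \<and> a < b \<and> b < c \<and> c < d \<and> d \<le> 115 \<and> sees (fst f) (snd f) \<and> held L e \<and>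
            held L (a, b) \<and> held L (b, c) \<and> held L (c, d) \<and> held L (a, d)
         then run_flips (f # removeAll e L) qs else None)"

text \<open>The first flip trades \<open>\<epsilon>\<close> for \<open>(0, 104)\<close>. Then arcs at the hub \<open>104\<close> replace the fans at \<open>1\<close> and \<open>115\<close>;
  the long fan moves from \<open>94\<close> to \<open>114\<close> one arc at a time; the first zigzag is collapsed onto the
  hub, the final zigzags are expanded from it, and the last flip restores \<open>\<epsilon>\<close>.\<close>

definition flip_list :: "(int \<times> int \<times> int \<times> int \<times> bool) list" where
  "flip_list =
     (0, 103, 104, 105, False) # (0, 1, 103, 104, True) # (0, 104, 105, 115, True)
     # map (\<lambda>k. (1, 102 - k, 103 - k, 104, True)) [0..8] @ (1, 2, 94, 104, True)
     # (0, 1, 2, 104, False)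
     # map (\<lambda>k. (104, 105 + k, 106 + k, 115, False)) [0..8]
     @ (0, 104, 114, 115, False) # (0, 2, 104, 114, True) # (2, 94, 104, 114, True)
     # map (\<lambda>k. (2 + k, 3 + k, 94, 114, True)) [0..75] @ (78, 94, 104, 114, False)
     # concat (map (\<lambda>i. [(78 + i, 93 - i, 94 - i, 104, True), (78 + i, 79 + i, 93 - i, 104, True)]) [0..6])
     @ (85, 86, 87, 104, True)
     # concat (map (\<lambda>i. [(93 - i, 94 - i, 95 + i, 104, False), (93 - i, 95 + i, 96 + i, 104, False)]) [0..7])
     @ concat (map (\<lambda>i. [(78 + i, 104, 113 - i, 114 - i, False), (78 + i, 79 + i, 104, 113 - i, True)]) [0..7])
     @ [(86, 104, 105, 106, False), (86, 103, 104, 105, True)]"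

lemma run_ok: "(case run_flips start_list flip_list of None \<Rightarrow> False
   | Some L \<Rightarrow> list_all (held L) goal_list) \<and> length flip_list = 152"
  by code_simp

section \<open>A potential that one flip changes by at most one\<close>

text \<open>The block \<open>2..103\<close> is divided into three kinds; the second block is kind \<open>3\<close>. Kind \<open>4\<close> is a default
  for the remaining vertices.\<close>

definition kind :: "int \<Rightarrow> int" where
  "kind i = (if 2 \<le> i \<and> i \<le> 85 then 0 else if 86 \<le> i \<and> i \<le> 93 then 1
     else if 94 \<le> i \<and> i \<le> 103 then 2 else if 105 \<le> i \<and> i \<le> 114 then 3 else 4)"

text \<open>The weight of a triangle depends on the kinds of its corners and on where they lie with respect to the
  three antidiagonals \<open>172\<close>, \<open>188\<close>, \<open>192\<close> along which the zigzags run. The two triangulations of a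
  quadrilateral have total weights that differ by at most one, whereas the zigzags of \<open>T\<^sub>1\<close> weigh \<open>-7\<close> and
  those of \<open>T\<^sub>2\<close> weigh \<open>48\<close>.\<close>

definition pot :: "int \<Rightarrow> int \<Rightarrow> int \<Rightarrow> int" where
  "pot p q r =
    (let k = (kind p, kind q, kind r) in
     if k = (0, 0, 1) then - of_bool (p + r < 172 \<and> 172 \<le> q + r)
     else if k = (0, 0, 3) then 1 + of_bool (p + r < 192 \<and> 192 \<le> q + r)
     else if k = (0, 1, 2) then of_bool (188 < q + r)
     else if k = (0, 1, 3) then of_bool (p + q < 172) - of_bool (192 \<le> p + r)
     else if k = (0, 2, 3) then - of_bool (192 \<le> p + r)
     else if k = (1, 1, 2) then 1 + of_bool (p + r \<le> 188 \<and> 188 < q + r)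
     else if k = (1, 2, 3) then of_bool (188 < p + q)
     else of_bool (k \<in> {(0, 2, 2), (0, 3, 3), (1, 2, 2), (1, 3, 3), (2, 2, 3), (2, 3, 3)}))"

lemma kind_mono: "\<lbrakk>2 \<le> p; p < q; q \<le> 114; p \<noteq> 104; q \<noteq> 104\<rbrakk> \<Longrightarrow> kind p \<le> kind q"
  by (auto simp: kind_def)

lemma kind_cases: "\<lbrakk>2 \<le> p; p \<le> 114; p \<noteq> 104\<rbrakk> \<Longrightarrow> kind p = 0 \<or> kind p = 1 \<or> kind p = 2 \<or> kind p = 3"
  by (auto simp: kind_def)

lemma pot_eqs:
  "\<lbrakk>kind p = 0; kind q = 0; kind r = 1\<rbrakk> \<Longrightarrow> pot p q r = (if p + r < 172 \<and> 172 \<le> q + r then - 1 else 0)"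
  "\<lbrakk>kind p = 0; kind q = 0; kind r = 3\<rbrakk> \<Longrightarrow> pot p q r = (if p + r < 192 \<and> 192 \<le> q + r then 2 else 1)"
  "\<lbrakk>kind p = 0; kind q = 1; kind r = 2\<rbrakk> \<Longrightarrow> pot p q r = (if 188 < q + r then 1 else 0)"
  "\<lbrakk>kind p = 0; kind q = 1; kind r = 3\<rbrakk> \<Longrightarrow> pot p q r = (if p + q < 172 then 1 else 0) - (if 192 \<le> p + r then 1 else 0)"
  "\<lbrakk>kind p = 0; kind q = 2; kind r = 3\<rbrakk> \<Longrightarrow> pot p q r = (if 192 \<le> p + r then - 1 else 0)"
  "\<lbrakk>kind p = 1; kind q = 1; kind r = 2\<rbrakk> \<Longrightarrow> pot p q r = (if p + r \<le> 188 \<and> 188 < q + r then 2 else 1)"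
  "\<lbrakk>kind p = 1; kind q = 2; kind r = 3\<rbrakk> \<Longrightarrow> pot p q r = (if 188 < p + q then 1 else 0)"
  by (simp_all add: pot_def)

lemma pot_const:
  "\<lbrakk>kind p = 0; kind q = 2; kind r = 2\<rbrakk> \<Longrightarrow> pot p q r = 1"
  "\<lbrakk>kind p = 0; kind q = 3; kind r = 3\<rbrakk> \<Longrightarrow> pot p q r = 1"
  "\<lbrakk>kind p = 1; kind q = 2; kind r = 2\<rbrakk> \<Longrightarrow> pot p q r = 1"
  "\<lbrakk>kind p = 1; kind q = 3; kind r = 3\<rbrakk> \<Longrightarrow> pot p q r = 1"
  "\<lbrakk>kind p = 2; kind q = 2; kind r = 3\<rbrakk> \<Longrightarrow> pot p q r = 1"
  "\<lbrakk>kind p = 2; kind q = 3; kind r = 3\<rbrakk> \<Longrightarrow> pot p q r = 1"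
  "\<lbrakk>kind p = 0; kind q = 0; kind r = 0\<rbrakk> \<Longrightarrow> pot p q r = 0"
  "\<lbrakk>kind p = 0; kind q = 0; kind r = 2\<rbrakk> \<Longrightarrow> pot p q r = 0"
  "\<lbrakk>kind p = 0; kind q = 1; kind r = 1\<rbrakk> \<Longrightarrow> pot p q r = 0"
  "\<lbrakk>kind p = 1; kind q = 1; kind r = 1\<rbrakk> \<Longrightarrow> pot p q r = 0"
  "\<lbrakk>kind p = 1; kind q = 1; kind r = 3\<rbrakk> \<Longrightarrow> pot p q r = 0"
  "\<lbrakk>kind p = 2; kind q = 2; kind r = 2\<rbrakk> \<Longrightarrow> pot p q r = 0"
  "\<lbrakk>kind p = 3; kind q = 3; kind r = 3\<rbrakk> \<Longrightarrow> pot p q r = 0"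
  by (simp_all add: pot_def)

text \<open>The potential is constant on most kinds, so the claim reduces to a finite list of inequalities between
  the positions of the corners relative to the antidiagonals.\<close>

lemma pot_quad_kinds:
  assumes "p < q" "q < r" "r < s"
  shows
    "\<lbrakk>kind p = 0; kind q = 0; kind r = 0; kind s = 0\<rbrakk> \<Longrightarrow> \<bar>pot p q r + pot p r s - pot p q s - pot q r s\<bar> \<le> 1"
    "\<lbrakk>kind p = 0; kind q = 0; kind r = 0; kind s = 1\<rbrakk> \<Longrightarrow> \<bar>pot p q r + pot p r s - pot p q s - pot q r s\<bar> \<le> 1"
    "\<lbrakk>kind p = 0; kind q = 0; kind r = 0; kind s = 2\<rbrakk> \<Longrightarrow> \<bar>pot p q r + pot p r s - pot p q s - pot q r s\<bar> \<le> 1"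
    "\<lbrakk>kind p = 0; kind q = 0; kind r = 0; kind s = 3\<rbrakk> \<Longrightarrow> \<bar>pot p q r + pot p r s - pot p q s - pot q r s\<bar> \<le> 1"
    "\<lbrakk>kind p = 0; kind q = 0; kind r = 1; kind s = 1\<rbrakk> \<Longrightarrow> \<bar>pot p q r + pot p r s - pot p q s - pot q r s\<bar> \<le> 1"
    "\<lbrakk>kind p = 0; kind q = 0; kind r = 1; kind s = 2\<rbrakk> \<Longrightarrow> \<bar>pot p q r + pot p r s - pot p q s - pot q r s\<bar> \<le> 1"
    "\<lbrakk>kind p = 0; kind q = 0; kind r = 1; kind s = 3\<rbrakk> \<Longrightarrow> \<bar>pot p q r + pot p r s - pot p q s - pot q r s\<bar> \<le> 1"
    "\<lbrakk>kind p = 0; kind q = 0; kind r = 2; kind s = 2\<rbrakk> \<Longrightarrow> \<bar>pot p q r + pot p r s - pot p q s - pot q r s\<bar> \<le> 1"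
    "\<lbrakk>kind p = 0; kind q = 0; kind r = 2; kind s = 3\<rbrakk> \<Longrightarrow> \<bar>pot p q r + pot p r s - pot p q s - pot q r s\<bar> \<le> 1"
    "\<lbrakk>kind p = 0; kind q = 0; kind r = 3; kind s = 3\<rbrakk> \<Longrightarrow> \<bar>pot p q r + pot p r s - pot p q s - pot q r s\<bar> \<le> 1"
    "\<lbrakk>kind p = 0; kind q = 1; kind r = 1; kind s = 1\<rbrakk> \<Longrightarrow> \<bar>pot p q r + pot p r s - pot p q s - pot q r s\<bar> \<le> 1"
    "\<lbrakk>kind p = 0; kind q = 1; kind r = 1; kind s = 2\<rbrakk> \<Longrightarrow> \<bar>pot p q r + pot p r s - pot p q s - pot q r s\<bar> \<le> 1"
    "\<lbrakk>kind p = 0; kind q = 1; kind r = 1; kind s = 3\<rbrakk> \<Longrightarrow> \<bar>pot p q r + pot p r s - pot p q s - pot q r s\<bar> \<le> 1"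
    "\<lbrakk>kind p = 0; kind q = 1; kind r = 2; kind s = 2\<rbrakk> \<Longrightarrow> \<bar>pot p q r + pot p r s - pot p q s - pot q r s\<bar> \<le> 1"
    "\<lbrakk>kind p = 0; kind q = 1; kind r = 2; kind s = 3\<rbrakk> \<Longrightarrow> \<bar>pot p q r + pot p r s - pot p q s - pot q r s\<bar> \<le> 1"
    "\<lbrakk>kind p = 0; kind q = 1; kind r = 3; kind s = 3\<rbrakk> \<Longrightarrow> \<bar>pot p q r + pot p r s - pot p q s - pot q r s\<bar> \<le> 1"
    "\<lbrakk>kind p = 0; kind q = 2; kind r = 2; kind s = 2\<rbrakk> \<Longrightarrow> \<bar>pot p q r + pot p r s - pot p q s - pot q r s\<bar> \<le> 1"
    "\<lbrakk>kind p = 0; kind q = 2; kind r = 2; kind s = 3\<rbrakk> \<Longrightarrow> \<bar>pot p q r + pot p r s - pot p q s - pot q r s\<bar> \<le> 1"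
    "\<lbrakk>kind p = 0; kind q = 2; kind r = 3; kind s = 3\<rbrakk> \<Longrightarrow> \<bar>pot p q r + pot p r s - pot p q s - pot q r s\<bar> \<le> 1"
    "\<lbrakk>kind p = 0; kind q = 3; kind r = 3; kind s = 3\<rbrakk> \<Longrightarrow> \<bar>pot p q r + pot p r s - pot p q s - pot q r s\<bar> \<le> 1"
    "\<lbrakk>kind p = 1; kind q = 1; kind r = 1; kind s = 1\<rbrakk> \<Longrightarrow> \<bar>pot p q r + pot p r s - pot p q s - pot q r s\<bar> \<le> 1"
    "\<lbrakk>kind p = 1; kind q = 1; kind r = 1; kind s = 2\<rbrakk> \<Longrightarrow> \<bar>pot p q r + pot p r s - pot p q s - pot q r s\<bar> \<le> 1"
    "\<lbrakk>kind p = 1; kind q = 1; kind r = 1; kind s = 3\<rbrakk> \<Longrightarrow> \<bar>pot p q r + pot p r s - pot p q s - pot q r s\<bar> \<le> 1"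
    "\<lbrakk>kind p = 1; kind q = 1; kind r = 2; kind s = 2\<rbrakk> \<Longrightarrow> \<bar>pot p q r + pot p r s - pot p q s - pot q r s\<bar> \<le> 1"
    "\<lbrakk>kind p = 1; kind q = 1; kind r = 2; kind s = 3\<rbrakk> \<Longrightarrow> \<bar>pot p q r + pot p r s - pot p q s - pot q r s\<bar> \<le> 1"
    "\<lbrakk>kind p = 1; kind q = 1; kind r = 3; kind s = 3\<rbrakk> \<Longrightarrow> \<bar>pot p q r + pot p r s - pot p q s - pot q r s\<bar> \<le> 1"
    "\<lbrakk>kind p = 1; kind q = 2; kind r = 2; kind s = 2\<rbrakk> \<Longrightarrow> \<bar>pot p q r + pot p r s - pot p q s - pot q r s\<bar> \<le> 1"
    "\<lbrakk>kind p = 1; kind q = 2; kind r = 2; kind s = 3\<rbrakk> \<Longrightarrow> \<bar>pot p q r + pot p r s - pot p q s - pot q r s\<bar> \<le> 1"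
    "\<lbrakk>kind p = 1; kind q = 2; kind r = 3; kind s = 3\<rbrakk> \<Longrightarrow> \<bar>pot p q r + pot p r s - pot p q s - pot q r s\<bar> \<le> 1"
    "\<lbrakk>kind p = 1; kind q = 3; kind r = 3; kind s = 3\<rbrakk> \<Longrightarrow> \<bar>pot p q r + pot p r s - pot p q s - pot q r s\<bar> \<le> 1"
    "\<lbrakk>kind p = 2; kind q = 2; kind r = 2; kind s = 2\<rbrakk> \<Longrightarrow> \<bar>pot p q r + pot p r s - pot p q s - pot q r s\<bar> \<le> 1"
    "\<lbrakk>kind p = 2; kind q = 2; kind r = 2; kind s = 3\<rbrakk> \<Longrightarrow> \<bar>pot p q r + pot p r s - pot p q s - pot q r s\<bar> \<le> 1"
    "\<lbrakk>kind p = 2; kind q = 2; kind r = 3; kind s = 3\<rbrakk> \<Longrightarrow> \<bar>pot p q r + pot p r s - pot p q s - pot q r s\<bar> \<le> 1"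
    "\<lbrakk>kind p = 2; kind q = 3; kind r = 3; kind s = 3\<rbrakk> \<Longrightarrow> \<bar>pot p q r + pot p r s - pot p q s - pot q r s\<bar> \<le> 1"
    "\<lbrakk>kind p = 3; kind q = 3; kind r = 3; kind s = 3\<rbrakk> \<Longrightarrow> \<bar>pot p q r + pot p r s - pot p q s - pot q r s\<bar> \<le> 1"
  using assms by (simp_all add: pot_eqs pot_const)

lemma pot_quad:
  assumes "2 \<le> p" "p < q" "q < r" "r < s" "s \<le> 114" "p \<noteq> 104" "q \<noteq> 104" "r \<noteq> 104" "s \<noteq> 104"
  shows "\<bar>pot p q r + pot p r s - pot p q s - pot q r s\<bar> \<le> 1"
proof -
  have k: "kind p = 0 \<or> kind p = 1 \<or> kind p = 2 \<or> kind p = 3" "kind q = 0 \<or> kind q = 1 \<or> kind q = 2 \<or> kind q = 3"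
    "kind r = 0 \<or> kind r = 1 \<or> kind r = 2 \<or> kind r = 3" "kind s = 0 \<or> kind s = 1 \<or> kind s = 2 \<or> kind s = 3"
    using kind_cases assms by auto
  have m: "kind p \<le> kind q" "kind q \<le> kind r" "kind r \<le> kind s"
    using kind_mono assms by auto
  show ?thesis using k
    by (elim disjE) ((rule pot_quad_kinds[OF assms(2-4)]; assumption) | (use m in simp))+
qed

type_synonym arcs = "(int \<times> int) set"

definition triangles :: "arcs \<Rightarrow> int \<Rightarrow> int \<Rightarrow> (int \<times> int \<times> int) set" where
  "triangles T l h = {(p, q, r). l \<le> p \<and> p < q \<and> q < r \<and> r \<le> h \<and> (p, q) \<in> T \<and> (q, r) \<in> T \<and> (p, r) \<in> T}"

text \<open>For \<open>(l, h)\<close> in a triangulation, this is the total weight of the triangles on the inner side of that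
  chord.\<close>

definition potsum :: "arcs \<Rightarrow> int \<Rightarrow> int \<Rightarrow> int" where
  "potsum T l h = (\<Sum>(p, q, r)\<in>triangles T l h. pot p q r)"

lemma finite_triangles [simp]: "finite (triangles T l h)"
proof -
  have "triangles T l h \<subseteq> {l..h} \<times> {l..h} \<times> {l..h}" by (auto simp: triangles_def)
  then show ?thesis by (rule finite_subset) auto
qed

lemma potsum_edge: "potsum T i (i + 1) = 0"
proof -
  have "triangles T i (i + 1) = {}" by (auto simp: triangles_def)
  then show ?thesis by (simp add: potsum_def)
qed

text \<open>The triangle resting on the chord \<open>(l, h)\<close> separates the remaining ones.\<close>

lemma potsum_split:
  assumes nc: "\<And>e f. e \<in> T \<Longrightarrow> f \<in> T \<Longrightarrow> \<not> crosses e f"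
    and o: "l < m" "m < h" and T: "(l, m) \<in> T" "(m, h) \<in> T" "(l, h) \<in> T"
  shows "potsum T l h = pot l m h + potsum T l m + potsum T m h"
proof -
  have eq: "triangles T l h = insert (l, m, h) (triangles T l m \<union> triangles T m h)" (is "?L = ?R")
  proof (rule set_eqI)
    fix t :: "int \<times> int \<times> int" obtain p q r where t: "t = (p, q, r)" by (cases t) auto
    show "t \<in> ?L \<longleftrightarrow> t \<in> ?R"
    proof
      assume L: "t \<in> ?L"
      then have 1: "l \<le> p" "p < q" "q < r" "r \<le> h" "(p, q) \<in> T" "(q, r) \<in> T" "(p, r) \<in> T"
        by (auto simp: triangles_def t)
      show "t \<in> ?R"
      proof (cases "r \<le> m \<or> m \<le> p")
        case True then show ?thesis using 1 by (auto simp: triangles_def t)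
      next
        case False
        have "p = l" "r = h" using nc[OF 1(7) T(1)] nc[OF 1(7) T(2)] False 1 o by (auto simp: crosses_def)
        moreover from this have "q = m"
          using nc[OF 1(6) T(1)] nc[OF 1(5) T(2)] 1 o by (auto simp: crosses_def)
        ultimately show ?thesis by (simp add: t)
      qed
    next
      assume "t \<in> ?R" then show "t \<in> ?L" using T o by (auto simp: triangles_def t)
    qed
  qed
  have d: "triangles T l m \<inter> triangles T m h = {}" "(l, m, h) \<notin> triangles T l m \<union> triangles T m h"
    using o by (auto simp: triangles_def)
  show ?thesis unfolding potsum_def eq using d by (simp add: sum.union_disjoint)
qed

lemma triangles_through:
  assumes nc: "\<And>e f. e \<in> T \<Longrightarrow> f \<in> T \<Longrightarrow> \<not> crosses e f"
    and o: "a < b" "b < c" "c < d"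
    and s: "(a, b) \<in> T" "(b, c) \<in> T" "(c, d) \<in> T" "(a, d) \<in> T"
    and t: "p < q" "q < r" "(p, q) \<in> T" "(q, r) \<in> T" "(p, r) \<in> T"
    and e: "(a, c) \<in> {(p, q), (q, r), (p, r)} \<or> (b, d) \<in> {(p, q), (q, r), (p, r)}"
  shows "(p, q, r) \<in> {(a, b, c), (a, c, d), (a, b, d), (b, c, d)}"
proof -
  have x: "\<not> crosses (a, b) (p, q)" "\<not> crosses (a, b) (q, r)" "\<not> crosses (a, b) (p, r)"
    "\<not> crosses (b, c) (p, q)" "\<not> crosses (b, c) (q, r)" "\<not> crosses (b, c) (p, r)"
    "\<not> crosses (c, d) (p, q)" "\<not> crosses (c, d) (q, r)" "\<not> crosses (c, d) (p, r)"
    "\<not> crosses (a, d) (p, q)" "\<not> crosses (a, d) (q, r)" "\<not> crosses (a, d) (p, r)"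
    using nc s t by auto
  consider "p = a" "q = c" | "q = a" "r = c" | "p = a" "r = c" | "p = b" "q = d" | "q = b" "r = d" | "p = b" "r = d"
    using e by auto
  then show ?thesis using x o t(1,2) by cases (auto simp: crosses_def)
qed

lemma potsum_insert_ac:
  assumes nc: "\<And>g h. g \<in> insert (a, c) S \<Longrightarrow> h \<in> insert (a, c) S \<Longrightarrow> \<not> crosses g h"
    and n: "(a, c) \<notin> S" "(b, d) \<notin> S" and o: "a < b" "b < c" "c < d"
    and s: "(a, b) \<in> S" "(b, c) \<in> S" "(c, d) \<in> S" "(a, d) \<in> S" and lh: "l \<le> a" "d \<le> h"
  shows "potsum (insert (a, c) S) l h = pot a b c + pot a c d + potsum S l h"
proof -
  let ?T = "insert (a, c) S" and ?A = "(a, b, c)" and ?B = "(a, c, d)"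
  have "t \<in> triangles ?T l h \<longleftrightarrow> t \<in> insert ?A (insert ?B (triangles S l h))" for t :: "int \<times> int \<times> int"
  proof -
    obtain p q r where t: "t = (p, q, r)" by (cases t) auto
    have "t \<in> insert ?A (insert ?B (triangles S l h))" if L: "t \<in> triangles ?T l h"
    proof -
      have 1: "p < q" "q < r" "(p, q) \<in> ?T" "(q, r) \<in> ?T" "(p, r) \<in> ?T" "l \<le> p" "r \<le> h"
        using L unfolding triangles_def t by blast+
      show ?thesis
      proof (cases "(a, c) \<in> {(p, q), (q, r), (p, r)}")
        case True
        have "(p, q, r) \<in> {(a, b, c), (a, c, d), (a, b, d), (b, c, d)}"
          by (rule triangles_through[OF nc o, where p=p and q=q and r=r]) (use s 1 True in blast)+
        then show ?thesis using n(2) 1 t o by auto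
      next
        case False then show ?thesis using 1 unfolding triangles_def t by blast
      qed
    qed
    moreover have "?A \<in> triangles ?T l h" "?B \<in> triangles ?T l h" using s o lh by (auto simp: triangles_def)
    moreover have "triangles S l h \<subseteq> triangles ?T l h" by (auto simp: triangles_def)
    ultimately show ?thesis by blast
  qed
  then have eq: "triangles ?T l h = insert ?A (insert ?B (triangles S l h))" by blast
  have "?A \<notin> triangles S l h" "?B \<notin> triangles S l h" using n by (auto simp: triangles_def)
  then show ?thesis unfolding potsum_def eq using o by auto
qed

lemma potsum_insert_bd:
  assumes nc: "\<And>g h. g \<in> insert (b, d) S \<Longrightarrow> h \<in> insert (b, d) S \<Longrightarrow> \<not> crosses g h"
    and n: "(b, d) \<notin> S" "(a, c) \<notin> S" and o: "a < b" "b < c" "c < d"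
    and s: "(a, b) \<in> S" "(b, c) \<in> S" "(c, d) \<in> S" "(a, d) \<in> S" and lh: "l \<le> a" "d \<le> h"
  shows "potsum (insert (b, d) S) l h = pot a b d + pot b c d + potsum S l h"
proof -
  let ?T = "insert (b, d) S" and ?A = "(a, b, d)" and ?B = "(b, c, d)"
  have "t \<in> triangles ?T l h \<longleftrightarrow> t \<in> insert ?A (insert ?B (triangles S l h))" for t :: "int \<times> int \<times> int"
  proof -
    obtain p q r where t: "t = (p, q, r)" by (cases t) auto
    have "t \<in> insert ?A (insert ?B (triangles S l h))" if L: "t \<in> triangles ?T l h"
    proof -
      have 1: "p < q" "q < r" "(p, q) \<in> ?T" "(q, r) \<in> ?T" "(p, r) \<in> ?T" "l \<le> p" "r \<le> h"
        using L unfolding triangles_def t by blast+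
      show ?thesis
      proof (cases "(b, d) \<in> {(p, q), (q, r), (p, r)}")
        case True
        have "(p, q, r) \<in> {(a, b, c), (a, c, d), (a, b, d), (b, c, d)}"
          by (rule triangles_through[OF nc o, where p=p and q=q and r=r]) (use s 1 True in blast)+
        then show ?thesis using n(2) 1 t o by auto
      next
        case False then show ?thesis using 1 unfolding triangles_def t by blast
      qed
    qed
    moreover have "?A \<in> triangles ?T l h" "?B \<in> triangles ?T l h" using s o lh by (auto simp: triangles_def)
    moreover have "triangles S l h \<subseteq> triangles ?T l h" by (auto simp: triangles_def)
    ultimately show ?thesis by blast
  qed
  then have eq: "triangles ?T l h = insert ?A (insert ?B (triangles S l h))" by blast
  have "?A \<notin> triangles S l h" "?B \<notin> triangles S l h" using n by (auto simp: triangles_def)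
  then show ?thesis unfolding potsum_def eq using o by auto
qed

text \<open>Only the two triangles on either side of the flipped arc are affected.\<close>

lemma potsum_flip:
  assumes nc: "\<And>g h. g \<in> T \<Longrightarrow> h \<in> T \<Longrightarrow> \<not> crosses g h"
    and nc': "\<And>g h. g \<in> T' \<Longrightarrow> h \<in> T' \<Longrightarrow> \<not> crosses g h"
    and T': "T' = insert f (T - {e})" and eT: "e \<in> T" "f \<notin> T" and o: "a < b" "b < c" "c < d"
    and ef: "e = (a, c) \<and> f = (b, d) \<or> e = (b, d) \<and> f = (a, c)"
    and s: "(a, b) \<in> T - {e}" "(b, c) \<in> T - {e}" "(c, d) \<in> T - {e}" "(a, d) \<in> T - {e}"
    and lh: "l \<le> a" "d \<le> h"
  shows "\<bar>potsum T' l h - potsum T l h\<bar> = \<bar>pot a b c + pot a c d - pot a b d - pot b c d\<bar>"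
proof -
  define S where "S = T - {e}"
  have TS: "T = insert e S" "T' = insert f S" "e \<notin> S" "f \<notin> S" using eT T' by (auto simp: S_def)
  note s' = s[folded S_def]
  from ef show ?thesis
  proof
    assume ef: "e = (a, c) \<and> f = (b, d)"
    have T1: "T = insert (a, c) S" "T' = insert (b, d) S" "(a, c) \<notin> S" "(b, d) \<notin> S" using TS ef by simp_all
    have "potsum T l h = pot a b c + pot a c d + potsum S l h"
      unfolding T1(1) by (rule potsum_insert_ac[OF nc[unfolded T1(1)] T1(3,4) o s' lh])
    moreover have "potsum T' l h = pot a b d + pot b c d + potsum S l h"
      unfolding T1(2) by (rule potsum_insert_bd[OF nc'[unfolded T1(2)] T1(4,3) o s' lh])
    ultimately have "potsum T' l h - potsum T l h = - (pot a b c + pot a c d - pot a b d - pot b c d)" by simp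
    then show ?thesis by (simp only: abs_minus_cancel)
  next
    assume ef: "e = (b, d) \<and> f = (a, c)"
    have T1: "T = insert (b, d) S" "T' = insert (a, c) S" "(a, c) \<notin> S" "(b, d) \<notin> S" using TS ef by simp_all
    have "potsum T' l h = pot a b c + pot a c d + potsum S l h"
      unfolding T1(2) by (rule potsum_insert_ac[OF nc'[unfolded T1(2)] T1(3,4) o s' lh])
    moreover have "potsum T l h = pot a b d + pot b c d + potsum S l h"
      unfolding T1(1) by (rule potsum_insert_bd[OF nc[unfolded T1(1)] T1(4,3) o s' lh])
    ultimately have "potsum T' l h - potsum T l h = pot a b c + pot a c d - pot a b d - pot b c d" by simp
    then show ?thesis by (simp only:)
  qed
qed

section \<open>Walks that keep the arc need 152 flips\<close>

lemma boundary_edges: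
  assumes "gad.tri T" shows "0 \<le> i \<Longrightarrow> i \<le> 114 \<Longrightarrow> (i, i + 1) \<in> T" "(0, 115) \<in> T"
proof -
  have lt: "(a, b) \<in> T \<Longrightarrow> 0 \<le> a \<and> a < b \<and> b \<le> 115" for a b
    using gad.tri_arc[OF assms, of "(a, b)"] by (auto simp: gad_arcs_def)
  show "(i, i + 1) \<in> T" if "0 \<le> i" "i \<le> 114"
    by (rule gad.tri_maximal[OF assms]) (use that in \<open>auto simp: gad_arcs_def sees_def crosses_def\<close>)
  show "(0, 115) \<in> T"
  proof (rule gad.tri_maximal[OF assms])
    show "(0, 115) \<in> gad_arcs" by (simp add: gad_arcs_def sees_def)
    fix f assume "f \<in> T"
    then show "\<not> crosses (0, 115) f" using lt[of "fst f" "snd f"] by (simp add: crosses_def)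
  qed
qed

lemma set_held: "gad.tri T \<Longrightarrow> set L \<subseteq> T \<Longrightarrow> held L (i, j) \<Longrightarrow> 0 \<le> i \<Longrightarrow> j \<le> 115 \<Longrightarrow> (i, j) \<in> T"
  unfolding held_def List.member_iff fst_conv snd_conv
proof (elim disjE)
  assume "gad.tri T" "j = i + 1" "0 \<le> i" "j \<le> 115" then show ?thesis using boundary_edges(1)[of T i] by simp
next
  assume "gad.tri T" "(i, j) = (0, 115)" then show ?thesis using boundary_edges(2)[of T] by simp
next
  assume "set L \<subseteq> T" "(i, j) \<in> set L" then show ?thesis by blast
qed

text \<open>The last conjunct records that a first entry with \<open>r = False\<close> removes its diagonal \<open>(b, d)\<close>, here \<open>\<epsilon>\<close>.\<close>

lemma run_flips_path:
  assumes "gad.tri T" "set L \<subseteq> T" "run_flips L qs = Some L'"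
  shows "\<exists>Ts. Ts 0 = T \<and> (\<forall>k \<le> length qs. gad.tri (Ts k)) \<and>
    (\<forall>k < length qs. flip_step (Ts k) (Ts (Suc k))) \<and> set L' \<subseteq> Ts (length qs) \<and>
    (\<forall>a b c d qs'. qs = (a, b, c, d, False) # qs' \<longrightarrow> (b, d) \<notin> Ts 1)"
  using assms
proof (induction qs arbitrary: T L)
  case Nil
  then show ?case by (intro exI[of _ "\<lambda>_. T"]) auto
next
  case (Cons q qs)
  obtain a b c d r where q: "q = (a, b, c, d, r)" by (cases q) auto
  define e where "e = (if r then (a, c) else (b, d))"
  define f where "f = (if r then (b, d) else (a, c))"
  have P: "(if 0 \<le> a \<and> a < b \<and> b < c \<and> c < d \<and> d \<le> 115 \<and> sees (fst f) (snd f) \<and> held L e \<and>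
      held L (a, b) \<and> held L (b, c) \<and> held L (c, d) \<and> held L (a, d)
    then run_flips (f # removeAll e L) qs else None) = Some L'"
    using Cons.prems(3) unfolding q e_def f_def by (simp only: run_flips.simps Let_def)
  have c: "0 \<le> a" "a < b" "b < c" "c < d" "d \<le> 115" "sees (fst f) (snd f)" "held L e"
    "held L (a, b)" "held L (b, c)" "held L (c, d)" "held L (a, d)"
    "run_flips (f # removeAll e L) qs = Some L'"
    by (rule ccontr, use P in \<open>simp split: if_split_asm\<close>)+
  have sh: "held L (i, j) \<Longrightarrow> 0 \<le> i \<Longrightarrow> j \<le> 115 \<Longrightarrow> (i, j) \<in> T" for i j
    by (rule set_held[OF Cons.prems(1,2)])
  have T: "(a, b) \<in> T" "(b, c) \<in> T" "(c, d) \<in> T" "(a, d) \<in> T" 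
    by (rule sh; use c(1-5,8-11) in simp)+
  have T5: "e \<in> T"
    using c(7) sh[of a c] sh[of b d] c(1-5) unfolding e_def by (simp split: if_split_asm)
  have ef: "e = (a, c) \<and> f = (b, d) \<or> e = (b, d) \<and> f = (a, c)" by (auto simp: e_def f_def)
  have fA: "f \<in> gad_arcs" using c(1-6) ef unfolding gad_arcs_def by fastforce
  have T': "gad.tri (insert f (T - {e}))" "f \<notin> T"
    using gad.flip_tri[OF Cons.prems(1) c(2-4) ef fA T5 T] by blast+
  have sub: "set (f # removeAll e L) \<subseteq> insert f (T - {e})" using Cons.prems(2) by auto
  obtain Us where U: "Us 0 = insert f (T - {e})" "\<forall>k \<le> length qs. gad.tri (Us k)"
    "\<forall>k < length qs. flip_step (Us k) (Us (Suc k))" "set L' \<subseteq> Us (length qs)"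
    using Cons.IH[OF T'(1) sub c(12)] by blast
  define Ts where "Ts k = (case k of 0 \<Rightarrow> T | Suc k' \<Rightarrow> Us k')" for k
  have "flip_step T (Us 0)" unfolding flip_step_def U(1) using T5 T'(2) by blast
  then have "\<forall>k < length (q # qs). flip_step (Ts k) (Ts (Suc k))"
    using U(3) by (auto simp: Ts_def split: nat.split)
  moreover have "\<forall>k \<le> length (q # qs). gad.tri (Ts k)"
    using U(2) Cons.prems(1) by (auto simp: Ts_def split: nat.split)
  moreover have "(b, d) \<notin> Ts 1" if "\<not> r"
    using that U(1) T5 T'(2) by (auto simp: Ts_def e_def f_def)
  moreover have "Ts 0 = T" "Ts (length (q # qs)) = Us (length qs)" by (simp_all add: Ts_def)
  ultimately show ?case using U(4) q by (intro exI[of _ Ts]) simp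
qed

lemma first_removal:
  fixes Ts :: "nat \<Rightarrow> 'b set"
  assumes "e \<in> Ts i" "e \<notin> Ts j" "i \<le> j"
  obtains s where "i \<le> s" "s < j" "\<And>s'. i \<le> s' \<Longrightarrow> s' \<le> s \<Longrightarrow> e \<in> Ts s'" "e \<notin> Ts (Suc s)"
proof -
  define u where "u = (LEAST u. i \<le> u \<and> e \<notin> Ts u)"
  have u: "i \<le> u" "e \<notin> Ts u" unfolding u_def using LeastI[of "\<lambda>u. i \<le> u \<and> e \<notin> Ts u" j] assms by auto
  have l: "e \<in> Ts s'" if "i \<le> s'" "s' < u" for s'
    using not_less_Least[of s' "\<lambda>u. i \<le> u \<and> e \<notin> Ts u"] that unfolding u_def by blast
  have "u \<le> j" unfolding u_def by (rule Least_le) (use assms in auto)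
  have "u \<noteq> i" using u assms by auto
  then show ?thesis using that[of "u - 1"] u l \<open>u \<le> j\<close> by (auto simp: Suc_diff_1)
qed

lemma last_insertion:
  fixes Ts :: "nat \<Rightarrow> 'b set"
  assumes "e \<notin> Ts i" "e \<in> Ts j" "i \<le> j"
  obtains s where "i \<le> s" "s < j" "e \<notin> Ts s" "\<And>s'. s < s' \<Longrightarrow> s' \<le> j \<Longrightarrow> e \<in> Ts s'"
proof -
  define s where "s = (GREATEST s. s < j \<and> e \<notin> Ts s)"
  have ex: "i < j \<and> e \<notin> Ts i" using assms by (cases "i = j") auto
  have s: "s < j \<and> e \<notin> Ts s" unfolding s_def by (rule GreatestI_nat[of _ i j]) (use ex in auto)
  have g: "s' \<le> s" if "s' < j" "e \<notin> Ts s'" for s'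
    unfolding s_def by (rule Greatest_le_nat[of _ _ j]) (use that in auto)
  have "e \<in> Ts s'" if "s < s'" "s' \<le> j" for s'
    using g[of s'] that assms by (cases "s' = j") force+
  then show ?thesis using that[of s] s g[of i] ex by auto
qed

text \<open>Restricting a geodesic of a larger polygon to the gadget gives a sequence of triangulations in which
  some steps change nothing; this is why stationary steps are admitted.\<close>

locale gad_walk =
  fixes Ts :: "nat \<Rightarrow> arcs" and n :: nat
  assumes tris: "s \<le> n \<Longrightarrow> gad.tri (Ts s)"
    and eps: "s \<le> n \<Longrightarrow> (103, 105) \<in> Ts s"
    and steps: "s < n \<Longrightarrow> Ts (Suc s) = Ts s \<or> flip_step (Ts s) (Ts (Suc s))"
begin

definition rm :: "nat \<Rightarrow> int \<times> int \<Rightarrow> bool" where "rm s e \<longleftrightarrow> s < n \<and> e \<in> Ts s \<and> e \<notin> Ts (Suc s)"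
definition ad :: "nat \<Rightarrow> int \<times> int \<Rightarrow> bool" where "ad s f \<longleftrightarrow> s < n \<and> f \<notin> Ts s \<and> f \<in> Ts (Suc s)"
text \<open>The step \<open>s\<close> is a flip inside the chord \<open>(l, h)\<close>.\<close>

definition flip_inside :: "int \<Rightarrow> int \<Rightarrow> nat \<Rightarrow> bool" where
  "flip_inside l h s \<longleftrightarrow> (\<exists>e f. rm s e \<and> ad s f \<and> l \<le> fst e \<and> snd e \<le> h \<and> l \<le> fst f \<and> snd f \<le> h)"

lemma step_cases:
  assumes "s < n"
  obtains "Ts (Suc s) = Ts s" | e f where "rm s e" "ad s f" "Ts (Suc s) = insert f (Ts s - {e})"
proof (cases "Ts (Suc s) = Ts s")
  case False
  then obtain e f where "e \<in> Ts s" "f \<notin> Ts s" "Ts (Suc s) = insert f (Ts s - {e})"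
    using steps[OF assms] by (auto simp: flip_step_def)
  then have "rm s e" "ad s f" using assms by (auto simp: rm_def ad_def)
  then show ?thesis using that \<open>Ts (Suc s) = insert f (Ts s - {e})\<close> by blast
qed (use that in blast)

lemma rm_unique: "rm s e \<Longrightarrow> rm s e' \<Longrightarrow> e = e'"
  using steps[of s] by (auto simp: rm_def flip_step_def)

lemma ad_unique: "ad s e \<Longrightarrow> ad s e' \<Longrightarrow> e = e'"
  using steps[of s] by (auto simp: ad_def flip_step_def)

lemma ad_imp_rm:
  assumes "ad s f" shows "\<exists>e. rm s e \<and> Ts (Suc s) = insert f (Ts s - {e})"
proof -
  have "s < n" using assms by (simp add: ad_def)
  then show ?thesis
  proof (cases rule: step_cases)
    case 1 then show ?thesis using assms by (simp add: ad_def)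
  next
    case (2 e f') then show ?thesis using ad_unique[OF assms 2(2)] by blast
  qed
qed

lemma quad:
  assumes "rm s e" "ad s f"
  obtains a b c d where "a < b" "b < c" "c < d" "e = (a, c) \<and> f = (b, d) \<or> e = (b, d) \<and> f = (a, c)"
    "(a, b) \<in> Ts s - {e}" "(b, c) \<in> Ts s - {e}" "(c, d) \<in> Ts s - {e}" "(a, d) \<in> Ts s - {e}"
    "Ts (Suc s) = insert f (Ts s - {e})" "e \<in> Ts s" "f \<notin> Ts s"
proof -
  have s: "s < n" using assms by (simp add: rm_def)
  obtain e' where e': "rm s e'" "Ts (Suc s) = insert f (Ts s - {e'})" using ad_imp_rm[OF assms(2)] by blast
  have E: "Ts (Suc s) = insert f (Ts s - {e})" using e' rm_unique[OF assms(1) e'(1)] by simp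
  have ef: "e \<in> Ts s" "f \<notin> Ts s" using assms by (auto simp: rm_def ad_def)
  show ?thesis
    by (rule gad.flip_quadrilateral[OF tris[of s] tris[of "Suc s"] ef E])
      (use s that E ef in auto)
qed

lemma arc_facts:
  assumes "s \<le> n" "(i, j) \<in> Ts s" shows "0 \<le> i" "i < j" "j \<le> 115" "sees i j"
  using gad.tri_arc[OF tris[OF assms(1)] assms(2)] by (auto simp: gad_arcs_def)

lemma nocross: "s \<le> n \<Longrightarrow> e \<in> Ts s \<Longrightarrow> f \<in> Ts s \<Longrightarrow> \<not> crosses e f"
  using gad.tri_noncrossing[OF tris] by blast

lemma removal_step:
  assumes "e \<in> Ts i" "e \<notin> Ts j" "i \<le> j" "j \<le> n" obtains s where "i \<le> s" "s < j" "rm s e"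
proof -
  obtain s where "i \<le> s" "s < j" "\<And>s'. i \<le> s' \<Longrightarrow> s' \<le> s \<Longrightarrow> e \<in> Ts s'" "e \<notin> Ts (Suc s)"
    using first_removal[of e Ts i j] assms by metis
  then show ?thesis using that[of s] assms(4) by (auto simp: rm_def)
qed

lemma insertion_step:
  assumes "e \<notin> Ts i" "e \<in> Ts j" "i \<le> j" "j \<le> n" obtains s where "i \<le> s" "s < j" "ad s e"
proof -
  obtain s where "i \<le> s" "s < j" "e \<notin> Ts s" "\<And>s'. s < s' \<Longrightarrow> s' \<le> j \<Longrightarrow> e \<in> Ts s'"
    using last_insertion[of e Ts i j] assms by metis
  then show ?thesis using that[of s] assms(4) by (auto simp: ad_def)
qed

text \<open>The arc \<open>(103, 105)\<close> keeps the vertex \<open>104\<close> out of every quadrilateral inside \<open>(l, h)\<close> that is flipped,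
  so that the quadrilateral inequality for the potential applies.\<close>

lemma potsum_step:
  assumes s: "s < n" and lh: "2 \<le> l" "h \<le> 114" "(l, h) \<in> Ts s" "(l, h) \<in> Ts (Suc s)"
  shows "potsum (Ts (Suc s)) l h \<le> potsum (Ts s) l h + of_bool (flip_inside l h s)"
proof (cases "Ts (Suc s) = Ts s")
  case False
  then obtain e f where ef: "rm s e" "ad s f" using step_cases[OF s] by metis
  obtain a b c d where q: "a < b" "b < c" "c < d" "e = (a, c) \<and> f = (b, d) \<or> e = (b, d) \<and> f = (a, c)"
    "(a, b) \<in> Ts s - {e}" "(b, c) \<in> Ts s - {e}" "(c, d) \<in> Ts s - {e}" "(a, d) \<in> Ts s - {e}"
    "Ts (Suc s) = insert f (Ts s - {e})" "e \<in> Ts s" "f \<notin> Ts s"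
    by (rule quad[OF ef]) (rule that, assumption+)
  have nc: "\<And>g h. g \<in> Ts s \<Longrightarrow> h \<in> Ts s \<Longrightarrow> \<not> crosses g h"
    "\<And>g h. g \<in> Ts (Suc s) \<Longrightarrow> h \<in> Ts (Suc s) \<Longrightarrow> \<not> crosses g h"
    using nocross[of s] nocross[of "Suc s"] s by auto
  have eps': "(103, 105) \<in> Ts s" "(103, 105) \<in> Ts (Suc s)" using eps s by auto
  have T': "f \<in> Ts (Suc s)" "(a, b) \<in> Ts (Suc s)" "(b, c) \<in> Ts (Suc s)" "(c, d) \<in> Ts (Suc s)" "(a, d) \<in> Ts (Suc s)"
    "e \<notin> Ts (Suc s)" using q by auto
  show ?thesis
  proof (cases "l \<le> a \<and> d \<le> h")
    case True
    have no104: "a \<noteq> 104" "b \<noteq> 104" "c \<noteq> 104" "d \<noteq> 104"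
    proof -
      have x: "\<not> crosses (103, 105) g" if "g \<in> Ts s \<or> g \<in> Ts (Suc s)" for g
        using nc(1)[OF eps'(1)] nc(2)[OF eps'(2)] that by blast
      have y: "\<not> crosses (103, 105) (a, b)" "\<not> crosses (103, 105) (a, d)" "\<not> crosses (103, 105) (a, c)"
        "\<not> crosses (103, 105) (b, d)"
        using x q T' by auto
      show "a \<noteq> 104" using y(3) q(1-3) by (auto simp: crosses_def)
      show "b \<noteq> 104" using y(1,4) q(1-3) unfolding crosses_def fst_conv snd_conv by linarith
      show "c \<noteq> 104" using y(3) q(1-3) unfolding crosses_def fst_conv snd_conv by linarith
      show "d \<noteq> 104" using y(2) q(1-3) unfolding crosses_def fst_conv snd_conv by linarith
    qed
    have "\<bar>pot a b c + pot a c d - pot a b d - pot b c d\<bar> \<le> 1"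
      by (rule pot_quad) (use True q(1-3) lh no104 in auto)
    then have "potsum (Ts (Suc s)) l h \<le> potsum (Ts s) l h + 1"
      using potsum_flip[OF nc q(9-11,1-8), of l h] True by linarith
    moreover have "flip_inside l h s"
      unfolding flip_inside_def using ef True q(1-4) by (intro exI[of _ e] exI[of _ f]) auto
    ultimately show ?thesis by simp
  next
    case False
    have x: "\<not> crosses (l, h) (a, b)" "\<not> crosses (l, h) (b, c)" "\<not> crosses (l, h) (c, d)" "\<not> crosses (l, h) (a, d)"
      using nc(1)[OF lh(3)] q(5-8) by auto
    have ne: "e \<noteq> (l, h)" "f \<noteq> (l, h)" using T'(6) q(11) lh(3,4) by auto
    have lh': "l < h" using arc_facts(2)[of s l h] s lh(3) by simp
    have ac: "(a, c) = (l, h)" if "l \<le> a" "c \<le> h"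
    proof -
      have "h < d" using False that by simp
      then have "a = l" "c = h" using x(3,4) that q(1-3) unfolding crosses_def fst_conv snd_conv by linarith+
      then show ?thesis by simp
    qed
    have bd: "(b, d) = (l, h)" if "l \<le> b" "d \<le> h"
    proof -
      have "a < l" using False that by simp
      then have "b = l" "d = h" using x(1,4) that q(1-3) unfolding crosses_def fst_conv snd_conv by linarith+
      then show ?thesis by simp
    qed
    have "\<not> (l \<le> fst e \<and> snd e \<le> h) \<and> \<not> (l \<le> fst f \<and> snd f \<le> h)"
    proof (rule disjE[OF q(4)])
      assume "e = (a, c) \<and> f = (b, d)"
      then show ?thesis using ac bd ne by (metis fst_conv snd_conv)
    next
      assume "e = (b, d) \<and> f = (a, c)"
      then show ?thesis using ac bd ne by (metis fst_conv snd_conv)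
    qed
    then have same: "(i, j) \<in> Ts (Suc s) \<longleftrightarrow> (i, j) \<in> Ts s" if "l \<le> i" "j \<le> h" for i j
      using that q(9) by (metis Diff_iff fst_conv insert_iff singletonD snd_conv)
    have "t \<in> triangles (Ts (Suc s)) l h \<longleftrightarrow> t \<in> triangles (Ts s) l h" for t
    proof -
      obtain i j k where t: "t = (i, j, k)" by (cases t) auto
      show ?thesis unfolding t triangles_def using same[of i j] same[of j k] same[of i k]
        by (simp only: mem_Collect_eq prod.case) linarith
    qed
    then have "triangles (Ts (Suc s)) l h = triangles (Ts s) l h" by blast
    then show ?thesis by (simp add: potsum_def)
  qed
qed simp

lemma potsum_walk:
  assumes "i \<le> j" "j \<le> n" "2 \<le> l" "h \<le> 114" "\<And>s. i \<le> s \<Longrightarrow> s \<le> j \<Longrightarrow> (l, h) \<in> Ts s"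
  shows "potsum (Ts j) l h \<le> potsum (Ts i) l h + int (card {s. i \<le> s \<and> s < j \<and> flip_inside l h s})"
proof -
  let ?C = "\<lambda>j. {s. i \<le> s \<and> s < j \<and> flip_inside l h s}"
  have "m \<le> j \<longrightarrow> potsum (Ts m) l h \<le> potsum (Ts i) l h + int (card (?C m))" if "i \<le> m" for m
    using that
  proof (induction m rule: dec_induct)
    case (step m)
    show ?case
    proof
      assume mj: "Suc m \<le> j"
      have "potsum (Ts (Suc m)) l h \<le> potsum (Ts m) l h + of_bool (flip_inside l h m)"
        by (rule potsum_step[OF _ assms(3,4) assms(5) assms(5)]) (use mj step(1) assms(2) in linarith)+
      moreover have "?C (Suc m) = (if flip_inside l h m then insert m (?C m) else ?C m)"
        using step(1) by (auto simp: less_Suc_eq)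
      ultimately show "potsum (Ts (Suc m)) l h \<le> potsum (Ts i) l h + int (card (?C (Suc m)))"
        using step(3) mj by (cases "flip_inside l h m") simp_all
    qed
  qed simp
  then show ?thesis using assms(1) by blast
qed

end

text \<open>An evaluator for \<open>potsum\<close>: each entry \<open>m\<close> is the third corner of the triangle resting on the current
  chord \<open>(l, h)\<close>, and one of the other two sides is a boundary edge, so that the sum continues on a single chord.\<close>

fun zigzag :: "(int \<times> int) list \<Rightarrow> int \<Rightarrow> int \<Rightarrow> int list \<Rightarrow> (int \<times> int \<times> int) option" where
  "zigzag L l h [] = Some (l, h, 0)"
| "zigzag L l h (m # ms) =
    (if 0 \<le> l \<and> l < m \<and> m < h \<and> h \<le> 115 \<and> held L (l, h) \<and> held L (l, m) \<and> held L (m, h)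
     then map_option (\<lambda>(l', h', v). (l', h', pot l m h + v))
       (if m = l + 1 then zigzag L m h ms else if h = m + 1 then zigzag L l m ms else None)
     else None)"

lemma zigzag_potsum:
  assumes T: "gad.tri T" "set L \<subseteq> T"
  shows "zigzag L l h ms = Some (l', h', v) \<Longrightarrow> potsum T l h = v + potsum T l' h'"
proof (induction ms arbitrary: l h v)
  case (Cons m ms)
  have nc: "\<And>e f. e \<in> T \<Longrightarrow> f \<in> T \<Longrightarrow> \<not> crosses e f" using gad.tri_noncrossing[OF T(1)] by blast
  have c: "0 \<le> l" "l < m" "m < h" "h \<le> 115" "held L (l, h)" "held L (l, m)" "held L (m, h)"
    by (rule ccontr, use Cons.prems in simp)+
  have "(l, m) \<in> T" "(m, h) \<in> T" "(l, h) \<in> T" by (rule set_held[OF T]; use c in simp)+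
  note split = potsum_split[OF nc c(2,3) this]
  show ?case
  proof (cases "m = l + 1")
    case True
    then obtain v' where "zigzag L m h ms = Some (l', h', v')" "v = pot l m h + v'"
      using Cons.prems c by auto
    then show ?thesis using split Cons.IH[of m h v'] True potsum_edge[of T l] by simp
  next
    case False
    then have "h = m + 1" by (rule_tac ccontr) (use Cons.prems c in simp)
    then obtain v' where "zigzag L l m ms = Some (l', h', v')" "v = pot l m h + v'"
      using Cons.prems c False by auto
    then show ?thesis using split Cons.IH[of l m v'] \<open>h = m + 1\<close> potsum_edge[of T m] by simp
  qed
qed simp

lemma potsum_start:
  assumes "gad.tri T" "set start_list \<subseteq> T"
  shows "potsum T 78 94 = -7"
proof -
  let ?ms = "[93, 79, 92, 80, 91, 81, 90, 82, 89, 83, 88, 84, 87, 85, 86] :: int list"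
  have "zigzag start_list 78 94 ?ms = Some (86, 87, -7)" by code_simp
  from zigzag_potsum[OF assms this] show ?thesis using potsum_edge[of T 86] by simp
qed

lemma potsum_goal:
  assumes "gad.tri T" "set goal_list \<subseteq> T"
  shows "potsum T 78 114 = 48"
proof -
  let ?ms = "[113, 79, 112, 80, 111, 81, 110, 82, 109, 83, 108, 84, 107, 85, 106, 86] :: int list"
  let ?ks = "[102, 87, 101, 88, 100, 89, 99, 90, 98, 91, 97, 92, 96, 93, 95, 94] :: int list"
  have nc: "\<And>e f. e \<in> T \<Longrightarrow> f \<in> T \<Longrightarrow> \<not> crosses e f" using gad.tri_noncrossing[OF assms(1)] by blast
  have m: "(86, 106) \<in> T" "(86, 105) \<in> T" "(86, 103) \<in> T" "(103, 105) \<in> T"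
    using assms(2) unfolding goal_list_def by auto
  have n: "(105, 106) \<in> T" "(103, 104) \<in> T" "(104, 105) \<in> T"
    using boundary_edges(1)[OF assms(1), of 105] boundary_edges(1)[OF assms(1), of 103]
      boundary_edges(1)[OF assms(1), of 104] by simp_all
  have eps: "potsum T 103 105 = 0"
    using potsum_split[OF nc, of T 103 104 105] m n potsum_edge[of T 103] potsum_edge[of T 104]
    by (simp add: pot_def kind_def)
  have "zigzag goal_list 86 103 ?ks = Some (94, 95, 23)" by code_simp
  from zigzag_potsum[OF assms this] have "potsum T 86 103 = 23" using potsum_edge[of T 94] by simp
  then have "potsum T 86 106 = 25"
    using potsum_split[OF nc, of T 86 105 106] potsum_split[OF nc, of T 86 103 105] m n potsum_edge[of T 105] eps
    by (simp add: pot_def kind_def)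
  moreover have "zigzag goal_list 78 114 ?ms = Some (86, 106, 23)" by code_simp
  then have "potsum T 78 114 = 23 + potsum T 86 106"
    using zigzag_potsum[OF assms, of 78 114 ?ms] by blast
  ultimately show ?thesis by simp
qed

lemma start_arcs:
  "(103, 105) \<in> set start_list" "(0, 103) \<in> set start_list" "(0, 105) \<in> set start_list"
  "94 \<le> j \<Longrightarrow> j \<le> 103 \<Longrightarrow> (1, j) \<in> set start_list"
  "105 \<le> j \<Longrightarrow> j \<le> 113 \<Longrightarrow> (j, 115) \<in> set start_list"
  "2 \<le> j \<Longrightarrow> j \<le> 78 \<Longrightarrow> (j, 94) \<in> set start_list"
  unfolding start_list_def list.set(2) set_append set_map set_upto insert_iff Un_iff image_iff Bex_def atLeastAtMost_iff by blast+

lemma goal_arcs: "2 \<le> j \<Longrightarrow> j \<le> 78 \<Longrightarrow> (j, 114) \<in> set goal_list"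
  unfolding goal_list_def list.set(2) set_append set_map set_upto insert_iff Un_iff image_iff Bex_def atLeastAtMost_iff by blast

lemma potsum_fan_start:
  assumes T: "gad.tri T" "set start_list \<subseteq> T" and l: "2 \<le> l" "l \<le> 78"
  shows "potsum T l 94 = -7"
  using l(2,1)
proof (induction l rule: int_le_induct)
  case base show ?case by (rule potsum_start[OF T])
next
  case (step i)
  have nc: "\<And>e f. e \<in> T \<Longrightarrow> f \<in> T \<Longrightarrow> \<not> crosses e f" using gad.tri_noncrossing[OF T(1)] by blast
  have "(i - 1, 94) \<in> set start_list" "(i, 94) \<in> set start_list"
    using start_arcs(6)[of "i - 1"] start_arcs(6)[of i] step by linarith+
  then have "(i - 1, 94) \<in> T" "(i, 94) \<in> T" "(i - 1, i) \<in> T"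
    using boundary_edges(1)[OF T(1), of "i - 1"] T(2) step(1,3) by auto
  then have "potsum T (i - 1) 94 = pot (i - 1) i 94 + potsum T (i - 1) i + potsum T i 94"
    using potsum_split[OF nc, of T "i - 1" i 94] step(1,3) by simp
  moreover have "pot (i - 1) i 94 = 0" by (rule pot_const(8)) (use step in \<open>auto simp: kind_def\<close>)
  ultimately show ?case using potsum_edge[of T "i - 1"] step by simp
qed

lemma potsum_fan_goal:
  assumes T: "gad.tri T" "set goal_list \<subseteq> T" and l: "2 \<le> l" "l \<le> 78"
  shows "potsum T l 114 = 126 - l + (if l \<le> 77 then 1 else 0)"
  using l(2,1)
proof (induction l rule: int_le_induct)
  case base show ?case using potsum_goal[OF T] by simp
next
  case (step i)
  have nc: "\<And>e f. e \<in> T \<Longrightarrow> f \<in> T \<Longrightarrow> \<not> crosses e f" using gad.tri_noncrossing[OF T(1)] by blast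
  have "(i - 1, 114) \<in> set goal_list" "(i, 114) \<in> set goal_list"
    using goal_arcs[of "i - 1"] goal_arcs[of i] step by linarith+
  then have "(i - 1, 114) \<in> T" "(i, 114) \<in> T" "(i - 1, i) \<in> T"
    using boundary_edges(1)[OF T(1), of "i - 1"] T(2) step(1,3) by auto
  then have "potsum T (i - 1) 114 = pot (i - 1) i 114 + potsum T (i - 1) i + potsum T i 114"
    using potsum_split[OF nc, of T "i - 1" i 114] step(1,3) by simp
  moreover have "pot (i - 1) i 114 = (if i = 78 then 2 else 1)"
    by (subst pot_eqs(2)) (use step in \<open>auto simp: kind_def\<close>)
  ultimately show ?case using potsum_edge[of T "i - 1"] step by auto
qed

lemma potsum_nonmixed: 
  assumes "2 \<le> l" "h \<le> 85" shows "potsum T l h = 0"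
  unfolding potsum_def
proof (rule sum.neutral, safe)
  fix p q r assume "(p, q, r) \<in> triangles T l h"
  then show "pot p q r = 0" by (intro pot_const(7)) (use assms in \<open>auto simp: kind_def triangles_def\<close>)
qed

text \<open>The arcs that join the third part of the first block to the second block, other than \<open>\<epsilon>\<close>.\<close>

definition rungs :: "arcs \<Rightarrow> arcs" where
  "rungs T = {(a, b) \<in> T. 94 \<le> a \<and> a \<le> 103 \<and> 105 \<le> b \<and> b \<le> 114 \<and> (a, b) \<noteq> (103, 105)}"

lemma finite_rungs [simp]: "finite (rungs T)"
  by (rule finite_subset[of _ "{94..103} \<times> {105..114}"]) (auto simp: rungs_def)

text \<open>Between the vertices \<open>94\<close> and \<open>114\<close> each triangle of nonzero weight has weight one and has a longest
  side joining the two blocks, and this side determines the triangle.\<close>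

lemma potsum_ladder:
  assumes nc: "\<And>e f. e \<in> T \<Longrightarrow> f \<in> T \<Longrightarrow> \<not> crosses e f" and eps: "(103, 105) \<in> T"
  shows "potsum T 94 114 \<le> int (card (rungs T))"
proof -
  let ?M = "{t \<in> triangles T 94 114. (case t of (p, q, r) \<Rightarrow> pot p q r) \<noteq> 0}"
  have M: "pot p q r = 1 \<and> (p, r) \<in> rungs T" if t: "(p, q, r) \<in> triangles T 94 114" "pot p q r \<noteq> 0" for p q r
  proof -
    have 1: "94 \<le> p" "p < q" "q < r" "r \<le> 114" "(p, q) \<in> T" "(q, r) \<in> T" "(p, r) \<in> T"
      using t by (auto simp: triangles_def)
    have k: "(kind p, kind q, kind r) \<in> {(2, 2, 3), (2, 3, 3)}"
      using t(2) 1(1-4) unfolding pot_def Let_def kind_def by (auto split: if_split_asm)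
    then have "pot p q r = 1" by (auto simp: pot_def)
    moreover have "(p, r) \<noteq> (103, 105)"
    proof
      assume "(p, r) = (103, 105)"
      then have "q = 104" using 1 by simp
      then show False using k by (auto simp: kind_def)
    qed
    moreover have "p \<le> 103" "105 \<le> r" using k 1(1-4) by (auto simp: kind_def split: if_split_asm)
    ultimately show ?thesis using 1 by (simp add: rungs_def)
  qed
  have "potsum T 94 114 = (\<Sum>t\<in>?M. case t of (p, q, r) \<Rightarrow> pot p q r)"
    unfolding potsum_def by (rule sum.mono_neutral_cong_right) auto
  also have "\<dots> = (\<Sum>t\<in>?M. 1)" by (rule sum.cong) (use M in auto)
  also have "\<dots> = int (card ?M)" by simp
  also have "card ?M \<le> card (rungs T)"
  proof (rule card_inj_on_le[where f = "\<lambda>(p, q, r). (p, r)"])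
    show "inj_on (\<lambda>(p, q, r). (p, r)) ?M"
    proof (rule inj_onI)
      fix s t assume st: "s \<in> ?M" "t \<in> ?M" "(case s of (p, q, r) \<Rightarrow> (p, r)) = (case t of (p, q, r) \<Rightarrow> (p, r))"
      obtain p q r q' where e: "s = (p, q, r)" "t = (p, q', r)" using st(3) by (cases s; cases t) auto
      have 1: "p < q" "q < r" "(p, q) \<in> T" "(q, r) \<in> T" "p < q'" "q' < r" "(p, q') \<in> T" "(q', r) \<in> T"
        using st e by (auto simp: triangles_def)
      have "\<not> crosses (p, q) (q', r)" "\<not> crosses (p, q') (q, r)" using nc 1 by blast+
      then show "s = t" using 1(1,2,5,6) unfolding e crosses_def fst_conv snd_conv by auto
    qed
    show "(\<lambda>(p, q, r). (p, r)) ` ?M \<subseteq> rungs T" using M by auto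
  qed simp
  finally show ?thesis by simp
qed

context gad_walk
begin

text \<open>A flip that exchanged such arcs would take place in a quadrilateral with a side joining \<open>1\<close> to the
  second block or the first block to \<open>115\<close>, and those pairs do not see each other.\<close>

lemma far_flip:
  assumes "rm s e" "ad s (u, v)" "2 \<le> u" "u \<le> 103" "105 \<le> v" "v \<le> 114"
  shows "\<not> (fst e = 1 \<and> snd e \<le> 103)" "snd e \<noteq> 115 \<or> fst e < 104"
proof -
  have s: "s \<le> n" using assms(1) by (simp add: rm_def)
  obtain a b c d where q: "a < b" "b < c" "c < d" "e = (a, c) \<and> (u, v) = (b, d) \<or> e = (b, d) \<and> (u, v) = (a, c)"
    "(a, d) \<in> Ts s"
    by (rule quad[OF assms(1,2)]) (rule that, assumption+, blast)
  have ad: "sees a d" "d \<le> 115" using arc_facts[OF s q(5)] by auto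
  from q(4) have "\<not> (fst e = 1 \<and> snd e \<le> 103) \<and> (snd e \<noteq> 115 \<or> fst e < 104)"
  proof
    assume "e = (a, c) \<and> (u, v) = (b, d)"
    then show ?thesis using q(1-3) ad assms(3-6) by (auto simp: sees_def)
  next
    assume "e = (b, d) \<and> (u, v) = (a, c)"
    then show ?thesis using q(1-3) ad assms(3-6) by (auto simp: sees_def)
  qed
  then show "\<not> (fst e = 1 \<and> snd e \<le> 103)" "snd e \<noteq> 115 \<or> fst e < 104" by auto
qed

text \<open>Assume that at step \<open>t\<close> an arc \<open>(I, 94)\<close> is exchanged for \<open>(J, 114)\<close>. The following sets of steps are disjoint:
  the \<open>19\<close> removals of arcs at \<open>1\<close> and \<open>115\<close>, before \<open>t\<close>; the insertions of the rungs present after \<open>t\<close>; the \<open>J - 1\<close>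
  last insertions of \<open>(l, 114)\<close> with \<open>l \<le> J\<close>; the flips inside \<open>(I, 94)\<close> before \<open>t\<close>; and the flips inside
  \<open>(J, 114)\<close> after \<open>t\<close>. The potential bounds the last two. In the sum the contribution of
  \<open>(J, 94)\<close>, the number of rungs and \<open>J\<close> all cancel, which leaves \<open>152\<close>.\<close>

theorem gad_distance:
  assumes S: "set start_list \<subseteq> Ts 0" and G: "set goal_list \<subseteq> Ts n"
  shows "152 \<le> n"
proof -
  have start: "(0, 103) \<in> Ts 0" "(0, 105) \<in> Ts 0" "94 \<le> j \<Longrightarrow> j \<le> 103 \<Longrightarrow> (1, j) \<in> Ts 0"
    "105 \<le> j \<Longrightarrow> j \<le> 113 \<Longrightarrow> (j, 115) \<in> Ts 0" "2 \<le> j \<Longrightarrow> j \<le> 78 \<Longrightarrow> (j, 94) \<in> Ts 0" for j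
    using S start_arcs by blast+
  have goal: "2 \<le> j \<Longrightarrow> j \<le> 78 \<Longrightarrow> (j, 114) \<in> Ts n" for j
    using G goal_arcs by blast
  have far0: "(u, v) \<notin> Ts 0" if "1 \<le> u" "u \<le> 103" "105 \<le> v" "v \<le> 114" "(u, v) \<noteq> (103, 105)" for u v
  proof
    assume "(u, v) \<in> Ts 0"
    then have "\<not> crosses (u, v) (0, 103)" "\<not> crosses (u, v) (0, 105)" using nocross[of 0] start by auto
    then show False using that unfolding crosses_def fst_conv snd_conv by auto
  qed
  have alpha_n: "(l, 94) \<notin> Ts n" if "2 \<le> l" "l \<le> 77" for l
  proof
    assume "(l, 94) \<in> Ts n"
    moreover have "(l + 1, 114) \<in> Ts n" using goal that by auto
    ultimately have "\<not> crosses (l, 94) (l + 1, 114)" using nocross[of n] by blast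
    then show False using that by (simp add: crosses_def)
  qed
  have "\<exists>s. rm s (l, 94) \<and> (\<forall>s' \<le> s. (l, 94) \<in> Ts s')" if "l \<in> {2..77}" for l
  proof -
    have "(l, 94) \<in> Ts 0" "(l, 94) \<notin> Ts n" using start alpha_n that by auto
    from first_removal[where Ts = Ts, OF this] obtain s where s: "s < n"
      "\<And>s'. s' \<le> s \<Longrightarrow> (l, 94) \<in> Ts s'" "(l, 94) \<notin> Ts (Suc s)" by auto
    then show ?thesis by (auto simp: rm_def)
  qed
  then obtain p where p: "\<And>l. l \<in> {2..77} \<Longrightarrow> rm (p l) (l, 94) \<and> (\<forall>s' \<le> p l. (l, 94) \<in> Ts s')" by metis
  have "\<exists>s. ad s (l, 114) \<and> (\<forall>s'. s < s' \<longrightarrow> s' \<le> n \<longrightarrow> (l, 114) \<in> Ts s')" if "l \<in> {2..78}" for l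
  proof -
    have "(l, 114) \<notin> Ts 0" "(l, 114) \<in> Ts n" using far0[of l 114] goal that by auto
    from last_insertion[where Ts = Ts, OF this] obtain s where s: "s < n"
      "\<And>s'. s < s' \<Longrightarrow> s' \<le> n \<Longrightarrow> (l, 114) \<in> Ts s'" "(l, 114) \<notin> Ts s" by blast
    then show ?thesis by (auto simp: ad_def intro!: exI[of _ s])
  qed
  then obtain q where q: "\<And>l. l \<in> {2..78} \<Longrightarrow> ad (q l) (l, 114) \<and> (\<forall>s'. q l < s' \<longrightarrow> s' \<le> n \<longrightarrow> (l, 114) \<in> Ts s')"
    by metis
  have pn: "p ` {2..77} \<subseteq> {..<n}" using p by (auto simp: rm_def)
  have qn: "q ` {2..78} \<subseteq> {..<n}" using q by (auto simp: ad_def)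
  have pinj: "inj_on p {2..77}" by (rule inj_onI) (metis p rm_unique prod.inject)
  have qinj: "inj_on q {2..78}" by (rule inj_onI) (metis q ad_unique prod.inject)
  show ?thesis
  \<comment> \<open>\<open>p l\<close> is the first removal of \<open>(l, 94)\<close> and \<open>q l\<close> the last insertion of \<open>(l, 114)\<close>\<close>
  proof (cases "p ` {2..77} \<inter> q ` {2..78} = {}")
    case True
    have "card (p ` {2..77} \<union> q ` {2..78}) = 76 + 77"
      using card_Un_disjoint[OF _ _ True] card_image[OF pinj] card_image[OF qinj] by simp
    moreover have "card (p ` {2..77} \<union> q ` {2..78}) \<le> card {..<n}" by (rule card_mono) (use pn qn in auto)
    ultimately show ?thesis by simp
  next
    case False
    then obtain t where "t \<in> p ` {2..77}" "t \<in> q ` {2..78}" by blast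
    then obtain I J where IJ: "I \<in> {2..77}" "J \<in> {2..78}" "t = p I" "t = q J" by blast
    have rt: "rm t (I, 94)" and pI: "\<And>s. s \<le> t \<Longrightarrow> (I, 94) \<in> Ts s" using p[OF IJ(1)] IJ(3) by auto
    have at: "ad t (J, 114)" and qJ: "\<And>s. t < s \<Longrightarrow> s \<le> n \<Longrightarrow> (J, 114) \<in> Ts s" using q[OF IJ(2)] IJ(4) by auto
    have tn: "t < n" using rt by (simp add: rm_def)
    obtain a b c d where w: "a < b" "b < c" "c < d" "(I, 94) = (a, c) \<and> (J, 114) = (b, d) \<or> (I, 94) = (b, d) \<and> (J, 114) = (a, c)"
      "(a, b) \<in> Ts t - {(I, 94)}" "(b, c) \<in> Ts t - {(I, 94)}" "(c, d) \<in> Ts t - {(I, 94)}" "(a, d) \<in> Ts t - {(I, 94)}"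
      and Tt: "Ts (Suc t) = insert (J, 114) (Ts t - {(I, 94)})"
      by (rule quad[OF rt at]) (rule that, assumption+)
    have abcd: "a = I" "b = J" "c = 94" "d = 114" using w(1-4) by auto
    have IJ': "I < J" using w(1) abcd by simp
    have T: "(I, J) \<in> Ts t" "(J, 94) \<in> Ts t" "(94, 114) \<in> Ts t" "(I, 114) \<in> Ts t"
      using w(5-8) abcd by auto
    have T1: "(J, 94) \<in> Ts (Suc t)" "(94, 114) \<in> Ts (Suc t)" "(J, 114) \<in> Ts (Suc t)" using Tt T IJ' by auto
    have nct: "\<And>e f. e \<in> Ts t \<Longrightarrow> f \<in> Ts t \<Longrightarrow> \<not> crosses e f"
      by (rule nocross[of t]) (use tn in simp)
    have nct1: "\<And>e f. e \<in> Ts (Suc t) \<Longrightarrow> f \<in> Ts (Suc t) \<Longrightarrow> \<not> crosses e f"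
      by (rule nocross[of "Suc t"]) (use tn in simp)
    \<comment> \<open>arcs of \<open>T\<^sub>1\<close> that cross \<open>(I, 114)\<close>, so they are gone at step \<open>t\<close>\<close>
    define D where "D = (\<lambda>j. (1::int, j::int)) ` {94..103} \<union> (\<lambda>j. (j, 115)) ` {105..113}"
    have cD: "card D = 19"
    proof -
      have "card D = card ((\<lambda>j. (1::int, j::int)) ` {94..103}) + card ((\<lambda>j. (j::int, 115::int)) ` {105..113})"
        unfolding D_def by (rule card_Un_disjoint) auto
      then show ?thesis by (simp add: card_image inj_on_def)
    qed
    have "\<exists>s. s < t \<and> rm s e" if "e \<in> D" for e
    proof -
      have "crosses e (I, 114)" using that IJ IJ' unfolding D_def crosses_def by auto
      then have "e \<notin> Ts t" using nct T(4) by blast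
      moreover have "e \<in> Ts 0" using that start unfolding D_def by auto
      ultimately show ?thesis using removal_step[of e 0 t] tn by (metis le0 less_imp_le)
    qed
    then obtain r where r: "\<And>e. e \<in> D \<Longrightarrow> r e < t \<and> rm (r e) e" by metis
    define R where "R = rungs (Ts (Suc t))"
    have R: "e \<in> R \<Longrightarrow> \<exists>u v. e = (u, v) \<and> e \<in> Ts (Suc t) \<and> 94 \<le> u \<and> u \<le> 103 \<and> 105 \<le> v \<and> v \<le> 114 \<and> e \<noteq> (103, 105)" for e
      unfolding R_def rungs_def by auto
    have "\<exists>s. s < t \<and> ad s e" if eR: "e \<in> R" for e
    proof -
      obtain u v where e: "e = (u, v)" "e \<in> Ts (Suc t)" "94 \<le> u" "u \<le> 103" "105 \<le> v" "v \<le> 114" "e \<noteq> (103, 105)"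
        using R[OF eR] by blast
      have "e \<notin> Ts 0" using far0[of u v] e by auto
      moreover have "e \<in> Ts t" using e Tt IJ by auto
      ultimately show ?thesis using insertion_step[of e 0 t] tn by (metis le0 less_imp_le)
    qed
    then obtain g where g: "\<And>e. e \<in> R \<Longrightarrow> g e < t \<and> ad (g e) e" by metis
    define S4 where "S4 = {s. 0 \<le> s \<and> s < t \<and> flip_inside I 94 s}"
    define S5 where "S5 = {s. Suc t \<le> s \<and> s < n \<and> flip_inside J 114 s}"
    have fin: "finite D" "finite R" "finite S4" "finite S5" by (auto simp: D_def R_def S4_def S5_def)
    have rinj: "inj_on r D" by (rule inj_onI) (metis r rm_unique)
    have ginj: "inj_on g R" by (rule inj_onI) (metis g ad_unique)
    have qinj': "inj_on q {2..J}" by (rule inj_on_subset[OF qinj]) (use IJ in auto)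
    have qad: "ad (q l) (l, 114)" if "l \<in> {2..J}" for l using q[of l] that IJ(2) by auto
    have qJ1: "q l \<notin> S5" if l: "l \<in> {2..J}" for l
    proof
      assume "q l \<in> S5"
      then obtain f where f: "Suc t \<le> q l" "q l < n" "ad (q l) f" "J \<le> fst f" by (auto simp: S5_def flip_inside_def)
      have "f = (l, 114)" by (rule ad_unique[OF f(3) qad[OF l]])
      then have "l = J" using f(4) l by auto
      then show False using f(1) IJ(4) by simp
    qed
    have dis: "r ` D \<inter> g ` R = {}" "(r ` D \<union> g ` R) \<inter> q ` {2..J} = {}"
      "(r ` D \<union> g ` R \<union> q ` {2..J}) \<inter> S4 = {}" "(r ` D \<union> g ` R \<union> q ` {2..J} \<union> S4) \<inter> S5 = {}"
    proof -
      have Dfar: False if "e \<in> D" "r e = s" "ad s (u, v)" "2 \<le> u" "u \<le> 103" "105 \<le> v" "v \<le> 114" for e s u v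
        using far_flip[of s e u v] r[OF that(1)] that unfolding D_def by auto
      show "r ` D \<inter> g ` R = {}"
      proof (rule equals0I, elim IntE imageE)
        fix y e f assume "y = r e" "e \<in> D" "y = g f" "f \<in> R"
        moreover obtain u v where "f = (u, v)" "94 \<le> u" "u \<le> 103" "105 \<le> v" "v \<le> 114" using R[OF \<open>f \<in> R\<close>] by blast
        ultimately show False using Dfar[of e y u v] g[of f] by simp
      qed
      show "(r ` D \<union> g ` R) \<inter> q ` {2..J} = {}"
      proof (rule equals0I, elim IntE UnE imageE)
        fix y e l assume "y = r e" "e \<in> D" "y = q l" "l \<in> {2..J}"
        then show False using Dfar[of e y l 114] qad[of l] IJ(2) by auto
      next
        fix y f l assume y: "y = g f" "f \<in> R" "y = q l" "l \<in> {2..J}"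
        have "f = (l, 114)" using ad_unique[of y f "(l, 114)"] g[OF y(2)] qad[OF y(4)] y by auto
        then show False using R[OF y(2)] y(4) IJ(2) by auto
      qed
      show "(r ` D \<union> g ` R \<union> q ` {2..J}) \<inter> S4 = {}"
      proof (rule equals0I, elim IntE UnE imageE)
        fix y e assume y: "y \<in> S4" "y = r e" "e \<in> D"
        obtain e' where e': "rm y e'" "I \<le> fst e'" "snd e' \<le> 94" using y(1) by (auto simp: S4_def flip_inside_def)
        have "e' = e" by (rule rm_unique[OF e'(1)]) (use r[OF y(3)] y in auto)
        then show False using e' y(3) IJ(1) unfolding D_def by auto
      next
        fix y f assume y: "y \<in> S4" "y = g f" "f \<in> R"
        obtain f' where f': "ad y f'" "snd f' \<le> 94" using y(1) by (auto simp: S4_def flip_inside_def)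
        have "f' = f" by (rule ad_unique[OF f'(1)]) (use g[OF y(3)] y in auto)
        then show False using f' R[OF y(3)] by auto
      next
        fix y l assume y: "y \<in> S4" "y = q l" "l \<in> {2..J}"
        obtain f' where f': "ad y f'" "snd f' \<le> 94" using y(1) by (auto simp: S4_def flip_inside_def)
        have "f' = (l, 114)" by (rule ad_unique[OF f'(1)]) (use qad[OF y(3)] y in auto)
        then show False using f' by auto
      qed
      show "(r ` D \<union> g ` R \<union> q ` {2..J} \<union> S4) \<inter> S5 = {}"
      proof (rule equals0I, elim IntE UnE imageE)
        fix y e assume "y \<in> S5" "y = r e" "e \<in> D" then show False using r[of e] by (auto simp: S5_def)
      next
        fix y e assume "y \<in> S5" "y = g e" "e \<in> R" then show False using g[of e] by (auto simp: S5_def)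
      next
        fix y l assume "y \<in> S5" "y = q l" "l \<in> {2..J}" then show False using qJ1 by blast
      next
        fix y assume "y \<in> S5" "y \<in> S4" then show False by (auto simp: S4_def S5_def)
      qed
    qed
    have "card (r ` D \<union> g ` R \<union> q ` {2..J} \<union> S4 \<union> S5) = card (r ` D) + card (g ` R) + card (q ` {2..J}) + card S4 + card S5"
      using fin card_Un_disjoint[OF _ _ dis(1)] card_Un_disjoint[OF _ _ dis(2)] card_Un_disjoint[OF _ _ dis(3)]
        card_Un_disjoint[OF _ _ dis(4)] by simp
    moreover have "card (r ` D \<union> g ` R \<union> q ` {2..J} \<union> S4 \<union> S5) \<le> card {..<n}"
    proof (rule card_mono)
      have "r e < n" if "e \<in> D" for e using r[OF that] tn by simp
      moreover have "g e < n" if "e \<in> R" for e using g[OF that] tn by simp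
      moreover have "q l < n" if "l \<in> {2..J}" for l using qad[OF that] by (simp add: ad_def)
      ultimately show "r ` D \<union> g ` R \<union> q ` {2..J} \<union> S4 \<union> S5 \<subseteq> {..<n}"
        using tn by (auto simp: S4_def S5_def)
    qed simp
    ultimately have count: "19 + int (card R) + (J - 1) + int (card S4) + int (card S5) \<le> int n"
      using card_image[OF rinj] card_image[OF ginj] card_image[OF qinj'] cD IJ(2) by simp
    have P0: "potsum (Ts 0) I 94 = -7" by (rule potsum_fan_start[OF tris S]) (use IJ in auto)
    have Pn: "potsum (Ts n) J 114 = 126 - J + (if J \<le> 77 then 1 else 0)"
      by (rule potsum_fan_goal[OF tris G]) (use IJ in auto)
    have "potsum (Ts t) I 94 \<le> potsum (Ts 0) I 94 + int (card S4)"
      unfolding S4_def by (rule potsum_walk) (use tn IJ pI in auto)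
    moreover have "potsum (Ts n) J 114 \<le> potsum (Ts (Suc t)) J 114 + int (card S5)"
      unfolding S5_def by (rule potsum_walk) (use tn IJ qJ in auto)
    moreover have "potsum (Ts t) I 94 = potsum (Ts t) J 94"
    proof -
      have "pot I J 94 = 0" by (rule pot_const(8)) (use IJ IJ' in \<open>auto simp: kind_def\<close>)
      moreover have "potsum (Ts t) I J = 0" by (rule potsum_nonmixed) (use IJ in auto)
      moreover have "(I, 94) \<in> Ts t" using pI by simp
      ultimately show ?thesis using potsum_split[OF nct, of "Ts t" I J 94] T IJ IJ' by auto
    qed
    moreover have "potsum (Ts (Suc t)) J 114 = pot J 94 114 + potsum (Ts (Suc t)) J 94 + potsum (Ts (Suc t)) 94 114"
      using potsum_split[OF nct1, of "Ts (Suc t)" J 94 114] T1 IJ by auto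
    moreover have "pot J 94 114 = (if 78 \<le> J then -1 else 0)"
      by (subst pot_eqs(5)) (use IJ in \<open>auto simp: kind_def\<close>)
    moreover have "potsum (Ts (Suc t)) J 94 = potsum (Ts t) J 94"
    proof -
      have same: "(i, j) \<in> Ts (Suc t) \<longleftrightarrow> (i, j) \<in> Ts t" if "J \<le> i" "j \<le> 94" for i j
        using Tt that IJ' by auto
      have "x \<in> triangles (Ts (Suc t)) J 94 \<longleftrightarrow> x \<in> triangles (Ts t) J 94" for x
      proof -
        obtain i j k where x: "x = (i, j, k)" by (cases x) auto
        show ?thesis unfolding x triangles_def using same[of i j] same[of j k] same[of i k]
          by (simp only: mem_Collect_eq prod.case) linarith
      qed
      then have "triangles (Ts (Suc t)) J 94 = triangles (Ts t) J 94" by blast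
      then show ?thesis by (simp add: potsum_def)
    qed
    moreover have "potsum (Ts (Suc t)) 94 114 \<le> int (card R)"
      unfolding R_def by (rule potsum_ladder[OF nct1 eps]) (use tn in auto)
    ultimately have "152 \<le> int n" using count P0 Pn by (auto split: if_split_asm)
    then show ?thesis by simp
  qed
qed

end

section \<open>Transporting the gadget into a larger chord model\<close>

lemma start_shape:
  assumes "(i, j) \<in> set start_list"
  shows "i = 0 \<and> (j = 103 \<or> j = 105) \<or> i = 1 \<and> 94 \<le> j \<and> j \<le> 103 \<or> 105 \<le> i \<and> i \<le> 113 \<and> j = 115
    \<or> 2 \<le> i \<and> i \<le> 78 \<and> j = 94 \<or> 78 \<le> i \<and> i \<le> 85 \<and> (i + j = 171 \<or> i + j = 172) \<or> i = 103 \<and> j = 105"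
  using assms unfolding start_list_def list.set(2) set_append set_map set_upto insert_iff Un_iff image_iff
    Bex_def atLeastAtMost_iff prod.inject
  by (elim disjE exE conjE) (simp_all only:, auto)

lemma start_arc: "(i, j) \<in> set start_list \<Longrightarrow> (i, j) \<in> gad_arcs"
  by (drule start_shape) (auto simp: gad_arcs_def sees_def)

lemma start_noncrossing:
  assumes "(i, j) \<in> set start_list" "(k, l) \<in> set start_list"
  shows "\<not> crosses (i, j) (k, l)"
  using start_shape[OF assms(1)] start_shape[OF assms(2)] unfolding crosses_def fst_conv snd_conv
  by (smt (verit))

lemma gad_start: "\<exists>G. gad.tri G \<and> set start_list \<subseteq> G"
  by (rule gad.tri_extend) (auto dest: start_arc start_noncrossing)

lemma gad_path:
  assumes "gad.tri G" "set start_list \<subseteq> G"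
  obtains Gs where "Gs 0 = G" "\<And>k. k \<le> 152 \<Longrightarrow> gad.tri (Gs k)" "\<And>k. k < 152 \<Longrightarrow> flip_step (Gs k) (Gs (Suc k))"
    "set goal_list \<subseteq> Gs 152" "(103, 105) \<notin> Gs 1"
proof -
  obtain L where L: "run_flips start_list flip_list = Some L" "list_all (held L) goal_list" and len: "length flip_list = 152"
    using run_ok by (auto split: option.splits)
  obtain Gs where Gs: "Gs 0 = G" "\<forall>k \<le> 152. gad.tri (Gs k)" "\<forall>k < 152. flip_step (Gs k) (Gs (Suc k))"
    "set L \<subseteq> Gs 152" "\<forall>a b c d qs'. flip_list = (a, b, c, d, False) # qs' \<longrightarrow> (b, d) \<notin> Gs 1"
    using run_flips_path[OF assms L(1)] unfolding len by blast
  have "(103, 105) \<notin> Gs 1" using Gs(5) unfolding flip_list_def by blast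
  moreover have "set goal_list \<subseteq> Gs 152"
  proof
    fix e assume e: "e \<in> set goal_list"
    obtain i j where ij: "e = (i, j)" by (cases e)
    have "0 \<le> i \<and> j \<le> 115" using e unfolding ij goal_list_def by (auto simp del: upto.simps)
    then show "e \<in> Gs 152" using set_held[of "Gs 152" L i j] Gs(2,4) L(2) e ij by (auto simp: list_all_iff)
  qed
  ultimately show ?thesis using that[of Gs] Gs by blast
qed

text \<open>The \<open>i\<close>-th vertex of the gadget is realised by the label \<open>y i\<close>.\<close>

locale gadget = chord_model V A ap for V A ap +
  fixes y :: "int \<Rightarrow> int"
  assumes y_V: "0 \<le> i \<Longrightarrow> i \<le> 115 \<Longrightarrow> y i \<in> V"
    and y_mono: "0 \<le> i \<Longrightarrow> i < j \<Longrightarrow> j \<le> 115 \<Longrightarrow> y i < y j"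
    and y_ap: "y 0 = ap"
    and y_sees: "0 \<le> i \<Longrightarrow> i < j \<Longrightarrow> j \<le> 115 \<Longrightarrow> (y i, y j) \<in> A \<longleftrightarrow> sees i j"
begin

definition walk :: "(nat \<Rightarrow> arcs) \<Rightarrow> nat \<Rightarrow> bool" where
  "walk Ts n \<longleftrightarrow> (\<forall>k \<le> n. tri (Ts k)) \<and> (\<forall>k < n. flip_step (Ts k) (Ts (Suc k)))"

definition geodesic_walk :: "(nat \<Rightarrow> arcs) \<Rightarrow> nat \<Rightarrow> bool" where
  "geodesic_walk Ts n \<longleftrightarrow> walk Ts n \<and> (\<forall>Us m. walk Us m \<longrightarrow> Us 0 = Ts 0 \<longrightarrow> Us m = Ts n \<longrightarrow> n \<le> m)"

text \<open>The arcs between vertices of the gadget, expressed in the labels of the gadget.\<close>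

definition res :: "arcs \<Rightarrow> arcs" where
  "res T = {(i, j). 0 \<le> i \<and> i < j \<and> j \<le> 115 \<and> (y i, y j) \<in> T}"

definition rim :: arcs where
  "rim = insert (y 0, y 115) ((\<lambda>i. (y i, y (i + 1))) ` {0..114})"

lemma rim_edge: "0 \<le> i \<Longrightarrow> i \<le> 114 \<Longrightarrow> (y i, y (i + 1)) \<in> rim"
  unfolding rim_def by (intro insertI2 rev_image_eqI[of i]) auto

lemma y_less: "0 \<le> i \<Longrightarrow> i \<le> 115 \<Longrightarrow> 0 \<le> j \<Longrightarrow> j \<le> 115 \<Longrightarrow> y i < y j \<longleftrightarrow> i < j"
  using y_mono[of i j] y_mono[of j i] by (cases i j rule: linorder_cases) auto

lemma y_eq: "0 \<le> i \<Longrightarrow> i \<le> 115 \<Longrightarrow> 0 \<le> j \<Longrightarrow> j \<le> 115 \<Longrightarrow> y i = y j \<longleftrightarrow> i = j"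
  using y_less[of i j] y_less[of j i] by (cases i j rule: linorder_cases) auto

lemma y_crosses:
  assumes "0 \<le> i" "i < j" "j \<le> 115" "0 \<le> k" "k < l" "l \<le> 115"
  shows "crosses (y i, y j) (y k, y l) \<longleftrightarrow> crosses (i, j) (k, l)"
  unfolding crosses_def fst_conv snd_conv
  using assms y_less[of i k] y_less[of k j] y_less[of j l] y_less[of k i] y_less[of i l] y_less[of l j] by simp

lemma position:
  assumes "u \<in> V"
  obtains k where "0 \<le> k" "k \<le> 115" "u = y k" | k where "0 \<le> k" "k \<le> 114" "y k < u" "u < y (k + 1)" | "y 115 < u"
proof -
  define K where "K = {k. 0 \<le> k \<and> k \<le> 115 \<and> y k \<le> u}"
  have fin: "finite K" by (rule finite_subset[of _ "{0..115}"]) (auto simp: K_def)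
  have "0 \<in> K" using ap_least[OF assms] y_ap by (simp add: K_def)
  then have M: "Max K \<in> K" and mx: "\<And>k. k \<in> K \<Longrightarrow> k \<le> Max K" using fin Max_in Max_ge by blast+
  have k: "0 \<le> Max K" "Max K \<le> 115" "y (Max K) \<le> u" using M by (auto simp: K_def)
  consider "y (Max K) = u" | "y (Max K) < u" "Max K = 115" | "y (Max K) < u" "Max K \<le> 114" using k by linarith
  then show ?thesis
  proof cases
    case 1 then show ?thesis using that(1)[of "Max K"] k by simp
  next
    case 2 then show ?thesis using that(3) by simp
  next
    case 3
    have "\<not> y (Max K + 1) \<le> u" using mx[of "Max K + 1"] k 3 by (auto simp: K_def)
    then show ?thesis using that(2)[of "Max K"] k 3 by simp
  qed
qed

text \<open>The chords of the rim separate the gadget from the rest, so an arc that crosses a chord of the gadget has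
  both ends in the gadget.\<close>

lemma crossing_in_image:
  assumes T: "tri T" "rim \<subseteq> T" and uv: "(u, v) \<in> T" and cr: "crosses (u, v) (y i, y j)"
    and ij: "0 \<le> i" "i < j" "j \<le> 115"
  obtains k l where "0 \<le> k" "k < l" "l \<le> 115" "u = y k" "v = y l"
proof -
  have V: "u \<in> V" "v \<in> V" "u < v" using A_vertices tri_arc[OF T(1) uv] by auto
  have top: "\<not> crosses (u, v) (y 0, y 115)" using tri_noncrossing[OF T(1) uv] T(2) by (auto simp: rim_def)
  have edge: "\<not> crosses (u, v) (y k, y (k + 1))" if "0 \<le> k" "k \<le> 114" for k
    using tri_noncrossing[OF T(1) uv] T(2) rim_edge[OF that] by blast
  have gap: "y i \<le> y k \<or> y (k + 1) \<le> y i" "y j \<le> y k \<or> y (k + 1) \<le> y j" if "0 \<le> k" "k \<le> 114" for k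
    using y_less[of k i] y_less[of k j] y_less[of i "k + 1"] y_less[of j "k + 1"] that ij by linarith+
  have c: "u < y i \<and> y i < v \<and> v < y j \<or> y i < u \<and> u < y j \<and> y j < v"
    using cr unfolding crosses_def fst_conv snd_conv by linarith
  have b: "y 0 \<le> y i" "y j \<le> y 115" "y i < y j" using y_less[of i 0] y_less[of 115 j] y_less[of i j] ij by linarith+
  have u0: "y 0 \<le> u" using ap_least[OF V(1)] y_ap by simp
  show ?thesis
  proof (cases rule: position[OF V(1)])
    case (2 k)
    have "v \<le> y (k + 1)" using edge[OF 2(1,2)] 2 V(3) unfolding crosses_def fst_conv snd_conv by linarith
    then show ?thesis using c gap[OF 2(1,2)] 2 by linarith
  next
    case 3 then show ?thesis using c b V(3) by linarith
  next
    case u: (1 k)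
    show ?thesis
    proof (cases rule: position[OF V(2)])
      case (1 l)
      then have "k < l" using V(3) u y_less[of k l] by simp
      then show ?thesis using that[of k l] u 1 by simp
    next
      case (2 l)
      have "y l \<le> u" using edge[OF 2(1,2)] 2 V(3) unfolding crosses_def fst_conv snd_conv by linarith
      then show ?thesis using c gap[OF 2(1,2)] 2 by linarith
    next
      case 3
      then show ?thesis using c b u0 top V(3) unfolding crosses_def fst_conv snd_conv by linarith
    qed
  qed
qed

lemma res_tri:
  assumes T: "tri T" "rim \<subseteq> T" shows "gad.tri (res T)"
  unfolding gad.tri_def
proof (intro conjI ballI impI subsetI)
  fix e assume e: "e \<in> res T"
  then obtain i j where ij: "e = (i, j)" "0 \<le> i" "i < j" "j \<le> 115" "(y i, y j) \<in> T" by (auto simp: res_def)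
  show "e \<in> gad_arcs" using ij y_sees[of i j] tri_arc[OF T(1)] by (simp add: gad_arcs_def)
  fix f assume "f \<in> res T"
  then obtain k l where kl: "f = (k, l)" "0 \<le> k" "k < l" "l \<le> 115" "(y k, y l) \<in> T" by (auto simp: res_def)
  show "\<not> crosses e f" using tri_noncrossing[OF T(1) ij(5) kl(5)] y_crosses[of i j k l] ij kl by simp
next
  fix e assume e: "e \<in> gad_arcs" and nc: "\<forall>f\<in>res T. \<not> crosses e f"
  obtain i j where ij: "e = (i, j)" "0 \<le> i" "i < j" "j \<le> 115" "sees i j" using e by (auto simp: gad_arcs_def)
  have "(y i, y j) \<in> T"
  proof (rule tri_maximal[OF T(1)])
    show "(y i, y j) \<in> A" using ij y_sees by simp
    fix f assume f: "f \<in> T"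
    show "\<not> crosses (y i, y j) f"
    proof
      assume cr: "crosses (y i, y j) f"
      obtain u v where uv: "f = (u, v)" by (cases f)
      obtain k l where kl: "0 \<le> k" "k < l" "l \<le> 115" "u = y k" "v = y l"
        using crossing_in_image[OF T, of u v i j] f cr ij uv crosses_sym by metis
      have "(k, l) \<in> res T" using kl f uv by (auto simp: res_def)
      then show False using nc y_crosses[of i j k l] ij kl cr uv by auto
    qed
  qed
  then show "e \<in> res T" using ij by (auto simp: res_def)
qed

text \<open>If just one of the exchanged arcs joined vertices of the gadget, one restriction would be a proper subset of
  the other although both are maximal.\<close>

lemma res_step:
  assumes T: "tri T" "rim \<subseteq> T" and T': "tri T'" "rim \<subseteq> T'" and fl: "flip_step T T'"
  shows "res T' = res T \<or> flip_step (res T) (res T')"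
proof -
  obtain a b where ab: "a \<in> T" "b \<notin> T" "T' = insert b (T - {a})" using fl by (auto simp: flip_step_def)
  let ?I = "\<lambda>e i j. 0 \<le> i \<and> i < j \<and> j \<le> 115 \<and> e = (y i, y j)"
  have inj: "?I e i j \<Longrightarrow> ?I e k l \<Longrightarrow> (k, l) = (i, j)" for e i j k l
    using y_eq[of i k] y_eq[of j l] by auto
  have mem: "(i, j) \<in> res T \<longleftrightarrow> 0 \<le> i \<and> i < j \<and> j \<le> 115 \<and> (y i, y j) \<in> T" for i j T by (auto simp: res_def)
  have mono: "res U \<subseteq> res W \<Longrightarrow> res W \<subseteq> res U" if "tri U" "rim \<subseteq> U" "tri W" "rim \<subseteq> W" for U W
    using gad.tri_maximal[OF res_tri[OF that(1,2)]] gad.tri_arc[OF res_tri[OF that(3,4)]]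
      gad.tri_noncrossing[OF res_tri[OF that(3,4)]] by blast
  show ?thesis
  proof (cases "\<exists>i j. ?I a i j")
    case False
    then have "res T \<subseteq> res T'" using ab by (auto simp: res_def)
    then show ?thesis using mono[OF T T'] by blast
  next
    case True
    then obtain i j where i: "?I a i j" by blast
    show ?thesis
    proof (cases "\<exists>i j. ?I b i j")
      case False
      then have "res T' \<subseteq> res T" using ab by (auto simp: res_def)
      then show ?thesis using mono[OF T' T] by blast
    next
      case True
      then obtain k l where k: "?I b k l" by blast
      have "(i, j) \<in> res T" "(k, l) \<notin> res T" using i k ab by (auto simp: mem)
      moreover have "res T' = insert (k, l) (res T - {(i, j)})"
      proof (rule set_eqI)
        fix e :: "int \<times> int" obtain p q where e: "e = (p, q)" by (cases e)
        show "e \<in> res T' \<longleftrightarrow> e \<in> insert (k, l) (res T - {(i, j)})"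
        proof
          assume "e \<in> res T'"
          then have m: "0 \<le> p" "p < q" "q \<le> 115" "(y p, y q) \<in> T'" unfolding e mem by simp_all
          then have "(y p, y q) = b \<or> (y p, y q) \<in> T \<and> (y p, y q) \<noteq> a" using ab(3) by blast
          then show "e \<in> insert (k, l) (res T - {(i, j)})"
            using inj[OF k, of p q] m i unfolding e by (auto simp: mem)
        next
          assume "e \<in> insert (k, l) (res T - {(i, j)})"
          then show "e \<in> res T'"
            using inj[OF i, of p q] i k ab(3) unfolding e by (auto simp: mem)
        qed
      qed
      ultimately show ?thesis unfolding flip_step_def by blast
    qed
  qed
qed

text \<open>The quadrilateral of a flip in the gadget has its sides in the larger triangulation too, and the arc
  that is removed, being crossed by another arc of the gadget, is not on the rim.\<close>

lemma lift_flip: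
  assumes T: "tri T" "rim \<subseteq> T" and U: "gad.tri U" "flip_step (res T) U"
  shows "\<exists>T'. tri T' \<and> rim \<subseteq> T' \<and> flip_step T T' \<and> res T' = U"
proof -
  obtain e f where ef: "e \<in> res T" "f \<notin> res T" "U = insert f (res T - {e})" using U(2) by (auto simp: flip_step_def)
  obtain a b c d where q: "a < b" "b < c" "c < d" "e = (a, c) \<and> f = (b, d) \<or> e = (b, d) \<and> f = (a, c)"
    "(a, b) \<in> res T - {e}" "(b, c) \<in> res T - {e}" "(c, d) \<in> res T - {e}" "(a, d) \<in> res T - {e}"
    by (rule gad.flip_quadrilateral[OF res_tri[OF T] U(1) ef]) (rule that, assumption+)
  have r: "0 \<le> a" "d \<le> 115" "(y a, y b) \<in> T" "(y b, y c) \<in> T" "(y c, y d) \<in> T" "(y a, y d) \<in> T"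
    using q by (auto simp: res_def)
  define Y where "Y e = (y (fst e), y (snd e))" for e :: "int \<times> int"
  have o: "y a < y b" "y b < y c" "y c < y d" using y_mono q(1-3) r(1,2) by auto
  have Yef: "Y e = (y a, y c) \<and> Y f = (y b, y d) \<or> Y e = (y b, y d) \<and> Y f = (y a, y c)" using q(4) by (auto simp: Y_def)
  have fs: "f \<in> gad_arcs" using U(1) ef(3) by (auto simp: gad.tri_def)
  have efr: "0 \<le> fst e \<and> fst e < snd e \<and> snd e \<le> 115" "0 \<le> fst f \<and> fst f < snd f \<and> snd f \<le> 115"
    using q(1-4) r(1,2) by auto
  have Yf: "Y f \<in> A" using fs efr y_sees[of "fst f" "snd f"] by (auto simp: Y_def gad_arcs_def)
  have Ye: "Y e \<in> T" using ef(1) by (auto simp: res_def Y_def)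
  note fl = flip_tri[OF T(1) o Yef Yf Ye r(3-6)]
  define T' where "T' = insert (Y f) (T - {Y e})"
  have inj: "Y (i, j) = Y e \<longleftrightarrow> (i, j) = e" "Y (i, j) = Y f \<longleftrightarrow> (i, j) = f" if "0 \<le> i" "i < j" "j \<le> 115" for i j
    using y_eq[of i "fst e"] y_eq[of j "snd e"] y_eq[of i "fst f"] y_eq[of j "snd f"] efr that
    by (auto simp: Y_def prod_eq_iff)
  have "e \<noteq> (0, 115)" "\<And>i. e \<noteq> (i, i + 1)" using q(1-4) r(1,2) by auto
  then have "Y e \<notin> rim"
    using inj(1)[of 0 115] inj(1)[of i "i + 1" for i] unfolding rim_def Y_def by fastforce
  then have "rim \<subseteq> T'" using T(2) by (auto simp: T'_def)
  moreover have "flip_step T T'" unfolding flip_step_def T'_def using Ye fl(2) by blast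
  moreover have "res T' = U"
  proof (rule set_eqI)
    fix g :: "int \<times> int" obtain i j where g: "g = (i, j)" by (cases g)
    have Yg: "(y i, y j) = Y (i, j)" by (simp add: Y_def)
    show "g \<in> res T' \<longleftrightarrow> g \<in> U"
    proof (cases "0 \<le> i \<and> i < j \<and> j \<le> 115")
      case True
      then show ?thesis unfolding g res_def T'_def ef(3) using inj[of i j] by (simp add: Yg)
    next
      case False
      then have "g \<noteq> f" using efr(2) g by auto
      then show ?thesis using False unfolding g res_def T'_def ef(3) by auto
    qed
  qed
  ultimately show ?thesis using fl(1) unfolding T'_def by blast
qed

lemma lift_path:
  assumes "tri T" "rim \<subseteq> T" "Gs 0 = res T" "\<And>k. k \<le> m \<Longrightarrow> gad.tri (Gs k)"
    "\<And>k. k < m \<Longrightarrow> flip_step (Gs k) (Gs (Suc k))"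
  shows "\<exists>Ts. Ts 0 = T \<and> walk Ts m \<and> (\<forall>k \<le> m. rim \<subseteq> Ts k \<and> res (Ts k) = Gs k)"
  using assms(4,5)
proof (induction m)
  case 0
  then show ?case using assms by (intro exI[of _ "\<lambda>_. T"]) (simp add: walk_def)
next
  case (Suc m)
  then obtain Ts where Ts: "Ts 0 = T" "walk Ts m" "\<forall>k \<le> m. rim \<subseteq> Ts k \<and> res (Ts k) = Gs k" by force
  have "flip_step (res (Ts m)) (Gs (Suc m))" using Ts Suc by simp
  then obtain T' where T': "tri T'" "rim \<subseteq> T'" "flip_step (Ts m) T'" "res T' = Gs (Suc m)"
    using lift_flip[of "Ts m" "Gs (Suc m)"] Ts Suc by (auto simp: walk_def)
  define Us where "Us k = (if k \<le> m then Ts k else T')" for k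
  have "walk Us (Suc m)" using Ts(2) T' unfolding walk_def Us_def
    by (auto simp: le_Suc_eq less_Suc_eq)
  moreover have "\<forall>k \<le> Suc m. rim \<subseteq> Us k \<and> res (Us k) = Gs k" using Ts T' by (auto simp: Us_def le_Suc_eq)
  moreover have "Us 0 = T" using Ts(1) by (simp add: Us_def)
  ultimately show ?case by blast
qed

text \<open>If every common arc of the ends were kept by all geodesics, a geodesic between the two
  triangulations would keep the rim and \<open>\<epsilon>\<close>; restricted to the gadget it has at least \<open>152\<close> steps, so the explicit
  path, which drops \<open>\<epsilon>\<close> at once, would be a geodesic as well.\<close>

theorem escaping_geodesic:
  "\<exists>Ts n e. geodesic_walk Ts n \<and> e \<in> Ts 0 \<and> e \<in> Ts n \<and> (\<exists>k \<le> n. e \<notin> Ts k)"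
proof (rule ccontr)
  assume "\<not> ?thesis"
  then have keep: "\<And>Ts n e k. geodesic_walk Ts n \<Longrightarrow> e \<in> Ts 0 \<Longrightarrow> e \<in> Ts n \<Longrightarrow> k \<le> n \<Longrightarrow> e \<in> Ts k" by blast
  obtain G where G: "gad.tri G" "set start_list \<subseteq> G" using gad_start by blast
  define S where "S = (\<lambda>(i, j). (y i, y j)) ` G"
  have Gr: "0 \<le> i \<and> i < j \<and> j \<le> 115 \<and> sees i j" if "(i, j) \<in> G" for i j
    using gad.tri_arc[OF G(1) that] by (auto simp: gad_arcs_def)
  have "S \<subseteq> A" using Gr y_sees by (fastforce simp: S_def)
  moreover have "\<not> crosses e f" if ef: "e \<in> S" "f \<in> S" for e f
  proof -
    obtain g h where gh: "g \<in> G" "h \<in> G" "e = (case g of (i, j) \<Rightarrow> (y i, y j))" "f = (case h of (i, j) \<Rightarrow> (y i, y j))"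
      using ef unfolding S_def by blast
    obtain i j k l where "g = (i, j)" "h = (k, l)" by (cases g; cases h)
    with gh have "e = (y i, y j)" "(i, j) \<in> G" "f = (y k, y l)" "(k, l) \<in> G" by simp_all
    then show ?thesis using gad.tri_noncrossing[OF G(1), of "(i, j)" "(k, l)"] y_crosses[of i j k l] Gr[of i j] Gr[of k l] by simp
  qed
  ultimately obtain T where T: "tri T" "S \<subseteq> T" using tri_extend by blast
  have GT': "(y i, y j) \<in> T" if "(i, j) \<in> G" for i j
    using T(2) that unfolding S_def by force
  have rim: "rim \<subseteq> T"
    unfolding rim_def using GT'[OF boundary_edges(2)[OF G(1)]] GT'[OF boundary_edges(1)[OF G(1)]] by auto
  have GT: "set start_list \<subseteq> res T"
  proof
    fix e assume "e \<in> set start_list"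
    then have e: "e \<in> G" using G by blast
    obtain i j where ij: "e = (i, j)" by (cases e)
    have "(y i, y j) \<in> S" unfolding S_def using e ij by force
    then show "e \<in> res T" using T(2) Gr[of i j] e ij by (auto simp: res_def)
  qed
  obtain Gs where Gs: "Gs 0 = res T" "\<And>k. k \<le> 152 \<Longrightarrow> gad.tri (Gs k)" "\<And>k. k < 152 \<Longrightarrow> flip_step (Gs k) (Gs (Suc k))"
    "set goal_list \<subseteq> Gs 152" "(103, 105) \<notin> Gs 1"
    by (rule gad_path[OF res_tri[OF T(1) rim] GT]) blast
  obtain Ts where Ts: "Ts 0 = T" "walk Ts 152" "\<forall>k \<le> 152. rim \<subseteq> Ts k \<and> res (Ts k) = Gs k"
    using lift_path[OF T(1) rim Gs(1-3)] by blast
  let ?W = "\<lambda>n. \<exists>Us. walk Us n \<and> Us 0 = Ts 0 \<and> Us n = Ts 152"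
  have "?W 152" using Ts(2) by blast
  define n where "n = (LEAST n. ?W n)"
  have n: "?W n" "n \<le> 152" "\<And>m. ?W m \<Longrightarrow> n \<le> m"
    unfolding n_def using \<open>?W 152\<close> by (rule LeastI, rule Least_le) (rule Least_le)
  obtain Us where Us: "walk Us n" "Us 0 = Ts 0" "Us n = Ts 152" using n(1) by blast
  have geo: "geodesic_walk Us n" unfolding geodesic_walk_def using Us n(3) by auto
  have goal: "set goal_list \<subseteq> res (Us n)" using Us(3) Ts(3) Gs(4) by simp
  have start: "set start_list \<subseteq> res (Us 0)" using Us(2) Ts(1) GT by simp
  have eps_s: "(103, 105) \<in> set start_list" "(103, 105) \<in> set goal_list"
    unfolding start_list_def goal_list_def list.set(2) insert_iff by blast+
  have eps: "(y 103, y 105) \<in> Us 0" "(y 103, y 105) \<in> Us n"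
    using start goal eps_s by (auto simp: res_def)
  have rims: "rim \<subseteq> Us k" if "k \<le> n" for k
    using keep[OF geo _ _ that] Us(2,3) Ts(1,3) rim by blast
  interpret gw: gad_walk "\<lambda>k. res (Us k)" n
  proof
    fix s assume s: "s \<le> n"
    show "gad.tri (res (Us s))" using res_tri rims[OF s] Us(1) s by (auto simp: walk_def)
    show "(103, 105) \<in> res (Us s)" using keep[OF geo eps s] by (auto simp: res_def)
  next
    fix s assume s: "s < n"
    show "res (Us (Suc s)) = res (Us s) \<or> flip_step (res (Us s)) (res (Us (Suc s)))"
      by (rule res_step) (use Us(1) rims s in \<open>auto simp: walk_def\<close>)
  qed
  have "n = 152" using gw.gad_distance[OF start goal] n(2) by simp
  then have "geodesic_walk Ts 152" using geo Ts(2) Us unfolding geodesic_walk_def by simp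
  then have "(y 103, y 105) \<in> Ts 1" using keep[of Ts 152 "(y 103, y 105)" 1] eps Us by simp
  then have "(103, 105) \<in> res (Ts 1)" by (simp add: res_def)
  then show False using Ts(3) Gs(5) by simp
qed

end

section \<open>Oriented area and rays in a simple closed curve\<close>

text \<open>Twice the signed area of the triangle spanned by two vectors; it is positive when \<open>b\<close> is to the left of \<open>a\<close>.\<close>

definition cr :: "complex \<Rightarrow> complex \<Rightarrow> real" where
  "cr a b = Re a * Im b - Im a * Re b"

lemma cr_simps [simp]: "cr a a = 0" "cr 0 a = 0" "cr a 0 = 0" "cr (- a) b = - cr a b" "cr a (- b) = - cr a b"
  by (simp_all add: cr_def algebra_simps)

lemma cr_add: "cr (a + b) c = cr a c + cr b c" "cr a (b + c) = cr a b + cr a c"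
  by (simp_all add: cr_def algebra_simps)

lemma cr_diff: "cr (a - b) c = cr a c - cr b c" "cr a (b - c) = cr a b - cr a c"
  by (simp_all add: cr_def algebra_simps)

lemma cr_scale: "cr (t *\<^sub>R a) b = t * cr a b" "cr a (t *\<^sub>R b) = t * cr a b"
  by (simp_all add: cr_def algebra_simps)

lemma cr_swap: "cr a b = - cr b a"
  by (simp add: cr_def)

lemma cr_zero_imp_parallel:
  assumes "cr u z = 0" "norm u = 1" shows "z = (u \<bullet> z) *\<^sub>R u"
proof -
  have n: "Re u * Re u + Im u * Im u = 1"
    using assms(2) cmod_power2[of u] by (simp add: power2_eq_square)
  have c: "Re u * Im z = Im u * Re z" using assms(1) by (simp add: cr_def)
  have "Re z = Re z * (Re u * Re u + Im u * Im u)" "Im z = Im z * (Re u * Re u + Im u * Im u)" using n by simp_all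
  then have "Re z = (Re u * Re z + Im u * Im z) * Re u" "Im z = (Re u * Re z + Im u * Im z) * Im u"
    using c by algebra+
  then show ?thesis by (simp add: complex_eq_iff inner_complex_def)
qed

lemma cr_inner: "cr u z = Complex (- Im u) (Re u) \<bullet> z" "cr z u = Complex (Im u) (- Re u) \<bullet> z"
  by (simp_all add: cr_def inner_complex_def)

lemma convex_half: "convex {z. 0 < cr u z}" "convex {z. 0 < cr z u}" "convex {z. cr u z < 0}" "convex {z. cr z u < 0}"
  unfolding cr_inner(1)[of u] cr_inner(2)[of _ u] by (rule convex_halfspace_gt convex_halfspace_lt)+

text \<open>Each of the sets contains a ray of the real line, and two of three rays point the same way.\<close>

lemma unbounded_reals_meet:
  fixes A :: "nat \<Rightarrow> real set"
  assumes "\<And>i. i < 3 \<Longrightarrow> Topological_Spaces.connected (A i)" "\<And>i. i < 3 \<Longrightarrow> \<not> bounded (A i)"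
  shows "\<exists>i j. i < 3 \<and> j < 3 \<and> i \<noteq> j \<and> A i \<inter> A j \<noteq> {}"
proof -
  have up: "\<exists>a. {a..} \<subseteq> A i" if i3: "i < 3" and nb: "\<not> bdd_above (A i)" for i
  proof -
    obtain a where a: "a \<in> A i" using nb by fastforce
    have "t \<in> A i" if t: "a \<le> t" for t
    proof -
      obtain b where "b \<in> A i" "t < b" using \<open>\<not> bdd_above (A i)\<close> by (meson bdd_above.I not_le)
      then show ?thesis using connected_contains_Icc[OF assms(1)[OF \<open>i < 3\<close>] a, of b] t by auto
    qed
    then show ?thesis by auto
  qed
  have dn: "\<exists>a. {..a} \<subseteq> A i" if i3: "i < 3" and nb: "\<not> bdd_below (A i)" for i
  proof -
    obtain a where a: "a \<in> A i" using nb by fastforce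
    have "t \<in> A i" if t: "t \<le> a" for t
    proof -
      obtain b where "b \<in> A i" "b < t" using \<open>\<not> bdd_below (A i)\<close> by (meson bdd_below.I not_le)
      then show ?thesis using connected_contains_Icc[OF assms(1)[OF \<open>i < 3\<close>] _ a, of b] t by auto
    qed
    then show ?thesis by auto
  qed
  have b: "\<not> bdd_above (A i) \<or> \<not> bdd_below (A i)" if "i < 3" for i
  proof (rule ccontr)
    assume "\<not> (\<not> bdd_above (A i) \<or> \<not> bdd_below (A i))"
    then obtain m M where "\<And>x. x \<in> A i \<Longrightarrow> m \<le> x" "\<And>x. x \<in> A i \<Longrightarrow> x \<le> M"
      unfolding bdd_above_def bdd_below_def by blast
    then have "A i \<subseteq> {m..M}" by auto
    then show False using assms(2)[OF that] bounded_closed_interval bounded_subset by blast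
  qed
  have meet_up: "A i \<inter> A j \<noteq> {}" if "i < 3" "j < 3" "\<not> bdd_above (A i)" "\<not> bdd_above (A j)" for i j
    using up[OF that(1,3)] up[OF that(2,4)] by (metis Int_iff atLeast_iff empty_iff max.cobounded1 max.cobounded2 subsetD)
  have meet_dn: "A i \<inter> A j \<noteq> {}" if "i < 3" "j < 3" "\<not> bdd_below (A i)" "\<not> bdd_below (A j)" for i j
    using dn[OF that(1,3)] dn[OF that(2,4)] by (metis Int_iff atMost_iff empty_iff min.cobounded1 min.cobounded2 subsetD)
  show ?thesis
    using b[of 0] b[of 1] b[of 2] meet_up[of 0 1] meet_up[of 0 2] meet_up[of 1 2] meet_dn[of 0 1] meet_dn[of 0 2] meet_dn[of 1 2]
    by (metis numeral_3_eq_3 numeral_2_eq_2 One_nat_def lessI less_SucI zero_less_Suc zero_neq_one n_not_Suc_n Suc_neq_Zero)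
qed

lemma punctured_loop_real:
  fixes g :: "real \<Rightarrow> complex"
  assumes "simple_path g" "pathfinish g = pathstart g" "p \<in> path_image g"
  shows "\<exists>f h. homeomorphism (path_image g - {p}) {z. \<i> \<bullet> z = 0} f h"
proof -
  have "path_image g homeomorphic sphere (0::complex) 1"
    by (rule homeomorphic_simple_path_image_circle) (use assms in auto)
  then obtain f h where fh: "homeomorphism (path_image g) (sphere (0::complex) 1) f h" by (auto simp: homeomorphic_def)
  have fp: "f p \<in> sphere 0 1" using fh assms(3) by (auto simp: homeomorphism_def)
  have im: "f ` (path_image g - {p}) = sphere 0 1 - {f p}"
  proof -
    have "inj_on f (path_image g)" using fh by (metis homeomorphism_def inj_on_inverseI)
    then have "f ` (path_image g - {p}) = f ` path_image g - f ` {p}" using assms(3) by (simp add: inj_on_image_set_diff)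
    then show ?thesis using fh by (simp add: homeomorphism_def)
  qed
  have "homeomorphism (path_image g - {p}) (sphere 0 1 - {f p}) f h"
    by (rule homeomorphism_of_subsets[OF fh]) (use im in auto)
  then have "(path_image g - {p}) homeomorphic (sphere 0 1 - {f p})" by (auto simp: homeomorphic_def)
  also have "(sphere 0 1 - {f p}) homeomorphic {z. \<i> \<bullet> z = 0}"
    by (rule homeomorphic_punctured_sphere_hyperplane[of 1 "f p" 0 \<i> 0]) (use fp in auto)
  finally show ?thesis by (simp add: homeomorphic_def)
qed

text \<open>The curve without \<open>p\<close> is homeomorphic to a line. The three legs become connected subsets of the line;
  they are unbounded, because \<open>p\<close> is missing from the curve, so two of them would meet.\<close>

lemma loop_no_triod:
  fixes g :: "real \<Rightarrow> complex" and d :: "nat \<Rightarrow> complex"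
  assumes g: "simple_path g" "pathfinish g = pathstart g" and p: "p \<in> path_image g" and r: "0 < r"
    and d: "\<And>i. i < 3 \<Longrightarrow> norm (d i) = 1" and inj: "\<And>i j. i < 3 \<Longrightarrow> j < 3 \<Longrightarrow> d i = d j \<Longrightarrow> i = j"
    and sub: "\<And>i t. i < 3 \<Longrightarrow> 0 < t \<Longrightarrow> t < r \<Longrightarrow> p + t *\<^sub>R d i \<in> path_image g"
  shows False
proof -
  obtain f h where fh: "homeomorphism (path_image g - {p}) {z. \<i> \<bullet> z = 0} f h"
    using punctured_loop_real[OF g p] by blast
  have cf: "continuous_on (path_image g - {p}) f" and ch: "continuous_on {z. \<i> \<bullet> z = 0} h"
    and hf: "\<And>z. z \<in> path_image g - {p} \<Longrightarrow> h (f z) = z" and fim: "f ` (path_image g - {p}) = {z. \<i> \<bullet> z = 0}"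
    and him: "h ` {z. \<i> \<bullet> z = 0} = path_image g - {p}"
    using fh by (auto simp: homeomorphism_def)
  define R where "R i = (\<lambda>t. p + t *\<^sub>R d i) ` {0<..<r}" for i
  have dn0: "d i \<noteq> 0" if "i < 3" for i using d[OF that] by auto
  have RJ: "R i \<subseteq> path_image g - {p}" if "i < 3" for i
    using sub[OF that] dn0[OF that] by (auto simp: R_def)
  have conR: "Topological_Spaces.connected (R i)" for i
    unfolding R_def by (intro connected_continuous_image continuous_intros) auto
  define A where "A i = (\<lambda>z. Re (f z)) ` R i" for i
  have Im0: "Im (f z) = 0" if "z \<in> path_image g - {p}" for z
    using fim that by (auto simp: inner_complex_def)
  have "Topological_Spaces.connected (A i)" if "i < 3" for i
    unfolding A_def by (intro connected_continuous_image continuous_intros conR continuous_on_subset[OF cf RJ[OF that]])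
  moreover have "\<not> bounded (A i)" if "i < 3" for i
  proof
    assume "bounded (A i)"
    then obtain B where B: "\<And>z. z \<in> R i \<Longrightarrow> \<bar>Re (f z)\<bar> \<le> B" by (auto simp: A_def bounded_iff)
    define K where "K = {z. \<i> \<bullet> z = 0} \<inter> cball 0 B"
    have "compact K" unfolding K_def by (intro closed_Int_compact closed_hyperplane compact_cball)
    then have "compact (h ` K)" by (intro compact_continuous_image continuous_on_subset[OF ch]) (auto simp: K_def)
    then have cl: "closed (h ` K)" by (rule compact_imp_closed)
    have "R i \<subseteq> h ` K"
    proof
      fix z assume z: "z \<in> R i"
      then have zJ: "z \<in> path_image g - {p}" using RJ[OF that] by blast
      have "norm (f z) = \<bar>Re (f z)\<bar>" using Im0[OF zJ] by (simp add: cmod_def)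
      then have "f z \<in> K" using B[OF z] fim zJ by (auto simp: K_def)
      then show "z \<in> h ` K" using hf[OF zJ] by force
    qed
    then have "closure (R i) \<subseteq> h ` K" using cl by (simp add: closure_minimal)
    moreover have "p \<in> closure (R i)"
      unfolding closure_approachable
    proof (intro allI impI)
      fix e :: real assume e: "0 < e"
      define t where "t = min (e/2) (r/2)"
      have "0 < t" "t < r" "t < e" using e r by (auto simp: t_def)
      then have "p + t *\<^sub>R d i \<in> R i" "dist (p + t *\<^sub>R d i) p < e" using d[OF that] by (auto simp: R_def dist_norm)
      then show "\<exists>y\<in>R i. dist y p < e" by blast
    qed
    moreover have "h ` K \<subseteq> path_image g - {p}" using him by (auto simp: K_def)
    ultimately show False by blast
  qed
  ultimately obtain i j where ij: "i < 3" "j < 3" "i \<noteq> j" "A i \<inter> A j \<noteq> {}" using unbounded_reals_meet[of A] by metis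
  then obtain z z' where z: "z \<in> R i" "z' \<in> R j" "Re (f z) = Re (f z')" by (auto simp: A_def)
  have zJ: "z \<in> path_image g - {p}" "z' \<in> path_image g - {p}" using z RJ ij by blast+
  have "f z = f z'" using z(3) Im0[OF zJ(1)] Im0[OF zJ(2)] by (simp add: complex_eq_iff)
  then have "z = z'" using hf zJ by metis
  then obtain s t where st: "0 < s" "0 < t" "s *\<^sub>R d i = t *\<^sub>R d j" using z by (auto simp: R_def)
  then have "norm (s *\<^sub>R d i) = norm (t *\<^sub>R d j)" by simp
  then have "s = t" using st(1,2) d[OF ij(1)] d[OF ij(2)] by (simp only: norm_scaleR)
  then show False using st inj[OF ij(1,2)] ij(3) by auto
qed

section \<open>Local shape of a polygon\<close>

text \<open>The last two assumptions express interior angles in a form that survives isometries: the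
  directions into the polygon at an ordinary vertex do not contain a half-plane, and those at the
  apex are not contained in one.\<close>

locale polygon =
  fixes Q :: "complex set" and E :: "complex set set" and X :: "complex set" and o\<^sub>x :: complex
  assumes compact_Q: "compact Q" and int_ne: "interior Q \<noteq> {}"
    and loop: "\<exists>g :: real \<Rightarrow> complex. simple_path g \<and> pathfinish g = pathstart g \<and> path_image g = frontier Q"
    and finite_E: "finite E" and edges: "e \<in> E \<Longrightarrow> \<exists>a b. a \<noteq> b \<and> e = closed_segment a b"
    and E_frontier: "\<Union>E = frontier Q"
    and X_def: "X = {a. \<exists>b. a \<noteq> b \<and> closed_segment a b \<in> E}"
    and apex: "o\<^sub>x \<in> X"
    and convex_vertex: "v \<in> X \<Longrightarrow> v \<noteq> o\<^sub>x \<Longrightarrow> u \<noteq> 0 \<Longrightarrow>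
      \<exists>z. 0 \<le> u \<bullet> z \<and> z \<noteq> 0 \<and> \<not> (\<exists>\<delta>>0. \<forall>t. 0 < t \<and> t < \<delta> \<longrightarrow> v + t *\<^sub>R z \<in> Q)"
    and reflex_apex: "u \<noteq> 0 \<Longrightarrow>
      \<exists>z. u \<bullet> z < 0 \<and> (\<exists>\<delta>>0. \<forall>t. 0 < t \<and> t < \<delta> \<longrightarrow> o\<^sub>x + t *\<^sub>R z \<in> Q)"
begin

abbreviation "J \<equiv> frontier Q"
abbreviation "I \<equiv> interior Q"

lemma closed_Q: "closed Q" using compact_Q by (rule compact_imp_closed)

lemma J_sub: "J \<subseteq> Q" using closed_Q by (simp add: frontier_subset_closed)

lemma Q_split: "z \<in> Q \<Longrightarrow> z \<notin> J \<Longrightarrow> z \<in> I"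
  using closed_Q by (simp add: frontier_def)

lemma I_not_J: "z \<in> I \<Longrightarrow> z \<notin> J" by (simp add: frontier_def)

text \<open>The complement of the curve has two components. The unbounded one does not meet the compact set, and the
  interior is nonempty, so it is the bounded one.\<close>

lemma I_inside: "I = inside J" "Topological_Spaces.connected I" "J \<subseteq> closure I"
proof -
  obtain g :: "real \<Rightarrow> complex" where g: "simple_path g" "pathfinish g = pathstart g" "path_image g = J" using loop by blast
  have Jo: "inside J \<noteq> {}" "open (inside J)" "Topological_Spaces.connected (inside J)" "Topological_Spaces.connected (outside J)" "\<not> bounded (outside J)"
    "inside J \<union> outside J = - J" "frontier (inside J) = J"
    using Jordan_inside_outside[OF g(1,2)] unfolding g(3) by blast+
  have side: "S \<subseteq> Q \<or> S \<inter> Q = {}" if "Topological_Spaces.connected S" "S \<inter> J = {}" for S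
    using connected_Int_frontier[OF that(1), of Q] that(2) by blast
  have out: "outside J \<inter> Q = {}"
  proof -
    have "\<not> outside J \<subseteq> Q" using Jo(5) compact_imp_bounded[OF compact_Q] bounded_subset by blast
    then show ?thesis using side[OF Jo(4)] Jo(6) by blast
  qed
  have "I \<subseteq> inside J" using I_not_J Jo(6) out interior_subset by blast
  moreover from this have "inside J \<subseteq> Q" using side[OF Jo(3)] Jo(6) int_ne interior_subset by blast
  then have "inside J \<subseteq> I" using Jo(2) by (simp add: interior_maximal)
  ultimately show eq: "I = inside J" by blast
  show "Topological_Spaces.connected I" unfolding eq by (rule Jo(3))
  show "J \<subseteq> closure I" unfolding eq using Jo(7) by (metis Diff_subset frontier_def)
qed

lemma X_J: "X \<subseteq> J"
  unfolding X_def using E_frontier by auto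

lemma finite_X: "finite X"
proof -
  have "X \<subseteq> (\<Union>e\<in>E. {a. \<exists>b. e = closed_segment a b})" unfolding X_def by auto
  moreover have "finite {a. \<exists>b. e = closed_segment a b}" if e: "e \<in> E" for e
  proof -
    obtain a b where "e = closed_segment a b" using edges[OF e] by blast
    then have "{a. \<exists>b. e = closed_segment a b} \<subseteq> {a, b}" by (auto simp: doubleton_eq_iff)
    then show ?thesis by (rule finite_subset) simp
  qed
  ultimately show ?thesis using finite_E by (meson finite_UN_I finite_subset)
qed

text \<open>The unit vectors along which the boundary leaves \<open>p\<close>.\<close>

definition dirs :: "complex \<Rightarrow> complex set" where
  "dirs p = {sgn (a - p) | a. a \<noteq> p \<and> (\<exists>b. a \<noteq> b \<and> closed_segment a b \<in> E \<and> p \<in> closed_segment a b)}"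

lemma dirs_unit: "d \<in> dirs p \<Longrightarrow> norm d = 1"
  by (auto simp: dirs_def norm_sgn)

lemma dirsI: "closed_segment a b \<in> E \<Longrightarrow> p \<in> closed_segment a b \<Longrightarrow> a \<noteq> b \<Longrightarrow> a \<noteq> p \<Longrightarrow> sgn (a - p) \<in> dirs p"
  unfolding dirs_def by blast

lemma dirsI': "closed_segment a b \<in> E \<Longrightarrow> p \<in> closed_segment a b \<Longrightarrow> a \<noteq> b \<Longrightarrow> b \<noteq> p \<Longrightarrow> sgn (b - p) \<in> dirs p"
  using dirsI[of b a p] closed_segment_commute[of a b] by metis

lemma segment_sgn:
  fixes p b q :: complex
  assumes "q \<in> closed_segment p b" "q \<noteq> p" shows "sgn (q - p) = sgn (b - p)" "b \<noteq> p"
proof -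
  obtain t where t: "q = (1 - t) *\<^sub>R p + t *\<^sub>R b" "0 \<le> t" "t \<le> 1" using assms(1) by (auto simp: in_segment)
  have q: "q - p = t *\<^sub>R (b - p)" using t(1) by (simp add: algebra_simps)
  have "t \<noteq> 0" using q assms(2) by auto
  then show "sgn (q - p) = sgn (b - p)" unfolding q using t(2) by (simp add: sgn_scaleR)
  show "b \<noteq> p" using q assms(2) by auto
qed

lemma local_rays:
  assumes p: "p \<in> J"
  obtains r where "0 < r" "\<And>q. dist p q < r \<Longrightarrow> q \<in> J \<longleftrightarrow> q = p \<or> sgn (q - p) \<in> dirs p"
proof -
  define C where "C = \<Union>{e \<in> E. p \<notin> e} \<union> (X - {p})"
  have "closed C" unfolding C_def
    by (intro closed_Un closed_Union finite_imp_closed) (use finite_E finite_X edges closed_segment in \<open>force+\<close>)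
  moreover have "p \<notin> C" by (auto simp: C_def)
  ultimately obtain r where r: "0 < r" "ball p r \<inter> C = {}"
    by (metis ComplI disjoint_eq_subset_Compl open_Compl open_contains_ball)
  show ?thesis
  proof (rule that[OF r(1)])
    fix q assume q: "dist p q < r"
    show "q \<in> J \<longleftrightarrow> q = p \<or> sgn (q - p) \<in> dirs p"
    proof
      assume qJ: "q \<in> J"
      show "q = p \<or> sgn (q - p) \<in> dirs p"
      proof (cases "q = p")
        case False
        obtain e where e: "e \<in> E" "q \<in> e" using qJ E_frontier by blast
        have pe: "p \<in> e" using e r(2) q by (auto simp: C_def)
        obtain a b where ab: "a \<noteq> b" "e = closed_segment a b" using edges[OF e(1)] by blast
        have "q \<in> closed_segment p a \<or> q \<in> closed_segment p b"
          using Un_closed_segment[of p a b] pe e(2) ab(2) by (auto simp: closed_segment_commute)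
        then show ?thesis
        proof
          assume "q \<in> closed_segment p a"
          from segment_sgn[OF this False] show ?thesis using dirsI[of a b p] ab e pe by simp
        next
          assume "q \<in> closed_segment p b"
          from segment_sgn[OF this False] show ?thesis using dirsI'[of a b p] ab e pe by simp
        qed
      qed simp
    next
      assume "q = p \<or> sgn (q - p) \<in> dirs p"
      then show "q \<in> J"
      proof
        assume "sgn (q - p) \<in> dirs p"
        then obtain a b where ab: "sgn (q - p) = sgn (a - p)" "a \<noteq> p" "a \<noteq> b" "closed_segment a b \<in> E" "p \<in> closed_segment a b"
          by (auto simp: dirs_def)
        have "a \<in> C" unfolding C_def X_def using ab by auto
        then have "a \<notin> ball p r" using r(2) by blast
        then have far: "norm (q - p) < norm (a - p)" using q by (simp add: dist_norm norm_minus_commute)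
        define s where "s = norm (q - p) / norm (a - p)"
        have s: "0 \<le> s" "s \<le> 1" using far ab(2) by (auto simp: s_def divide_simps)
        have "q - p = norm (q - p) *\<^sub>R sgn (q - p)" by (cases "q = p") (simp_all add: sgn_div_norm)
        also have "\<dots> = s *\<^sub>R (a - p)" unfolding ab(1) s_def by (simp add: sgn_div_norm divide_inverse)
        finally have "q = (1 - s) *\<^sub>R p + s *\<^sub>R a" by (simp add: algebra_simps)
        then have "q \<in> closed_segment p a" using s by (auto simp: in_segment)
        then have "q \<in> closed_segment a b" using Un_closed_segment[OF ab(5)] by (auto simp: closed_segment_commute)
        then show ?thesis using ab(4) E_frontier by blast
      qed (use p in simp)
    qed
  qed
qed

lemma dirs_le2:
  assumes p: "p \<in> J" and d: "u \<in> dirs p" "v \<in> dirs p" "w \<in> dirs p" shows "u = v \<or> v = w \<or> u = w"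
proof (rule ccontr)
  assume n: "\<not> ?thesis"
  obtain g :: "real \<Rightarrow> complex" where g: "simple_path g" "pathfinish g = pathstart g" "path_image g = J" using loop by blast
  obtain r where r: "0 < r" "\<And>q. dist p q < r \<Longrightarrow> q \<in> J \<longleftrightarrow> q = p \<or> sgn (q - p) \<in> dirs p"
    using local_rays[OF p] by blast
  define d where "d i = (if i = 0 then u else if i = 1 then v else w)" for i :: nat
  have di: "d i \<in> dirs p" for i using assms by (simp add: d_def)
  show False
  proof (rule loop_no_triod[OF g(1,2), of p r d])
    fix i and t :: real assume t: "0 < t" "t < r"
    have u: "norm (d i) = 1" using dirs_unit[OF di] .
    have "sgn (t *\<^sub>R d i) = d i" using t u by (simp add: sgn_scaleR sgn_div_norm)
    then show "p + t *\<^sub>R d i \<in> path_image g" unfolding g(3)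
      using r(2)[of "p + t *\<^sub>R d i"] t u di by (simp add: dist_norm)
  next
    fix i j :: nat assume "i < 3" "j < 3" "d i = d j"
    then show "i = j" using n unfolding d_def by (auto split: if_split_asm)
  next
    show "norm (d i) = 1" for i by (rule dirs_unit[OF di])
  qed (use p g r in auto)
qed

lemma dirs_ne:
  assumes "p \<in> J" shows "dirs p \<noteq> {}"
proof -
  obtain e where e: "e \<in> E" "p \<in> e" using assms E_frontier by blast
  obtain a b where ab: "a \<noteq> b" "e = closed_segment a b" using edges[OF e(1)] by blast
  show ?thesis
  proof (cases "a = p")
    case False then show ?thesis using dirsI[of a b p] e ab by auto
  next
    case True
    then show ?thesis using dirsI'[of a b p] e ab by auto
  qed
qed

lemma dirs_opposite:
  assumes "p \<notin> X" "u \<in> dirs p" shows "- u \<in> dirs p"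
proof -
  obtain a b where ab: "u = sgn (a - p)" "a \<noteq> p" "a \<noteq> b" "closed_segment a b \<in> E" "p \<in> closed_segment a b"
    using assms(2) by (auto simp: dirs_def)
  have "closed_segment b a \<in> E" "b \<noteq> a" using ab by (simp_all add: closed_segment_commute)
  then have bp: "b \<noteq> p" using assms(1) X_def by auto
  obtain t where t: "p = (1 - t) *\<^sub>R a + t *\<^sub>R b" "0 \<le> t" "t \<le> 1" using ab(5) by (auto simp: in_segment)
  have "t \<noteq> 0" "t \<noteq> 1" using t(1) ab(2) bp by auto
  then have t': "0 < t" "t < 1" using t by auto
  have "a - p = t *\<^sub>R (a - b)" "b - p = (1 - t) *\<^sub>R (b - a)" using t(1) by (simp_all add: algebra_simps)
  then have "sgn (b - p) = sgn (b - a)" "sgn (a - p) = sgn (a - b)" using t' by (simp_all add: sgn_scaleR)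
  then have "sgn (b - p) = - sgn (a - p)" using sgn_minus[of "a - b"] by simp
  then have "sgn (b - p) = - u" using ab(1) by simp
  moreover have "sgn (b - p) \<in> dirs p"
    by (rule dirsI'[OF ab(4,5,3) bp])
  ultimately show ?thesis by simp
qed

lemma connected_side: "Topological_Spaces.connected S \<Longrightarrow> S \<inter> J = {} \<Longrightarrow> S \<subseteq> Q \<or> S \<inter> Q = {}"
  using connected_Int_frontier[of S Q] by blast

text \<open>A boundary point is a limit of interior and of exterior points, so the two sides cannot both be
  inside or both outside.\<close>

lemma two_sides:
  assumes p: "p \<in> J" and r: "0 < r"
    and S: "Topological_Spaces.connected S1" "Topological_Spaces.connected S2" "S1 \<inter> J = {}" "S2 \<inter> J = {}" "ball p r \<subseteq> S1 \<union> S2 \<union> J"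
  shows "S1 \<subseteq> Q \<and> S2 \<inter> Q = {} \<or> S2 \<subseteq> Q \<and> S1 \<inter> Q = {}"
proof -
  have "p \<in> closure I" using I_inside(3) p by blast
  then obtain q where "q \<in> I" "dist q p < r" using r by (auto simp: closure_approachable)
  then have q: "q \<in> Q" "q \<in> S1 \<union> S2" using I_not_J S(5) interior_subset by (auto simp: dist_commute)
  have "p \<in> closure (- Q)" using p by (simp add: frontier_closures)
  then obtain q' where "q' \<in> - Q" "dist q' p < r" using r by (auto simp: closure_approachable)
  then have q': "q' \<notin> Q" "q' \<in> S1 \<union> S2" using J_sub S(5) by (auto simp: dist_commute)
  show ?thesis using connected_side[OF S(1,3)] connected_side[OF S(2,4)] q q' by blast
qed

end

context polygon begin

lemma sgn_eq_unit: "norm u = 1 \<Longrightarrow> sgn z = u \<Longrightarrow> z = norm z *\<^sub>R u" for z u :: complex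
  by (cases "z = 0") (auto simp: sgn_div_norm)

lemma connected_shift: "Topological_Spaces.connected S \<Longrightarrow> Topological_Spaces.connected ((+) (p::complex) ` S)"
  by (intro connected_continuous_image continuous_intros)

lemma unit_sgn: "norm u = 1 \<Longrightarrow> 0 < s \<Longrightarrow> sgn (s *\<^sub>R u) = u" for u :: complex
  by (simp add: sgn_scaleR sgn_div_norm)

lemma shape_angle:
  assumes p: "p \<in> J" and uw: "norm u = 1" "norm w = 1" "0 < cr u w" "dirs p = {u, w}"
    and r: "0 < r" "\<And>q. dist p q < r \<Longrightarrow> q \<in> J \<longleftrightarrow> q = p \<or> sgn (q - p) \<in> dirs p"
  shows "(\<forall>z. norm z < r \<longrightarrow> (p + z \<in> Q \<longleftrightarrow> 0 \<le> cr u z \<and> 0 \<le> cr z w)) \<or>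
    (\<forall>z. norm z < r \<longrightarrow> (p + z \<in> Q \<longleftrightarrow> \<not> (0 < cr u z \<and> 0 < cr z w)))"
proof -
  have inJ: "p + z \<in> J \<longleftrightarrow> 0 \<le> cr u z \<and> 0 \<le> cr z w \<and> (cr u z = 0 \<or> cr z w = 0)" if z: "norm z < r" for z
  proof -
    have J: "p + z \<in> J \<longleftrightarrow> z = 0 \<or> sgn z = u \<or> sgn z = w" using r(2)[of "p + z"] z uw(4) by (simp add: dist_norm)
    show ?thesis
    proof
      assume "p + z \<in> J"
      then consider "z = 0" | "z = norm z *\<^sub>R u" | "z = norm z *\<^sub>R w"
        using J sgn_eq_unit[OF uw(1), of z] sgn_eq_unit[OF uw(2), of z] by blast
      then show "0 \<le> cr u z \<and> 0 \<le> cr z w \<and> (cr u z = 0 \<or> cr z w = 0)"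
      proof cases
        case 2 then obtain s where "z = s *\<^sub>R u" "0 \<le> s" by (metis norm_ge_zero)
        then show ?thesis using uw(3) by (simp add: cr_scale)
      next
        case 3 then obtain s where "z = s *\<^sub>R w" "0 \<le> s" by (metis norm_ge_zero)
        then show ?thesis using uw(3) by (simp add: cr_scale)
      qed simp
    next
      assume a: "0 \<le> cr u z \<and> 0 \<le> cr z w \<and> (cr u z = 0 \<or> cr z w = 0)"
      then have "cr u z = 0 \<or> cr w z = 0" using cr_swap[of z w] by auto
      then obtain s where "z = s *\<^sub>R u \<or> z = s *\<^sub>R w"
        using cr_zero_imp_parallel[OF _ uw(1)] cr_zero_imp_parallel[OF _ uw(2)] by blast
      moreover from this have "0 \<le> s" using a uw(3) by (auto simp: cr_scale zero_le_mult_iff)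
      ultimately show "p + z \<in> J" unfolding J using unit_sgn[OF uw(1), of s] unit_sgn[OF uw(2), of s]
        by (cases "s = 0") auto
    qed
  qed
  define A where "A = {z. 0 < cr u z} \<inter> {z. 0 < cr z w} \<inter> ball 0 r"
  define B1 where "B1 = {z. cr u z < 0} \<inter> ball 0 r"
  define B2 where "B2 = {z. cr z w < 0} \<inter> ball 0 r"
  have "Topological_Spaces.connected A" unfolding A_def by (intro convex_connected convex_Int convex_half convex_ball)
  have "Topological_Spaces.connected (B1 \<union> B2)"
  proof (rule connected_Un)
    show "Topological_Spaces.connected B1" "Topological_Spaces.connected B2"
      unfolding B1_def B2_def by (intro convex_connected convex_Int convex_half convex_ball)+
    define s where "s = r / 3"
    have "norm (s *\<^sub>R (- u - w)) \<le> s * (1 + 1)"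
      unfolding norm_scaleR using norm_triangle_ineq4[of "- u" w] uw r(1) by (simp add: s_def mult_left_mono)
    then have "norm (s *\<^sub>R (- u - w)) < r" using r(1) by (simp add: s_def)
    moreover have "cr u (s *\<^sub>R (- u - w)) < 0" "cr (s *\<^sub>R (- u - w)) w < 0"
      using uw(3) r(1) by (simp_all add: cr_scale cr_diff s_def)
    ultimately have "s *\<^sub>R (- u - w) \<in> B1 \<inter> B2" by (simp add: B1_def B2_def)
    then show "B1 \<inter> B2 \<noteq> {}" by blast
  qed
  have "p + z \<notin> J" if "z \<in> A \<union> (B1 \<union> B2)" for z
    using inJ[of z] that by (auto simp: A_def B1_def B2_def)
  then have AJ: "(+) p ` A \<inter> J = {}" "(+) p ` (B1 \<union> B2) \<inter> J = {}" by blast+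
  have cov: "ball p r \<subseteq> (+) p ` A \<union> (+) p ` (B1 \<union> B2) \<union> J"
  proof
    fix q assume "q \<in> ball p r"
    then have z: "norm (q - p) < r" by (simp add: dist_norm norm_minus_commute)
    have "q - p \<in> A \<or> q - p \<in> B1 \<union> B2 \<or> q \<in> J"
      using inJ[OF z] z by (auto simp: A_def B1_def B2_def)
    moreover have "q = p + (q - p)" by simp
    ultimately show "q \<in> (+) p ` A \<union> (+) p ` (B1 \<union> B2) \<union> J" by blast
  qed
  have mem: "p + z \<in> (+) p ` S \<longleftrightarrow> z \<in> S" for z S by auto
  have "(+) p ` A \<subseteq> Q \<and> (+) p ` (B1 \<union> B2) \<inter> Q = {} \<or> (+) p ` (B1 \<union> B2) \<subseteq> Q \<and> (+) p ` A \<inter> Q = {}"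
    by (rule two_sides[OF p r(1) _ _ AJ cov]) (intro connected_shift \<open>Topological_Spaces.connected A\<close> \<open>Topological_Spaces.connected (B1 \<union> B2)\<close>)+
  then show ?thesis
  proof (elim disjE conjE)
    assume *: "(+) p ` A \<subseteq> Q" "(+) p ` (B1 \<union> B2) \<inter> Q = {}"
    have "p + z \<in> Q \<longleftrightarrow> 0 \<le> cr u z \<and> 0 \<le> cr z w" if z: "norm z < r" for z
    proof
      assume "p + z \<in> Q"
      then have "z \<notin> B1 \<union> B2" using * mem by blast
      then show "0 \<le> cr u z \<and> 0 \<le> cr z w" using z by (auto simp: B1_def B2_def)
    next
      assume "0 \<le> cr u z \<and> 0 \<le> cr z w"
      then have "z \<in> A \<or> p + z \<in> J" using inJ[OF z] z by (auto simp: A_def)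
      then show "p + z \<in> Q" using * J_sub mem by blast
    qed
    then show ?thesis by blast
  next
    assume *: "(+) p ` (B1 \<union> B2) \<subseteq> Q" "(+) p ` A \<inter> Q = {}"
    have "p + z \<in> Q \<longleftrightarrow> \<not> (0 < cr u z \<and> 0 < cr z w)" if z: "norm z < r" for z
    proof
      assume "p + z \<in> Q"
      then have "z \<notin> A" using * mem by blast
      then show "\<not> (0 < cr u z \<and> 0 < cr z w)" using z by (auto simp: A_def)
    next
      assume "\<not> (0 < cr u z \<and> 0 < cr z w)"
      then have "z \<in> B1 \<union> B2 \<or> p + z \<in> J" using inJ[OF z] z by (auto simp: B1_def B2_def)
      then show "p + z \<in> Q" using * J_sub mem by blast
    qed
    then show ?thesis by blast
  qed
qed

text \<open>Were there only one ray, the rest of the disc would be connected, hence entirely inside or entirely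
  outside. That excludes an isolated ray, and the two opposite rays leave two half-discs.\<close>

lemma shape_line:
  assumes p: "p \<in> J" and u: "norm u = 1" "u \<in> dirs p" "dirs p \<subseteq> {u, - u}"
    and r: "0 < r" "\<And>q. dist p q < r \<Longrightarrow> q \<in> J \<longleftrightarrow> q = p \<or> sgn (q - p) \<in> dirs p"
  shows "\<exists>u'. norm u' = 1 \<and> (\<forall>z. norm z < r \<longrightarrow> (p + z \<in> Q \<longleftrightarrow> 0 \<le> cr u' z) \<and> (p + z \<in> J \<longleftrightarrow> cr u' z = 0))"
proof -
  have J: "p + z \<in> J \<longleftrightarrow> z = 0 \<or> sgn z \<in> dirs p" if "norm z < r" for z
    using r(2)[of "p + z"] that by (simp add: dist_norm)
  have par: "cr u z = 0 \<Longrightarrow> z = 0 \<or> (0 < u \<bullet> z \<and> sgn z = u) \<or> (u \<bullet> z < 0 \<and> sgn z = - u)" for z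
  proof -
    assume "cr u z = 0"
    then have z: "z = (u \<bullet> z) *\<^sub>R u" using cr_zero_imp_parallel u(1) by blast
    consider "u \<bullet> z = 0" | "0 < u \<bullet> z" | "u \<bullet> z < 0" by linarith
    then show ?thesis
    proof cases
      case 3
      have "sgn z = sgn ((- (u \<bullet> z)) *\<^sub>R (- u))" using z by simp
      then show ?thesis using unit_sgn[of "- u" "- (u \<bullet> z)"] 3 u(1) by simp
    qed (use z unit_sgn[OF u(1), of "u \<bullet> z"] in auto)
  qed
  have par': "cr u z = 0" if "sgn z \<in> {u, - u}" for z
  proof -
    have "z = norm z *\<^sub>R u \<or> z = norm z *\<^sub>R (- u)" using sgn_eq_unit[of u z] sgn_eq_unit[of "- u" z] that u(1) by auto
    then obtain s where "z = s *\<^sub>R u \<or> z = s *\<^sub>R (- u)" by blast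
    then show ?thesis by (auto simp: cr_scale)
  qed
  define A where "A = {z. 0 < cr u z} \<inter> ball 0 r"
  define B where "B = {z. cr u z < 0} \<inter> ball 0 r"
  define C where "C = {z. u \<bullet> z < 0} \<inter> ball 0 r"
  have con: "Topological_Spaces.connected A" "Topological_Spaces.connected B" "Topological_Spaces.connected C"
    unfolding A_def B_def C_def by (intro convex_connected convex_Int convex_half convex_ball convex_halfspace_lt)+
  have n: "Re u * Re u + Im u * Im u = 1" using u(1) cmod_power2[of u] by (simp add: power2_eq_square)
  have mem: "p + z \<in> (+) p ` S \<longleftrightarrow> z \<in> S" for z S by auto
  have AB: "(+) p ` A \<inter> J = {}" "(+) p ` B \<inter> J = {}"
  proof -
    have "p + z \<notin> J" if "z \<in> A \<union> B" for z
    proof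
      assume "p + z \<in> J"
      then have "z = 0 \<or> sgn z \<in> {u, - u}" using J[of z] that u(3) by (auto simp: A_def B_def)
      then have "cr u z = 0" using par'[of z] by auto
      then show False using that by (auto simp: A_def B_def)
    qed
    then show "(+) p ` A \<inter> J = {}" "(+) p ` B \<inter> J = {}" by blast+
  qed
  have "- u \<in> dirs p"
  proof (rule ccontr)
    assume no: "- u \<notin> dirs p"
    have "Topological_Spaces.connected (A \<union> C \<union> B)"
    proof (intro connected_Un con)
      define s where "s = r / 3"
      have nn: "norm (s *\<^sub>R (- u + \<i> * u)) < r" "norm (s *\<^sub>R (- u - \<i> * u)) < r"
        unfolding norm_scaleR using norm_triangle_ineq[of "- u" "\<i> * u"] norm_triangle_ineq4[of "- u" "\<i> * u"] u(1) r(1)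
        by (auto simp: s_def norm_mult field_simps)
      have "s *\<^sub>R (- u + \<i> * u) \<in> A \<inter> C" "s *\<^sub>R (- u - \<i> * u) \<in> C \<inter> B"
      proof -
        have "cr u (\<i> * u) = 1" "u \<bullet> (\<i> * u) = 0" "u \<bullet> u = 1" "0 < s"
          using n r(1) by (simp_all add: cr_def inner_complex_def s_def)
        then show "s *\<^sub>R (- u + \<i> * u) \<in> A \<inter> C" "s *\<^sub>R (- u - \<i> * u) \<in> C \<inter> B"
          using nn by (simp_all add: A_def B_def C_def cr_scale cr_add cr_diff inner_add_right inner_diff_right)
      qed
      then show "A \<inter> C \<noteq> {}" "(A \<union> C) \<inter> B \<noteq> {}" by blast+
    qed
    then have c: "Topological_Spaces.connected ((+) p ` (A \<union> C \<union> B))" by (rule connected_shift)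
    have "z \<notin> C" if "p + z \<in> J" "norm z < r" for z
    proof
      assume "z \<in> C"
      then have "u \<bullet> z < 0" by (simp add: C_def)
      then have "z \<noteq> 0" by auto
      then have sd: "sgn z \<in> dirs p" using J[OF that(2)] that(1) by simp
      then have "sgn z = u \<or> sgn z = - u" using u(3) by auto
      moreover have "sgn z \<noteq> - u" using sd no by metis
      ultimately have "sgn z = u" by simp
      then have "z = norm z *\<^sub>R u" using sgn_eq_unit[OF u(1)] by blast
      then obtain s where s: "z = s *\<^sub>R u" "0 \<le> s" by (metis norm_ge_zero)
      then have "0 \<le> u \<bullet> z" by simp
      then show False using \<open>u \<bullet> z < 0\<close> by linarith
    qed
    then have dis: "(+) p ` (A \<union> C \<union> B) \<inter> J = {}" using AB by (auto simp: C_def)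
    have cov: "ball p r \<subseteq> (+) p ` (A \<union> C \<union> B) \<union> (+) p ` (A \<union> C \<union> B) \<union> J"
    proof
      fix q assume "q \<in> ball p r"
      then have z: "norm (q - p) < r" by (simp add: dist_norm norm_minus_commute)
      have "q - p \<in> A \<union> C \<union> B \<or> q \<in> J"
        using J[OF z] z par[of "q - p"] u(2) unfolding A_def B_def C_def
        by (cases "cr u (q - p)" "0 :: real" rule: linorder_cases) auto
      moreover have "q = p + (q - p)" by simp
      ultimately show "q \<in> (+) p ` (A \<union> C \<union> B) \<union> (+) p ` (A \<union> C \<union> B) \<union> J" by blast
    qed
    have "(r / 2) *\<^sub>R (- u) \<in> C" using u(1) r(1) by (simp add: C_def dot_square_norm)
    then show False using two_sides[OF p r(1) c c dis dis cov] by blast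
  qed
  then have dirs: "dirs p = {u, - u}" using u by blast
  have inJ: "p + z \<in> J \<longleftrightarrow> cr u z = 0" if "norm z < r" for z
    using J[OF that] par[of z] par'[of z] unfolding dirs by (metis insertCI cr_simps(3))
  have cov: "ball p r \<subseteq> (+) p ` A \<union> (+) p ` B \<union> J"
  proof
    fix q assume "q \<in> ball p r"
    then have z: "norm (q - p) < r" by (simp add: dist_norm norm_minus_commute)
    have "q - p \<in> A \<or> q - p \<in> B \<or> q \<in> J" using inJ[OF z] z by (auto simp: A_def B_def)
    moreover have "q = p + (q - p)" by simp
    ultimately show "q \<in> (+) p ` A \<union> (+) p ` B \<union> J" by blast
  qed
  have "(+) p ` A \<subseteq> Q \<and> (+) p ` B \<inter> Q = {} \<or> (+) p ` B \<subseteq> Q \<and> (+) p ` A \<inter> Q = {}"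
    by (rule two_sides[OF p r(1) _ _ AB cov]) (intro connected_shift con)+
  then show ?thesis
  proof (elim disjE conjE)
    assume *: "(+) p ` A \<subseteq> Q" "(+) p ` B \<inter> Q = {}"
    have "p + z \<in> Q \<longleftrightarrow> 0 \<le> cr u z" if z: "norm z < r" for z
    proof
      assume "p + z \<in> Q"
      then have "z \<notin> B" using * mem by blast
      then show "0 \<le> cr u z" using z by (auto simp: B_def)
    next
      assume "0 \<le> cr u z"
      then have "z \<in> A \<or> p + z \<in> J" using inJ[OF z] z by (auto simp: A_def)
      then show "p + z \<in> Q" using * J_sub mem by blast
    qed
    then show ?thesis using inJ u(1) by blast
  next
    assume *: "(+) p ` B \<subseteq> Q" "(+) p ` A \<inter> Q = {}"
    have "p + z \<in> Q \<longleftrightarrow> 0 \<le> cr (- u) z" if z: "norm z < r" for z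
    proof
      assume "p + z \<in> Q"
      then have "z \<notin> A" using * mem by blast
      then show "0 \<le> cr (- u) z" using z by (auto simp: A_def)
    next
      assume "0 \<le> cr (- u) z"
      then have "z \<in> B \<or> p + z \<in> J" using inJ[OF z] z by (auto simp: B_def)
      then show "p + z \<in> Q" using * J_sub mem by blast
    qed
    moreover have "p + z \<in> J \<longleftrightarrow> cr (- u) z = 0" if "norm z < r" for z using inJ[OF that] by simp
    moreover have "norm (- u) = 1" using u(1) by simp
    ultimately show ?thesis by blast
  qed
qed

text \<open>Every boundary point has two boundary rays. Unless they are opposite, the point is a vertex and the
  polygon is a convex or a reflex wedge there.\<close>

lemma local_shape:
  assumes p: "p \<in> J"
  obtains
    (wedge) r u w where "0 < r" "norm u = 1" "norm w = 1" "0 < cr u w" "p \<in> X"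
      "\<And>z. norm z < r \<Longrightarrow> p + z \<in> Q \<longleftrightarrow> 0 \<le> cr u z \<and> 0 \<le> cr z w"
  | (reflex) r u w where "0 < r" "norm u = 1" "norm w = 1" "0 < cr u w" "p \<in> X"
      "\<And>z. norm z < r \<Longrightarrow> p + z \<in> Q \<longleftrightarrow> \<not> (0 < cr u z \<and> 0 < cr z w)"
  | (half) r u where "0 < r" "norm u = 1"
      "\<And>z. norm z < r \<Longrightarrow> p + z \<in> Q \<longleftrightarrow> 0 \<le> cr u z" "\<And>z. norm z < r \<Longrightarrow> p + z \<in> J \<longleftrightarrow> cr u z = 0"
proof -
  obtain r where r: "0 < r" "\<And>q. dist p q < r \<Longrightarrow> q \<in> J \<longleftrightarrow> q = p \<or> sgn (q - p) \<in> dirs p"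
    using local_rays[OF p] by blast
  obtain u where u: "u \<in> dirs p" using dirs_ne[OF p] by blast
  show ?thesis
  proof (cases "dirs p \<subseteq> {u, - u}")
    case True
    show ?thesis using shape_line[OF p dirs_unit[OF u] u True r] half r(1) by blast
  next
    case False
    then obtain w where w: "w \<in> dirs p" "w \<noteq> u" "w \<noteq> - u" by blast
    have d: "dirs p = {u, w}" using dirs_le2[OF p] u w by blast
    have pX: "p \<in> X"
    proof (rule ccontr)
      assume "p \<notin> X"
      then have "- u \<in> dirs p" using dirs_opposite u by blast
      then have "- u = u" using d w(3) by auto
      then show False using dirs_unit[OF u] by auto
    qed
    have "cr u w \<noteq> 0"
    proof
      assume "cr u w = 0"
      then have e: "w = (u \<bullet> w) *\<^sub>R u" using cr_zero_imp_parallel dirs_unit[OF u] by blast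
      then have "norm w = \<bar>u \<bullet> w\<bar> * norm u" by (metis norm_scaleR)
      then have "u \<bullet> w = 1 \<or> u \<bullet> w = - 1" using dirs_unit[OF u] dirs_unit[OF w(1)] by auto
      then show False
      proof
        assume "u \<bullet> w = 1" then show False using e w(2) by simp
      next
        assume "u \<bullet> w = - 1" then show False using e w(3) by simp
      qed
    qed
    then obtain a b where ab: "0 < cr a b" "dirs p = {a, b}"
    proof (cases "0 < cr u w")
      case False
      then have "0 < cr w u" using cr_swap[of u w] \<open>cr u w \<noteq> 0\<close> by linarith
      then show ?thesis using that[of w u] d by blast
    qed (use that d in blast)
    have n: "norm a = 1" "norm b = 1" using ab(2) dirs_unit by auto
    show ?thesis using shape_angle[OF p n ab(1,2) r] wedge[OF r(1) n ab(1) pX] reflex[OF r(1) n ab(1) pX] by blast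
  qed
qed

end

section \<open>Segments inside a polygon with one reflex vertex\<close>

lemma segI: "0 \<le> t \<Longrightarrow> t \<le> 1 \<Longrightarrow> (1 - t) *\<^sub>R a + t *\<^sub>R b \<in> closed_segment a b" for a b :: complex
  unfolding in_segment by blast

lemma osegI: "0 < t \<Longrightarrow> t < 1 \<Longrightarrow> a \<noteq> b \<Longrightarrow> (1 - t) *\<^sub>R a + t *\<^sub>R b \<in> open_segment a b" for a b :: complex
  unfolding in_segment by blast

context polygon begin

text \<open>A reflex wedge or a half-plane at a vertex would contain a half-plane of directions.\<close>

lemma shape_regular:
  assumes p: "p \<in> J" "p \<noteq> o\<^sub>x"
  obtains (wedge) r u w where "0 < r" "norm u = 1" "norm w = 1" "0 < cr u w"
      "\<And>z. norm z < r \<Longrightarrow> p + z \<in> Q \<longleftrightarrow> 0 \<le> cr u z \<and> 0 \<le> cr z w"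
  | (half) r u where "p \<notin> X" "0 < r" "norm u = 1"
      "\<And>z. norm z < r \<Longrightarrow> p + z \<in> Q \<longleftrightarrow> 0 \<le> cr u z" "\<And>z. norm z < r \<Longrightarrow> p + z \<in> J \<longleftrightarrow> cr u z = 0"
proof (cases rule: local_shape[OF p(1), case_names wedge reflex half])
  case (wedge r u w) then show ?thesis using that(1) by blast
next
  have no: False if X: "p \<in> X" and r: "0 < r" and u: "u \<noteq> 0" and h: "\<And>z. norm z < r \<Longrightarrow> 0 \<le> cr u z \<Longrightarrow> p + z \<in> Q" for r u
  proof -
    have "Complex (- Im u) (Re u) \<noteq> 0" using u by (auto simp: complex_eq_iff)
    then obtain z where z: "0 \<le> cr u z" "z \<noteq> 0" "\<not> (\<exists>\<delta>>0. \<forall>t. 0 < t \<and> t < \<delta> \<longrightarrow> p + t *\<^sub>R z \<in> Q)"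
      using convex_vertex[OF X p(2)] unfolding cr_inner(1) by blast
    have "p + t *\<^sub>R z \<in> Q" if "0 < t" "t < r / norm z" for t
      by (rule h) (use that z in \<open>auto simp: cr_scale field_simps\<close>)
    moreover have "0 < r / norm z" using r z by simp
    ultimately show False using z(3) by blast
  qed
  {
    case (reflex r u w)
    have "u \<noteq> 0" using reflex by auto
    then show ?thesis using no[of r "- u"] reflex by auto
  next
    case (half r u)
    have "u \<noteq> 0" using half by auto
    then show ?thesis using no[of r u] half that(2)[of r u] by blast
  }
qed

lemma shape_apex:
  obtains r u w where "0 < r" "norm u = 1" "norm w = 1" "0 < cr u w"
      "\<And>z. norm z < r \<Longrightarrow> o\<^sub>x + z \<in> Q \<longleftrightarrow> \<not> (0 < cr u z \<and> 0 < cr z w)"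
proof -
  have oJ: "o\<^sub>x \<in> J" using apex X_J by blast
  have no: False if r: "0 < r" and u: "u \<noteq> 0" and h: "\<And>z. norm z < r \<Longrightarrow> o\<^sub>x + z \<in> Q \<Longrightarrow> 0 \<le> cr u z" for r u
  proof -
    have "Complex (- Im u) (Re u) \<noteq> 0" using u by (auto simp: complex_eq_iff)
    then obtain z \<delta> where z: "cr u z < 0" "0 < \<delta>" "\<And>t. 0 < t \<Longrightarrow> t < \<delta> \<Longrightarrow> o\<^sub>x + t *\<^sub>R z \<in> Q"
      using reflex_apex unfolding cr_inner(1) by blast
    have zn: "0 < norm z" using z(1) by auto
    define t where "t = min (\<delta> / 2) (r / (2 * norm z))"
    have "0 < t" "t < \<delta>" "norm (t *\<^sub>R z) < r" using z(2) r zn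
      by (auto simp: t_def min_def field_simps split: if_split_asm)
    then have "0 \<le> t * cr u z" using h[of "t *\<^sub>R z"] z(3) by (simp add: cr_scale)
    then show False using z(1) \<open>0 < t\<close> by (simp add: zero_le_mult_iff)
  qed
  show ?thesis
  proof (cases rule: local_shape[OF oJ, case_names wedge reflex half])
    case (wedge r u w)
    then have "u \<noteq> 0" by auto
    then show ?thesis using no[of r u] wedge by blast
  next
    case (reflex r u w) then show ?thesis using that by blast
  next
    case (half r u)
    then have "u \<noteq> 0" by auto
    then show ?thesis using no[of r u] half by blast
  qed
qed

text \<open>A segment inside the polygon passes through a boundary point in both directions \<open>d\<close> and \<open>- d\<close>. A convex
  wedge contains no line, so the polygon is a half-plane there and the segment runs along its edge.\<close>

lemma frontier_along_segment:
  assumes ab: "closed_segment a b \<subseteq> Q" and q: "q \<in> open_segment a b" "q \<in> J" "q \<noteq> o\<^sub>x"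
  shows "q \<notin> X \<and> (\<exists>e>0. \<forall>q'\<in>open_segment a b. dist q' q < e \<longrightarrow> q' \<in> J)"
proof -
  obtain t where t: "q = (1 - t) *\<^sub>R a + t *\<^sub>R b" "0 < t" "t < 1" "a \<noteq> b" using q(1) by (auto simp: in_segment)
  define d where "d = b - a"
  have d0: "d \<noteq> 0" using t(4) by (simp add: d_def)
  have on: "q + s *\<^sub>R d \<in> Q" if "\<bar>s\<bar> \<le> min t (1 - t)" for s
  proof -
    have "q + s *\<^sub>R d = (1 - (t + s)) *\<^sub>R a + (t + s) *\<^sub>R b" by (simp add: t(1) d_def algebra_simps)
    moreover have "0 \<le> t + s" "t + s \<le> 1" using that by auto
    ultimately have "q + s *\<^sub>R d \<in> closed_segment a b" unfolding in_segment by blast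
    then show ?thesis using ab by blast
  qed
  define S where "S r = min (min t (1 - t)) (r / (2 * norm d))" for r
  have S: "0 < S r" "norm (S r *\<^sub>R d) < r" "norm ((- S r) *\<^sub>R d) < r" "q + S r *\<^sub>R d \<in> Q" "q + (- S r) *\<^sub>R d \<in> Q" if "0 < r" for r
  proof -
    show pos: "0 < S r" using t that d0 by (simp add: S_def)
    have "S r \<le> r / (2 * norm d)" by (simp add: S_def)
    then have "S r * norm d \<le> r / 2" using d0 by (simp add: field_simps)
    then show "norm (S r *\<^sub>R d) < r" "norm ((- S r) *\<^sub>R d) < r" using pos that by simp_all
    have "S r \<le> min t (1 - t)" unfolding S_def by (rule min.cobounded1)
    then have "\<bar>S r\<bar> \<le> min t (1 - t)" using pos by linarith
    then show "q + S r *\<^sub>R d \<in> Q" "q + (- S r) *\<^sub>R d \<in> Q" using on[of "S r"] on[of "- S r"] by simp_all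
  qed
  have flat: "cr u d = 0" if r: "0 < r" and h: "\<And>z. norm z < r \<Longrightarrow> q + z \<in> Q \<Longrightarrow> 0 \<le> cr u z" for r u
  proof -
    have "0 \<le> S r * cr u d" "0 \<le> - (S r * cr u d)" using h[OF S(2)[OF r] S(4)[OF r]] h[OF S(3)[OF r] S(5)[OF r]] by (simp_all only: cr_scale)
    then show ?thesis using S(1)[OF r] by simp
  qed
  show ?thesis
  proof (cases rule: shape_regular[OF q(2,3), case_names wedge half])
    case (wedge r u w)
    have "cr u d = 0" using flat[OF wedge(1), of u] wedge(5) by blast
    moreover have "cr (- w) d = 0" by (rule flat[OF wedge(1)]) (use wedge(5) cr_swap[of w] in auto)
    ultimately obtain s where s: "d = s *\<^sub>R u" "cr w d = 0" using cr_zero_imp_parallel[OF _ wedge(2)] by fastforce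
    then have "s * cr u w = 0" using cr_swap[of w u] by (simp add: cr_scale)
    then show ?thesis using wedge(4) s(1) d0 by simp
  next
    case (half r u)
    have c: "cr u d = 0" using flat[OF half(2), of u] half(4) by blast
    have "q' \<in> J" if q': "q' \<in> open_segment a b" "dist q' q < r" for q'
    proof -
      obtain t' where t': "q' = (1 - t') *\<^sub>R a + t' *\<^sub>R b" using q'(1) by (auto simp: in_segment)
      have e: "q' - q = (t' - t) *\<^sub>R d" by (simp add: t' t(1) d_def algebra_simps)
      have "q + (q' - q) \<in> J" by (subst half(5)) (use q' c in \<open>simp_all add: e[symmetric] dist_norm\<close>, simp add: e cr_scale c)
      then show ?thesis by simp
    qed
    then show ?thesis using half(1,2) by blast
  qed
qed

text \<open>The part on the boundary is relatively open in the segment, and so is the part in the interior.\<close>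

lemma segment_dichotomy:
  assumes ab: "closed_segment a b \<subseteq> Q" "o\<^sub>x \<notin> open_segment a b"
  shows "open_segment a b \<subseteq> I \<or> open_segment a b \<subseteq> J" "open_segment a b \<inter> X = {}"
proof -
  let ?S = "open_segment a b"
  have SQ: "?S \<subseteq> Q" using ab(1) segment_open_subset_closed by blast
  have fr: "q \<notin> X \<and> (\<exists>e>0. \<forall>q'\<in>?S. dist q' q < e \<longrightarrow> q' \<in> J)" if "q \<in> ?S" "q \<in> J" for q
    by (rule frontier_along_segment[OF ab(1) that]) (use that ab(2) in auto)
  then show "?S \<inter> X = {}" using X_J by blast
  have 1: "openin (top_of_set ?S) (?S \<inter> J)" unfolding openin_euclidean_subtopology_iff using fr by blast
  have 2: "openin (top_of_set ?S) (?S \<inter> I)" by (rule openin_open_Int) simp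
  have "?S \<inter> J = {} \<or> ?S \<inter> I = {}"
    using convex_connected[OF convex_open_segment[of a b]] 1 2 SQ Q_split I_not_J unfolding connected_openin by blast
  then show "?S \<subseteq> I \<or> ?S \<subseteq> J" using SQ Q_split by blast
qed

lemma segment_interior:
  assumes "closed_segment a b \<subseteq> Q" "o\<^sub>x \<notin> open_segment a b" "b \<in> I"
  shows "open_segment a b \<subseteq> I"
proof (cases "a = b")
  case False
  have "\<not> open_segment a b \<subseteq> J"
  proof
    assume "open_segment a b \<subseteq> J"
    then have "closure (open_segment a b) \<subseteq> J" by (rule closure_minimal) (rule frontier_closed)
    moreover have "b \<in> closure (open_segment a b)" using False by simp
    ultimately show False using assms(3) I_not_J by blast
  qed
  then show ?thesis using segment_dichotomy[OF assms(1,2)] by blast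
qed simp

lemma Q_closure: "Q \<subseteq> closure I"
  using I_inside(3) Q_split closure_subset by blast

lemma closed_visible: "closed {y. closed_segment a y \<subseteq> Q}"
proof -
  have "{y. closed_segment a y \<subseteq> Q} = (\<Inter>t\<in>{0..1}. (\<lambda>y. (1 - t) *\<^sub>R a + t *\<^sub>R y) -` Q)"
  proof (rule set_eqI)
    fix y
    have "closed_segment a y \<subseteq> Q \<longleftrightarrow> (\<forall>t\<in>{0..1}. (1 - t) *\<^sub>R a + t *\<^sub>R y \<in> Q)"
      using segI[of _ a y] by (auto simp: in_segment)
    then show "y \<in> {y. closed_segment a y \<subseteq> Q} \<longleftrightarrow> y \<in> (\<Inter>t\<in>{0..1}. (\<lambda>y. (1 - t) *\<^sub>R a + t *\<^sub>R y) -` Q)" by simp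
  qed
  also have "closed \<dots>" by (intro closed_INT ballI continuous_closed_vimage closed_Q continuous_intros)
  finally show ?thesis .
qed

text \<open>The interior points visible from the apex form a nonempty subset of the interior that is closed and open in
  it. For openness, near the apex the polygon is a cone, and the rest of the segment to
  such a point is a compact subset of the interior.\<close>

theorem star_shaped: assumes "y \<in> Q" shows "closed_segment o\<^sub>x y \<subseteq> Q"
proof -
  have oJ: "o\<^sub>x \<in> J" using apex X_J by blast
  obtain r u w where sh: "0 < r" "norm u = 1" "norm w = 1" "0 < cr u w"
      "\<And>z. norm z < r \<Longrightarrow> o\<^sub>x + z \<in> Q \<longleftrightarrow> \<not> (0 < cr u z \<and> 0 < cr z w)"
    using shape_apex by metis
  have cone: "o\<^sub>x + s *\<^sub>R z \<in> Q" if "norm z < r" "o\<^sub>x + z \<in> Q" "0 \<le> s" "s \<le> 1" for z s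
  proof -
    have "s * norm z \<le> norm z" using that by (simp add: mult_left_le_one_le)
    then have "norm (s *\<^sub>R z) < r" using that by simp
    then show ?thesis using sh(5)[OF that(1)] sh(5)[of "s *\<^sub>R z"] that(2,3) by (auto simp: cr_scale zero_less_mult_iff)
  qed
  have near: "closed_segment o\<^sub>x q \<subseteq> Q" if "q \<in> Q" "dist o\<^sub>x q < r" for q
  proof
    fix y assume "y \<in> closed_segment o\<^sub>x q"
    then obtain s where "y = (1 - s) *\<^sub>R o\<^sub>x + s *\<^sub>R q" "0 \<le> s" "s \<le> 1" by (auto simp: in_segment)
    moreover from this have "y = o\<^sub>x + s *\<^sub>R (q - o\<^sub>x)" by (simp add: algebra_simps)
    ultimately show "y \<in> Q" using cone[of "q - o\<^sub>x" s] that by (simp add: dist_norm norm_minus_commute)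
  qed
  define S where "S = {y. closed_segment o\<^sub>x y \<subseteq> Q}"
  have "I \<inter> S \<noteq> {}"
  proof -
    obtain q where "q \<in> I" "dist q o\<^sub>x < r" using I_inside(3) oJ sh(1) by (force simp: closure_approachable)
    then show ?thesis using near[of q] interior_subset by (auto simp: S_def dist_commute)
  qed
  moreover have "closedin (top_of_set I) (I \<inter> S)" unfolding S_def by (rule closedin_closed_Int[OF closed_visible])
  moreover have "openin (top_of_set I) (I \<inter> S)"
    unfolding openin_euclidean_subtopology_iff
  proof (intro conjI ballI)
    fix y assume y: "y \<in> I \<inter> S"
    then have yI: "y \<in> I" and yS: "closed_segment o\<^sub>x y \<subseteq> Q" by (auto simp: S_def)
    have ne: "y \<noteq> o\<^sub>x" using yI oJ I_not_J by auto
    have op: "open_segment o\<^sub>x y \<subseteq> I" by (rule segment_interior[OF yS _ yI]) (simp add: open_segment_def)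
    define \<delta> where "\<delta> = min 1 (r / (2 * norm (y - o\<^sub>x)))"
    have \<delta>: "0 < \<delta>" "\<delta> \<le> 1" using ne sh(1) by (auto simp: \<delta>_def)
    have "\<delta> \<le> r / (2 * norm (y - o\<^sub>x))" by (simp add: \<delta>_def)
    then have \<delta>n: "\<delta> * norm (y - o\<^sub>x) \<le> r / 2" using ne by (simp add: field_simps)
    define K where "K = (\<lambda>t. o\<^sub>x + t *\<^sub>R (y - o\<^sub>x)) ` {\<delta>..1}"
    have "compact K" unfolding K_def by (intro compact_continuous_image continuous_intros) simp
    moreover have "K \<subseteq> I"
    proof
      fix q assume "q \<in> K"
      then obtain t where "t \<in> {\<delta>..1}" and tq: "q = o\<^sub>x + t *\<^sub>R (y - o\<^sub>x)" unfolding K_def by blast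
      then have t: "q = o\<^sub>x + t *\<^sub>R (y - o\<^sub>x)" "\<delta> \<le> t" "t \<le> 1" by simp_all
      have q: "q = (1 - t) *\<^sub>R o\<^sub>x + t *\<^sub>R y" by (simp add: t(1) algebra_simps)
      show "q \<in> I"
      proof (cases "t = 1")
        case False
        then have "q \<in> open_segment o\<^sub>x y" unfolding q using osegI[of t o\<^sub>x y] t \<delta> ne by auto
        then show ?thesis using op by blast
      qed (use q yI in simp)
    qed
    ultimately obtain \<epsilon> where \<epsilon>: "0 < \<epsilon>" "(\<Union>q\<in>K. ball q \<epsilon>) \<subseteq> I"
      using compact_subset_open_imp_ball_epsilon_subset[of K I] by auto
    show "\<exists>e>0. \<forall>y'\<in>I. dist y' y < e \<longrightarrow> y' \<in> I \<inter> S"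
    proof (intro exI[of _ "min \<epsilon> (r / 2)"] conjI ballI impI)
      fix y' assume y': "y' \<in> I" "dist y' y < min \<epsilon> (r / 2)"
      have far: "o\<^sub>x + t *\<^sub>R (y' - o\<^sub>x) \<in> I" if t: "\<delta> \<le> t" "t \<le> 1" for t
      proof -
        have "dist (o\<^sub>x + t *\<^sub>R (y - o\<^sub>x)) (o\<^sub>x + t *\<^sub>R (y' - o\<^sub>x)) = norm (t *\<^sub>R (y - y'))"
          unfolding dist_norm by (rule arg_cong[of _ _ norm]) (simp add: algebra_simps)
        also have "\<dots> = t * norm (y - y')" using t \<delta> by simp
        also have "\<dots> \<le> norm (y - y')" using t \<delta> by (simp add: mult_left_le_one_le)
        also have "\<dots> < \<epsilon>" using y' by (simp add: dist_norm norm_minus_commute)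
        finally have "o\<^sub>x + t *\<^sub>R (y' - o\<^sub>x) \<in> ball (o\<^sub>x + t *\<^sub>R (y - o\<^sub>x)) \<epsilon>" by simp
        moreover have "o\<^sub>x + t *\<^sub>R (y - o\<^sub>x) \<in> K" using t by (auto simp: K_def)
        ultimately show ?thesis using \<epsilon>(2) by blast
      qed
      have "\<delta> * norm (y' - o\<^sub>x) \<le> \<delta> * norm (y - o\<^sub>x) + \<delta> * norm (y' - y)"
        using norm_triangle_ineq[of "y - o\<^sub>x" "y' - y"] \<delta>(1) by (simp flip: distrib_left)
      moreover have "\<delta> * norm (y' - y) < r / 2"
      proof -
        have "\<delta> * norm (y' - y) \<le> norm (y' - y)" using \<delta> by (simp add: mult_left_le_one_le)
        then show ?thesis using y'(2) by (simp add: dist_norm)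
      qed
      ultimately have n: "norm (\<delta> *\<^sub>R (y' - o\<^sub>x)) < r" using \<delta> \<delta>n by simp
      have \<delta>Q: "o\<^sub>x + \<delta> *\<^sub>R (y' - o\<^sub>x) \<in> Q" using far[of \<delta>] \<delta> interior_subset by auto
      have "closed_segment o\<^sub>x y' \<subseteq> Q"
      proof
        fix q assume "q \<in> closed_segment o\<^sub>x y'"
        then obtain t where t: "q = (1 - t) *\<^sub>R o\<^sub>x + t *\<^sub>R y'" "0 \<le> t" "t \<le> 1" by (auto simp: in_segment)
        then have q: "q = o\<^sub>x + t *\<^sub>R (y' - o\<^sub>x)" by (simp add: algebra_simps)
        show "q \<in> Q"
        proof (cases "\<delta> \<le> t")
          case True then show ?thesis using far[of t] t(3) q interior_subset by auto
        next
          case False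
          then have "o\<^sub>x + (t / \<delta>) *\<^sub>R (\<delta> *\<^sub>R (y' - o\<^sub>x)) \<in> Q" using cone[OF n \<delta>Q, of "t / \<delta>"] t \<delta> by simp
          then show ?thesis using q \<delta> by simp
        qed
      qed
      then show "y' \<in> I \<inter> S" using y' by (simp add: S_def)
    qed (use \<epsilon> sh in auto)
  qed simp
  ultimately have "I \<inter> S = I" using I_inside(2) unfolding connected_clopen by blast
  then have "closure I \<subseteq> S" unfolding S_def using closure_minimal[OF _ closed_visible] by blast
  then show ?thesis using Q_closure assms by (auto simp: S_def)
qed

text \<open>The bisector of the reflex wedge's complement leaves the polygon at the apex and, by star-shapedness, never
  returns. Rotating it to the positive real axis makes the argument continuous on the polygon.\<close>

lemma excluded_direction: "\<exists>e. norm e = 1 \<and> (\<forall>t>0. o\<^sub>x + t *\<^sub>R e \<notin> Q)"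
proof -
  obtain r u w where sh: "0 < r" "norm u = 1" "norm w = 1" "0 < cr u w"
      "\<And>z. norm z < r \<Longrightarrow> o\<^sub>x + z \<in> Q \<longleftrightarrow> \<not> (0 < cr u z \<and> 0 < cr z w)"
    using shape_apex by metis
  define e where "e = sgn (u + w)"
  have "u + w \<noteq> 0"
  proof
    assume "u + w = 0"
    then have "w = - u" by (simp add: eq_neg_iff_add_eq_0 add.commute)
    then show False using sh(4) by simp
  qed
  then have n: "norm e = 1" and k: "e = (1 / norm (u + w)) *\<^sub>R (u + w)" "0 < 1 / norm (u + w)"
    by (simp_all add: e_def norm_sgn sgn_div_norm divide_inverse)
  have c: "0 < cr u e" "0 < cr e w" unfolding k(1) cr_scale cr_add using k(2) sh(4) by simp_all
  have "o\<^sub>x + t *\<^sub>R e \<notin> Q" if t: "0 < t" for t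
  proof
    assume "o\<^sub>x + t *\<^sub>R e \<in> Q"
    from star_shaped[OF this] have seg: "closed_segment o\<^sub>x (o\<^sub>x + t *\<^sub>R e) \<subseteq> Q" .
    define s where "s = min 1 (r / (2 * t))"
    have s: "0 < s" "s \<le> 1" "s * t < r" using t sh(1) by (auto simp: s_def min_def field_simps)
    have "o\<^sub>x + (s * t) *\<^sub>R e = (1 - s) *\<^sub>R o\<^sub>x + s *\<^sub>R (o\<^sub>x + t *\<^sub>R e)" by (simp add: algebra_simps)
    then have "o\<^sub>x + (s * t) *\<^sub>R e \<in> Q" using seg segI[of s o\<^sub>x "o\<^sub>x + t *\<^sub>R e"] s by auto
    moreover have "norm ((s * t) *\<^sub>R e) < r" using n s t by simp
    ultimately show False using sh(5)[of "(s * t) *\<^sub>R e"] c s t by (simp add: cr_scale)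
  qed
  then show ?thesis using n by blast
qed

end

section \<open>Visibility by angles\<close>

lemma polar: "z = norm z *\<^sub>R cis (Arg2pi z)"
  using Arg2pi_eq[of z] by (simp add: cis_conv_exp scaleR_conv_of_real mult.commute)

lemma cr_cis: "cr (r *\<^sub>R cis a) (s *\<^sub>R cis b) = r * s * sin (b - a)"
  by (simp add: cr_def sin_diff algebra_simps)

lemma cr_polar: "cr a b = norm a * norm b * sin (Arg2pi b - Arg2pi a)"
  using cr_cis[of "norm a" "Arg2pi a" "norm b" "Arg2pi b"] by (simp flip: polar)

lemma Arg2pi_cis_scale: "0 < r \<Longrightarrow> 0 \<le> t \<Longrightarrow> t < 2 * pi \<Longrightarrow> Arg2pi (r *\<^sub>R cis t) = t"
  by (rule Arg2pi_unique[of r]) (simp_all add: cis_conv_exp scaleR_conv_of_real mult.commute)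

lemma Im_polar: "Im z = norm z * sin (Arg2pi z)"
proof -
  have "Im z = Im (norm z *\<^sub>R cis (Arg2pi z))" by (rule arg_cong[OF polar])
  also have "\<dots> = norm z * sin (Arg2pi z)" by simp
  finally show ?thesis .
qed

lemma sin_nonpos: "- pi \<le> x \<Longrightarrow> x \<le> 0 \<Longrightarrow> sin x \<le> 0"
  using sin_ge_zero[of "- x"] by simp

lemma sin_neg: "- pi < x \<Longrightarrow> x < 0 \<Longrightarrow> sin x < 0"
  using sin_gt_zero[of "- x"] by simp

text \<open>Along a chord that subtends less than \<open>\<pi>\<close> at the origin the argument increases.\<close>

lemma segment_Arg:
  assumes a: "a \<noteq> 0" "b \<noteq> 0" "Arg2pi a \<le> Arg2pi b" "Arg2pi b < Arg2pi a + pi"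
    and m: "m = (1 - t) *\<^sub>R a + t *\<^sub>R b" "0 \<le> t" "t \<le> 1"
  shows "m \<noteq> 0" "Arg2pi a \<le> Arg2pi m" "Arg2pi m \<le> Arg2pi b"
    "\<lbrakk>Arg2pi a < Arg2pi b; 0 < t; t < 1\<rbrakk> \<Longrightarrow> Arg2pi a < Arg2pi m \<and> Arg2pi m < Arg2pi b"
proof -
  define \<delta> where "\<delta> = Arg2pi b - Arg2pi a"
  have \<delta>: "0 \<le> \<delta>" "\<delta> < pi" using a by (auto simp: \<delta>_def)
  define A where "A = norm a" define B where "B = norm b"
  have AB: "0 < A" "0 < B" using a by (auto simp: A_def B_def)
  define n where "n = ((1 - t) * A) *\<^sub>R cis 0 + (t * B) *\<^sub>R cis \<delta>"
  have mn: "m = cis (Arg2pi a) * n"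
  proof -
    define ca where "ca = cis (Arg2pi a)"
    have ab: "a = A *\<^sub>R ca" "b = B *\<^sub>R (ca * cis \<delta>)"
    proof -
      have e: "ca * cis \<delta> = cis (Arg2pi b)" by (simp add: ca_def cis_mult \<delta>_def)
      show "b = B *\<^sub>R (ca * cis \<delta>)" unfolding e B_def by (rule polar)
      show "a = A *\<^sub>R ca" unfolding A_def ca_def by (rule polar)
    qed
    have "(1 - t) *\<^sub>R a = (1 - t) *\<^sub>R (A *\<^sub>R ca)" by (rule arg_cong[OF ab(1)])
    moreover have "t *\<^sub>R b = t *\<^sub>R (B *\<^sub>R (ca * cis \<delta>))" by (rule arg_cong[OF ab(2)])
    ultimately have "m = (1 - t) *\<^sub>R (A *\<^sub>R ca) + t *\<^sub>R (B *\<^sub>R (ca * cis \<delta>))" unfolding m(1) by simp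
    then show ?thesis unfolding ca_def[symmetric] n_def by (simp add: algebra_simps)
  qed
  have s: "0 \<le> sin \<delta>" using \<delta> by (simp add: sin_ge_zero)
  have ImN: "Im n = t * B * sin \<delta>" and ReN: "Re n = (1 - t) * A + t * B * cos \<delta>" by (simp_all add: n_def)
  have Im0: "0 \<le> Im n" using ImN m AB s by simp
  have crn: "cr n (1 *\<^sub>R cis \<delta>) = (1 - t) * A * sin \<delta>" unfolding n_def cr_add cr_cis by simp
  have crn0: "0 \<le> cr n (1 *\<^sub>R cis \<delta>)" unfolding crn using m AB s by simp
  have pos: "0 < sin \<delta>" if "\<delta> \<noteq> 0" using that \<delta> by (simp add: sin_gt_zero)
  have d0: "n = complex_of_real ((1 - t) * A + t * B)" "0 < (1 - t) * A + t * B" if "\<delta> = 0"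
  proof -
    show "n = complex_of_real ((1 - t) * A + t * B)" using that by (simp add: n_def complex_eq_iff)
    show "0 < (1 - t) * A + t * B" using m AB by (cases "t = 0") (auto intro: add_nonneg_pos)
  qed
  have n0: "n \<noteq> 0"
  proof
    assume n: "n = 0"
    have "\<delta> \<noteq> 0"
    proof
      assume "\<delta> = 0"
      from d0(1)[OF this] n have "(1 - t) * A + t * B = 0" by (metis of_real_eq_0_iff)
      then show False using d0(2)[OF \<open>\<delta> = 0\<close>] by simp
    qed
    then have "0 < sin \<delta>" by (rule pos)
    then have "t = 0" using ImN n AB by simp
    then show False using ReN n AB by simp
  qed
  define \<mu> where "\<mu> = Arg2pi n"
  have np: "n = norm n *\<^sub>R cis \<mu>" unfolding \<mu>_def by (rule polar)
  have \<mu>: "0 \<le> \<mu>" "\<mu> \<le> pi" using Im0 Arg2pi_le_pi[of n] Arg2pi_ge_0[of n] by (simp_all add: \<mu>_def)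
  have cs: "cr n (1 *\<^sub>R cis \<delta>) = norm n * sin (\<delta> - \<mu>)" 
  proof -
    have "cr n (1 *\<^sub>R cis \<delta>) = cr (norm n *\<^sub>R cis \<mu>) (1 *\<^sub>R cis \<delta>)" by (rule arg_cong[OF np])
    then show ?thesis unfolding cr_cis by simp
  qed
  have \<mu>\<delta>: "\<mu> \<le> \<delta>"
  proof (rule ccontr)
    assume h: "\<not> \<mu> \<le> \<delta>"
    show False
    proof (cases "\<delta> = 0")
      case True
      have "\<mu> = 0" unfolding \<mu>_def d0(1)[OF True] using d0(2)[OF True] by (simp add: Arg2pi_eq_0 complex_is_Real_iff)
      then show False using h True by simp
    next
      case False
      then have "sin (\<delta> - \<mu>) < 0" using h \<delta> \<mu> by (intro sin_neg) auto
      then have "norm n * sin (\<delta> - \<mu>) < 0" using n0 by (simp add: mult_less_0_iff)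
      then show False using crn0 cs by linarith
    qed
  qed
  have "m = norm n *\<^sub>R cis (Arg2pi a + \<mu>)"
  proof -
    have "cis (Arg2pi a) * n = cis (Arg2pi a) * (norm n *\<^sub>R cis \<mu>)" by (rule arg_cong[OF np])
    also have "\<dots> = norm n *\<^sub>R cis (Arg2pi a + \<mu>)" by (simp add: cis_mult)
    finally show ?thesis unfolding mn .
  qed
  then have Am: "Arg2pi m = Arg2pi a + \<mu>"
    using Arg2pi_cis_scale[of "norm n" "Arg2pi a + \<mu>"] n0 \<mu> \<mu>\<delta> Arg2pi_ge_0[of a] Arg2pi_lt_2pi[of b] by (simp add: \<delta>_def)
  show "m \<noteq> 0" using mn n0 by simp
  show "Arg2pi a \<le> Arg2pi m" "Arg2pi m \<le> Arg2pi b" using Am \<mu> \<mu>\<delta> by (simp_all add: \<delta>_def)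
  assume st: "Arg2pi a < Arg2pi b" "0 < t" "t < 1"
  then have sp: "0 < sin \<delta>" using pos by (simp add: \<delta>_def)
  have "\<mu> \<noteq> 0"
  proof
    assume "\<mu> = 0"
    then have "Im n = 0" using Im_polar[of n] by (simp add: \<mu>_def)
    then show False using ImN sp st AB by simp
  qed
  moreover have "\<mu> \<noteq> \<delta>"
  proof
    assume "\<mu> = \<delta>"
    then have "(1 - t) * A * sin \<delta> = 0" using cs crn by simp
    then show False using sp st AB by simp
  qed
  ultimately show "Arg2pi a < Arg2pi m \<and> Arg2pi m < Arg2pi b" using Am \<mu> \<mu>\<delta> by (simp add: \<delta>_def)
qed

text \<open>The apex is at the origin and the positive real axis avoids the polygon, so that arguments order the
  vertices around the apex.\<close>

locale axis_polygon = polygon Q E X 0 for Q E X +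
  assumes axis: "0 < t \<Longrightarrow> complex_of_real t \<notin> Q"
begin

lemma zero_X: "0 \<in> X" using apex .

lemma off_axis: "z \<in> Q \<Longrightarrow> z \<noteq> 0 \<Longrightarrow> z \<notin> \<real>\<^sub>\<ge>\<^sub>0"
  using axis by (auto simp: nonneg_Reals_def)

lemma Arg_pos: "z \<in> Q \<Longrightarrow> z \<noteq> 0 \<Longrightarrow> 0 < Arg2pi z"
  using off_axis[of z] Arg2pi_eq_0[of z] Arg2pi_ge_0[of z] by (auto simp: complex_nonneg_Reals_iff complex_is_Real_iff order_less_le)

text \<open>Near the apex the polygon is the sector between the arguments \<open>\<omega>\<close> of \<open>w\<close> and \<open>\<upsilon>\<close> of \<open>u\<close>, which contains every
  intermediate direction.\<close>

lemma local_between: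
  "\<exists>r. 0 < r \<and> (\<forall>a b m. a \<in> Q \<and> b \<in> Q \<and> a \<noteq> 0 \<and> b \<noteq> 0 \<and> m \<noteq> 0 \<and> norm a < r \<and> norm b < r \<and> norm m < r \<and>
     Arg2pi a \<le> Arg2pi m \<and> Arg2pi m \<le> Arg2pi b \<longrightarrow> m \<in> Q)"
proof -
  obtain r u w where sh: "0 < r" "norm u = 1" "norm w = 1" "0 < cr u w"
      "\<And>z. norm z < r \<Longrightarrow> z \<in> Q \<longleftrightarrow> \<not> (0 < cr u z \<and> 0 < cr z w)"
    using shape_apex unfolding add_0 by metis
  define \<omega> where "\<omega> = Arg2pi w" define \<upsilon> where "\<upsilon> = Arg2pi u"
  have rng: "0 \<le> \<omega>" "\<omega> < 2 * pi" "0 \<le> \<upsilon>" "\<upsilon> < 2 * pi" by (simp_all add: \<omega>_def \<upsilon>_def Arg2pi_ge_0 Arg2pi_lt_2pi)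
  have "(r / 2) *\<^sub>R 1 \<notin> Q" using axis[of "r / 2"] sh(1) by (simp add: scaleR_conv_of_real)
  then have "0 < cr u ((r / 2) *\<^sub>R 1)" "0 < cr ((r / 2) *\<^sub>R 1) w" using sh(5)[of "(r / 2) *\<^sub>R 1"] sh(1) by auto
  then have "Im u < 0" "0 < Im w" using sh(1) by (simp_all add: cr_def mult_less_0_iff zero_less_mult_iff)
  then have im: "\<omega> < pi" "0 < \<omega>" "pi < \<upsilon>"
    using Arg2pi_lt_pi[of w] Arg2pi_le_pi[of u] by (auto simp: \<omega>_def \<upsilon>_def)
  have gap: "\<upsilon> - \<omega> > pi"
  proof (rule ccontr)
    assume "\<not> \<upsilon> - \<omega> > pi"
    then have "0 \<le> sin (\<upsilon> - \<omega>)" using im by (intro sin_ge_zero) auto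
    then have "cr u w \<le> 0" using cr_polar[of u w] sin_minus[of "\<upsilon> - \<omega>"] sh(2,3) by (simp add: \<omega>_def \<upsilon>_def)
    then show False using sh(4) by simp
  qed
  have iff: "z \<in> Q \<longleftrightarrow> \<omega> \<le> Arg2pi z \<and> Arg2pi z \<le> \<upsilon>" if z: "norm z < r" "z \<noteq> 0" for z
  proof -
    define \<theta> where "\<theta> = Arg2pi z"
    have t: "0 \<le> \<theta>" "\<theta> < 2 * pi" by (simp_all add: \<theta>_def Arg2pi_ge_0 Arg2pi_lt_2pi)
    have c1: "0 < cr u z \<longleftrightarrow> 0 < sin (\<theta> - \<upsilon>)" and c2: "0 < cr z w \<longleftrightarrow> 0 < sin (\<omega> - \<theta>)"
      using cr_polar[of u z] cr_polar[of z w] sh(2,3) z(2) by (simp_all add: \<theta>_def \<omega>_def \<upsilon>_def zero_less_mult_iff)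
    have p2: "sin (x + 2 * pi) = sin x" for x :: real by simp
    have "0 < sin (\<theta> - \<upsilon>) \<and> 0 < sin (\<omega> - \<theta>) \<longleftrightarrow> \<theta> < \<omega> \<or> \<upsilon> < \<theta>"
    proof
      assume "\<theta> < \<omega> \<or> \<upsilon> < \<theta>"
      then show "0 < sin (\<theta> - \<upsilon>) \<and> 0 < sin (\<omega> - \<theta>)"
      proof
        assume "\<theta> < \<omega>"
        then show ?thesis using sin_gt_zero[of "\<omega> - \<theta>"] sin_gt_zero[of "\<theta> - \<upsilon> + 2 * pi"] p2[of "\<theta> - \<upsilon>"] t im gap rng by auto
      next
        assume "\<upsilon> < \<theta>"
        then show ?thesis using sin_gt_zero[of "\<theta> - \<upsilon>"] sin_gt_zero[of "\<omega> - \<theta> + 2 * pi"] p2[of "\<omega> - \<theta>"] t im gap rng by auto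
      qed
    next
      assume h: "0 < sin (\<theta> - \<upsilon>) \<and> 0 < sin (\<omega> - \<theta>)"
      show "\<theta> < \<omega> \<or> \<upsilon> < \<theta>"
      proof (rule ccontr)
        assume n: "\<not> (\<theta> < \<omega> \<or> \<upsilon> < \<theta>)"
        show False
        proof (cases "\<theta> - \<omega> \<le> pi")
          case True
          then show False using sin_ge_zero[of "\<theta> - \<omega>"] n h sin_minus[of "\<theta> - \<omega>"] by simp
        next
          case False
          then show False using sin_ge_zero[of "\<upsilon> - \<theta>"] n h sin_minus[of "\<upsilon> - \<theta>"] rng im by simp
        qed
      qed
    qed
    then show ?thesis using sh(5)[OF z(1)] c1 c2 by (auto simp: \<theta>_def)
  qed
  have "m \<in> Q" if "a \<in> Q" "b \<in> Q" "a \<noteq> 0" "b \<noteq> 0" "m \<noteq> 0" "norm a < r" "norm b < r" "norm m < r"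
     "Arg2pi a \<le> Arg2pi m" "Arg2pi m \<le> Arg2pi b" for a b m
  proof -
    have "\<omega> \<le> Arg2pi a" "Arg2pi b \<le> \<upsilon>" using iff[OF that(6,3)] iff[OF that(7,4)] that(1,2) by blast+
    then show "m \<in> Q" using iff[OF that(8,5)] that(9,10) by linarith
  qed
  then show ?thesis using sh(1) by blast
qed

lemma star: "y \<in> Q \<Longrightarrow> 0 \<le> s \<Longrightarrow> s \<le> 1 \<Longrightarrow> s *\<^sub>R y \<in> Q"
  using star_shaped[of y] segI[of s 0 y] by auto

lemma star_interior: assumes "y \<in> I" "0 < s" "s \<le> 1" shows "s *\<^sub>R y \<in> I"
proof (cases "s = 1")
  case False
  have "0 \<in> J" using X_J zero_X by blast
  then have ne: "0 \<noteq> y" using I_not_J[OF assms(1)] by auto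
  have yQ: "y \<in> Q" using assms(1) interior_subset by blast
  have "open_segment 0 y \<subseteq> I" by (rule segment_interior[OF star_shaped[OF yQ] _ assms(1)]) (simp add: open_segment_def)
  then show ?thesis using osegI[of s 0 y] assms False ne by auto
qed (use assms in simp)

text \<open>Shrink the segment towards the apex by a factor \<open>s\<close>. For small \<open>s\<close> it lies in the local sector. The set of good
  factors is closed, and it is open in \<open>(0, 1]\<close> because a segment inside the polygon
  with interior end points lies in the interior.\<close>

lemma visible_interior:
  assumes a: "a \<in> I" "b \<in> I" and ang: "Arg2pi a \<le> Arg2pi b" "Arg2pi b < Arg2pi a + pi"
  shows "closed_segment a b \<subseteq> Q"
proof -
  have "0 \<in> J" using X_J zero_X by blast
  then have ne: "a \<noteq> 0" "b \<noteq> 0" using I_not_J a by auto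
  have aQ: "a \<in> Q" "b \<in> Q" using a interior_subset by blast+
  let ?m = "\<lambda>t. (1 - t) *\<^sub>R a + t *\<^sub>R b"
  define S where "S = {s \<in> {0<..1::real}. \<forall>t\<in>{0..1}. s *\<^sub>R ?m t \<in> Q}"
  define B where "B = norm a + norm b + 1"
  have B: "0 < B" "norm (?m t) < B" if "0 \<le> t" "t \<le> 1" for t
  proof -
    show "0 < B" by (simp add: B_def add_nonneg_pos)
    have "norm (?m t) \<le> (1 - t) * norm a + t * norm b" using norm_triangle_ineq[of "(1 - t) *\<^sub>R a" "t *\<^sub>R b"] that by simp
    also have "\<dots> \<le> norm a + norm b" using that by (intro add_mono) (auto intro: mult_left_le_one_le)
    finally show "norm (?m t) < B" by (simp add: B_def)
  qed
  have B0: "0 < B" using B(1)[of 0] by simp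
  obtain r where r0: "0 < r \<and> (\<forall>a b m. a \<in> Q \<and> b \<in> Q \<and> a \<noteq> 0 \<and> b \<noteq> 0 \<and> m \<noteq> 0 \<and> norm a < r \<and> norm b < r \<and> norm m < r \<and>
     Arg2pi a \<le> Arg2pi m \<and> Arg2pi m \<le> Arg2pi b \<longrightarrow> m \<in> Q)"
    using local_between by (rule exE)
  note r = r0[THEN conjunct1] r0[THEN conjunct2, rule_format]
  have sArg: "Arg2pi (s *\<^sub>R z) = Arg2pi z" if "0 < s" for s z
    using Arg2pi_times_of_real[OF that, of z] by (simp add: scaleR_conv_of_real)
  have "S \<noteq> {}"
  proof -
    define s where "s = min 1 (r / B)"
    have s: "0 < s" "s \<le> 1" "s * B \<le> r" using r(1) B0 by (auto simp: s_def min_def field_simps)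
    have sm: "s * norm z < r" if "norm z < B" for z :: complex
    proof -
      have "s * norm z < s * B" using that s(1) by simp
      then show ?thesis using s(3) by linarith
    qed
    have "s *\<^sub>R ?m t \<in> Q" if t: "t \<in> {0..1}" for t
    proof (rule r(2)[of "s *\<^sub>R a" "s *\<^sub>R b"], intro conjI)
      show "s *\<^sub>R a \<in> Q" "s *\<^sub>R b \<in> Q" using star aQ s by auto
      show "norm (s *\<^sub>R a) < r" "norm (s *\<^sub>R b) < r" using sm[of a] sm[of b] B(2)[of 0] B(2)[of 1] s by simp_all
      show "norm (s *\<^sub>R ?m t) < r" using sm[of "?m t"] B(2)[of t] t s by (simp del: scaleR_add_right)
      note sa = segment_Arg[OF ne ang refl, of t]
      show "s *\<^sub>R ?m t \<noteq> 0" using sa(1) t s by (simp del: scaleR_add_right)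
      show "Arg2pi (s *\<^sub>R a) \<le> Arg2pi (s *\<^sub>R ?m t)" "Arg2pi (s *\<^sub>R ?m t) \<le> Arg2pi (s *\<^sub>R b)"
        using sa(2,3) t s(1) by (simp_all only: sArg atLeastAtMost_iff)
    qed (use ne s in auto)
    then show ?thesis using s by (auto simp: S_def)
  qed
  moreover have "closedin (top_of_set {0<..1}) S"
  proof -
    have "S = {0<..1} \<inter> (\<Inter>t\<in>{0..1}. (\<lambda>s. s *\<^sub>R ?m t) -` Q)" by (auto simp: S_def)
    moreover have "closed (\<Inter>t\<in>{0..1}. (\<lambda>s. s *\<^sub>R ?m t) -` Q)"
      by (intro closed_INT ballI continuous_closed_vimage closed_Q continuous_intros)
    ultimately show ?thesis using closedin_closed_Int by metis
  qed
  moreover have "openin (top_of_set {0<..1}) S"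
    unfolding openin_euclidean_subtopology_iff
  proof (intro conjI ballI)
    show "S \<subseteq> {0<..1}" by (auto simp: S_def)
    fix s assume "s \<in> S"
    then have s: "0 < s" "s \<le> 1" "\<And>t. 0 \<le> t \<Longrightarrow> t \<le> 1 \<Longrightarrow> s *\<^sub>R ?m t \<in> Q" by (auto simp: S_def)
    have sI: "s *\<^sub>R a \<in> I" "s *\<^sub>R b \<in> I" using star_interior a s by auto
    have conv: "(1 - t) *\<^sub>R (s *\<^sub>R a) + t *\<^sub>R (s *\<^sub>R b) = s *\<^sub>R ?m t" for t by (simp add: scaleR_add_right mult.commute)
    have cl: "closed_segment (s *\<^sub>R a) (s *\<^sub>R b) \<subseteq> Q"
    proof
      fix z assume "z \<in> closed_segment (s *\<^sub>R a) (s *\<^sub>R b)"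
      then obtain t where "z = (1 - t) *\<^sub>R (s *\<^sub>R a) + t *\<^sub>R (s *\<^sub>R b)" "0 \<le> t" "t \<le> 1" unfolding in_segment by blast
      then show "z \<in> Q" unfolding conv using s(3) by blast
    qed
    have no0: "0 \<notin> closed_segment (s *\<^sub>R a) (s *\<^sub>R b)"
    proof
      assume "0 \<in> closed_segment (s *\<^sub>R a) (s *\<^sub>R b)"
      then obtain t where "0 = (1 - t) *\<^sub>R (s *\<^sub>R a) + t *\<^sub>R (s *\<^sub>R b)" "0 \<le> t" "t \<le> 1" unfolding in_segment by blast
      then show False unfolding conv using segment_Arg(1)[OF ne ang refl, of t] s(1) by auto
    qed
    then have "open_segment (s *\<^sub>R a) (s *\<^sub>R b) \<subseteq> I"
      by (intro segment_interior[OF cl _ sI(2)]) (auto simp: open_segment_def)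
    then have "closed_segment (s *\<^sub>R a) (s *\<^sub>R b) \<subseteq> I" using sI by (auto simp: closed_segment_eq_open)
    then obtain \<epsilon> where \<epsilon>: "0 < \<epsilon>" "(\<Union>q\<in>closed_segment (s *\<^sub>R a) (s *\<^sub>R b). ball q \<epsilon>) \<subseteq> I"
      using compact_subset_open_imp_ball_epsilon_subset[of "closed_segment (s *\<^sub>R a) (s *\<^sub>R b)" I] by auto
    show "\<exists>e>0. \<forall>s'\<in>{0<..1}. dist s' s < e \<longrightarrow> s' \<in> S"
    proof (intro exI[of _ "\<epsilon> / B"] conjI ballI impI)
      show "0 < \<epsilon> / B" using \<epsilon> B0 by simp
      fix s' :: real assume s': "s' \<in> {0<..1}" "dist s' s < \<epsilon> / B"
      have "s' *\<^sub>R ?m t \<in> Q" if t: "t \<in> {0..1}" for t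
      proof -
        have "dist (s *\<^sub>R ?m t) (s' *\<^sub>R ?m t) = \<bar>s' - s\<bar> * norm (?m t)"
          unfolding dist_norm scaleR_diff_left[symmetric] norm_scaleR by (simp add: abs_minus_commute)
        also have "\<dots> \<le> \<bar>s' - s\<bar> * B" using B(2)[of t] t by (intro mult_left_mono) auto
        also have "\<dots> < \<epsilon>" using s'(2) B0 by (simp add: dist_real_def field_simps)
        finally have "s' *\<^sub>R ?m t \<in> ball (s *\<^sub>R ?m t) \<epsilon>" by simp
        moreover have "s *\<^sub>R ?m t \<in> closed_segment (s *\<^sub>R a) (s *\<^sub>R b)"
          unfolding conv[symmetric] using t by (intro segI) auto
        ultimately show ?thesis using \<epsilon>(2) interior_subset by blast
      qed
      then show "s' \<in> S" using s' by (simp add: S_def)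
    qed
  qed
  moreover have "Topological_Spaces.connected {0<..1::real}" by (rule convex_connected) (rule convex_real_interval)
  ultimately have "S = {0<..1}" unfolding connected_clopen by blast
  then have "1 \<in> S" by simp
  then have "\<And>t. 0 \<le> t \<Longrightarrow> t \<le> 1 \<Longrightarrow> ?m t \<in> Q" by (simp add: S_def)
  then show ?thesis by (auto simp: in_segment)
qed

theorem visible:
  assumes a: "a \<in> Q" "b \<in> Q" "a \<noteq> 0" "b \<noteq> 0" and ang: "Arg2pi a < Arg2pi b" "Arg2pi b < Arg2pi a + pi"
  shows "closed_segment a b \<subseteq> Q"
proof -
  obtain f g where f: "\<And>n::nat. f n \<in> I" "f \<longlonglongrightarrow> a" and g: "\<And>n::nat. g n \<in> I" "g \<longlonglongrightarrow> b"
    using Q_closure a unfolding closure_sequential by (metis subsetD closure_sequential)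
  have "(\<lambda>n. Arg2pi (f n)) \<longlonglongrightarrow> Arg2pi a" "(\<lambda>n. Arg2pi (g n)) \<longlonglongrightarrow> Arg2pi b"
    using continuous_within_tendsto_compose'[OF continuous_at_Arg2pi[OF off_axis] _ f(2)]
      continuous_within_tendsto_compose'[OF continuous_at_Arg2pi[OF off_axis] _ g(2)] a by auto
  then have "(\<lambda>n. Arg2pi (g n) - Arg2pi (f n)) \<longlonglongrightarrow> Arg2pi b - Arg2pi a" by (intro tendsto_diff)
  then have lim: "(\<lambda>n. Arg2pi (g n) - Arg2pi (f n)) \<longlonglongrightarrow> Arg2pi b - Arg2pi a" .
  have "\<forall>\<^sub>F n in sequentially. 0 < Arg2pi (g n) - Arg2pi (f n)"
    by (rule order_tendstoD(1)[OF lim]) (use ang in simp)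
  moreover have "\<forall>\<^sub>F n in sequentially. Arg2pi (g n) - Arg2pi (f n) < pi"
    by (rule order_tendstoD(2)[OF lim]) (use ang in simp)
  ultimately have ev: "\<forall>\<^sub>F n in sequentially. closed_segment (f n) (g n) \<subseteq> Q"
    by eventually_elim (rule visible_interior[OF f(1) g(1)], simp_all)
  show ?thesis
  proof
    fix z assume "z \<in> closed_segment a b"
    then obtain t where t: "z = (1 - t) *\<^sub>R a + t *\<^sub>R b" "0 \<le> t" "t \<le> 1" unfolding in_segment by blast
    have "(\<lambda>n. (1 - t) *\<^sub>R f n + t *\<^sub>R g n) \<longlonglongrightarrow> z" unfolding t(1) by (intro tendsto_intros f g)
    moreover have "\<forall>\<^sub>F n in sequentially. (1 - t) *\<^sub>R f n + t *\<^sub>R g n \<in> Q"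
      using ev by eventually_elim (use segI[OF t(2,3)] in blast)
    ultimately show "z \<in> Q" using Lim_in_closed_set[OF closed_Q] by (metis trivial_limit_sequentially)
  qed
qed

text \<open>Such a segment crosses the real axis at a nonnegative point.\<close>

theorem hidden:
  assumes a: "a \<in> Q" "b \<in> Q" "a \<noteq> 0" "b \<noteq> 0" and ang: "Arg2pi a + pi \<le> Arg2pi b" and seg: "closed_segment a b \<subseteq> Q"
  shows "0 \<in> open_segment a b"
proof -
  have th: "0 < Arg2pi a" "Arg2pi a < pi" "pi < Arg2pi b" "Arg2pi b < 2 * pi"
    using Arg_pos[OF a(1,3)] ang Arg2pi_lt_2pi[of b] by linarith+
  have ImA: "0 < Im a" unfolding Im_polar[of a] using sin_gt_zero[OF th(1,2)] a(3) by simp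
  have "sin (Arg2pi b) < 0" by (rule sin_lt_zero[OF th(3,4)])
  then have ImB: "Im b < 0" unfolding Im_polar[of b] using a(4) by (simp add: mult_pos_neg)
  define t where "t = Im a / (Im a - Im b)"
  have t: "0 < t" "t < 1" using ImA ImB by (auto simp: t_def field_simps)
  define m where "m = (1 - t) *\<^sub>R a + t *\<^sub>R b"
  have D: "t * (Im a - Im b) = Im a" using ImA ImB by (simp add: t_def)
  have im: "Im m = 0" using D by (simp add: m_def algebra_simps)
  have "Re m * (Im a - Im b) = Re a * (Im a - Im b) + (t * (Im a - Im b)) * (Re b - Re a)" by (simp add: m_def algebra_simps)
  also have "\<dots> = - cr a b" unfolding D by (simp add: cr_def algebra_simps)
  also have "\<dots> \<ge> 0"
  proof -
    have "sin (Arg2pi b - Arg2pi a) \<le> 0" by (rule sin_le_zero) (use ang th in auto)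
    then show ?thesis by (simp add: cr_polar mult_nonneg_nonpos)
  qed
  finally have Re0: "0 \<le> Re m" using ImA ImB by (simp add: zero_le_mult_iff)
  have mQ: "m \<in> Q" using seg segI[of t a b] t by (auto simp: m_def)
  have mr: "complex_of_real (Re m) = m" using im by (simp add: complex_eq_iff)
  have "\<not> 0 < Re m"
  proof
    assume "0 < Re m"
    from axis[OF this] show False unfolding mr using mQ by blast
  qed
  then have "Re m = 0" using Re0 by linarith
  then have "m = 0" using im by (simp add: complex_eq_iff)
  moreover have "a \<noteq> b" using ImA ImB by auto
  ultimately show ?thesis using osegI[of t a b] t by (simp add: m_def)
qed

end

context axis_polygon begin

lemma X_Q: "v \<in> X \<Longrightarrow> v \<in> Q" using X_J J_sub by blast

lemma spoke:
  assumes "v \<in> X" "v \<noteq> 0"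
  shows "closed_segment 0 v \<subseteq> Q" "open_segment 0 v \<inter> X = {}"
proof -
  show s: "closed_segment 0 v \<subseteq> Q" by (rule star_shaped[OF X_Q[OF assms(1)]])
  show "open_segment 0 v \<inter> X = {}" by (rule segment_dichotomy(2)[OF s]) (simp add: open_segment_def)
qed

lemma chord_free:
  assumes "closed_segment v w \<subseteq> Q" "0 \<notin> open_segment v w" shows "open_segment v w \<inter> X = {}"
  by (rule segment_dichotomy(2)[OF assms])

text \<open>Otherwise the vertex would lie inside the segment from the apex to \<open>z\<close>.\<close>

lemma scaled_vertex:
  assumes "z \<in> Q" "v \<in> X" "v \<noteq> 0" "v = s *\<^sub>R z" "0 < s" shows "1 \<le> s"
proof (rule ccontr)
  assume "\<not> 1 \<le> s"
  then have "v \<in> open_segment 0 z" using osegI[of s 0 z] assms by auto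
  moreover have "open_segment 0 z \<inter> X = {}"
    by (rule segment_dichotomy(2)[OF star_shaped[OF assms(1)]]) (simp add: open_segment_def)
  ultimately show False using assms(2) by blast
qed

lemma Arg_inj:
  assumes "v \<in> X" "w \<in> X" "v \<noteq> 0" "w \<noteq> 0" "Arg2pi v = Arg2pi w" shows "v = w"
proof -
  define c where "c = cis (Arg2pi v)"
  have c: "v = norm v *\<^sub>R c" "w = norm w *\<^sub>R c" using polar[of v] polar[of w] assms(5) by (simp_all add: c_def)
  have scale: "(norm v / norm w) *\<^sub>R w = v" if "v = norm v *\<^sub>R c" "w = norm w *\<^sub>R c" "w \<noteq> 0" for v w
  proof -
    have "(norm v / norm w) *\<^sub>R w = (norm v / norm w) *\<^sub>R (norm w *\<^sub>R c)" by (rule arg_cong[OF that(2)])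
    also have "\<dots> = norm v *\<^sub>R c" using that(3) by simp
    also have "\<dots> = v" by (rule that(1)[symmetric])
    finally show ?thesis .
  qed
  have "1 \<le> norm v / norm w"
    by (rule scaled_vertex[OF X_Q[OF assms(2)] assms(1,3) scale[OF c assms(4), symmetric]]) (use assms(3,4) in simp)
  moreover have "1 \<le> norm w / norm v"
    by (rule scaled_vertex[OF X_Q[OF assms(1)] assms(2,4) scale[OF c(2,1) assms(3), symmetric]]) (use assms(3,4) in simp)
  ultimately have "norm v = norm w" using assms by (simp add: le_divide_eq)
  then show ?thesis using c by metis
qed

lemma chord_iff:
  assumes v: "v \<in> X" "w \<in> X" "v \<noteq> 0" "w \<noteq> 0" "Arg2pi v < Arg2pi w"
  shows "closed_segment v w \<subseteq> Q \<and> open_segment v w \<inter> X = {} \<longleftrightarrow> Arg2pi w < Arg2pi v + pi"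
proof
  assume *: "closed_segment v w \<subseteq> Q \<and> open_segment v w \<inter> X = {}"
  show "Arg2pi w < Arg2pi v + pi"
  proof (rule ccontr)
    assume "\<not> ?thesis"
    then have "0 \<in> open_segment v w" using hidden[of v w] v X_Q * by auto
    then show False using * zero_X by blast
  qed
next
  assume h: "Arg2pi w < Arg2pi v + pi"
  have s: "closed_segment v w \<subseteq> Q" by (rule visible) (use v h X_Q in auto)
  have "0 \<notin> open_segment v w"
  proof
    assume "0 \<in> open_segment v w"
    then obtain t where "0 = (1 - t) *\<^sub>R v + t *\<^sub>R w" "0 < t" "t < 1" unfolding in_segment by blast
    then show False using segment_Arg(1)[OF v(3,4) _ h, of 0 t] v(5) by auto
  qed
  then show "closed_segment v w \<subseteq> Q \<and> open_segment v w \<inter> X = {}" using s chord_free by blast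
qed

lemma open_segment_Arg:
  assumes v: "v \<noteq> 0" "w \<noteq> 0" "Arg2pi v < Arg2pi w" "Arg2pi w < Arg2pi v + pi" and m: "m \<in> open_segment v w"
  shows "m \<noteq> 0" "Arg2pi v < Arg2pi m" "Arg2pi m < Arg2pi w"
proof -
  obtain t where t: "m = (1 - t) *\<^sub>R v + t *\<^sub>R w" "0 < t" "t < 1" using m unfolding in_segment by blast
  show "m \<noteq> 0" "Arg2pi v < Arg2pi m" "Arg2pi m < Arg2pi w"
    using segment_Arg(1,4)[OF v(1,2) _ v(4) t(1)] v(3) t by auto
qed

lemma spoke_Arg:
  assumes "m \<in> open_segment 0 v" shows "m \<noteq> 0" "Arg2pi m = Arg2pi v"
proof -
  obtain t where t: "m = (1 - t) *\<^sub>R 0 + t *\<^sub>R v" "0 < t" "t < 1" "0 \<noteq> v" using assms unfolding in_segment by blast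
  show "m \<noteq> 0" using t by simp
  show "Arg2pi m = Arg2pi v" using t Arg2pi_times_of_real[OF t(2), of v] by (simp add: scaleR_conv_of_real)
qed

text \<open>The ray through \<open>k\<close> meets the chord. If \<open>k\<close> were nearer to the apex than the meeting point, or equal to
  it, a segment inside the polygon would pass through a vertex.\<close>

lemma beyond_chord:
  assumes X: "i \<in> X" "k \<in> X" "j \<in> X" "i \<noteq> 0" "k \<noteq> 0" "j \<noteq> 0"
    and ang: "Arg2pi i < Arg2pi k" "Arg2pi k < Arg2pi j" "Arg2pi j < Arg2pi i + pi"
  obtains a where "0 < a" "a < 1" "a *\<^sub>R k \<in> open_segment i j"
proof -
  have p: "0 < cr i k" "0 < cr k j" "0 < cr i j"
    using X ang by (auto simp: cr_polar zero_less_mult_iff intro!: sin_gt_zero)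
  have ki: "cr k i < 0" using p(1) cr_swap[of k i] by simp
  define t where "t = (- cr k i) / (cr k j - cr k i)"
  have t: "0 < t" "t < 1" using p(2) ki by (auto simp: t_def field_simps)
  define m where "m = (1 - t) *\<^sub>R i + t *\<^sub>R j"
  have "t * (cr k j - cr k i) = - cr k i" using p(2) ki by (simp add: t_def)
  then have km: "cr k m = 0" unfolding m_def cr_add cr_scale by (simp add: algebra_simps)
  have "cr (sgn k) m = 0" using km by (simp add: sgn_div_norm cr_scale)
  then obtain s where s: "m = s *\<^sub>R sgn k" using cr_zero_imp_parallel[of "sgn k" m] X(5) by (metis norm_sgn)
  have n: "0 < norm k" using X by simp
  define l where "l = s / norm k"
  have ml: "m = l *\<^sub>R k" using s n by (simp add: l_def sgn_div_norm divide_inverse)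
  have "cr i m = t * cr i j" by (simp add: m_def cr_add cr_scale)
  then have "0 < l * cr i k" using t p(3) unfolding ml cr_scale by simp
  then have l0: "0 < l" using p(1) by (simp add: zero_less_mult_iff)
  have ij: "i \<noteq> j" using ang by auto
  have mo: "m \<in> open_segment i j" unfolding m_def using osegI[OF t ij] .
  have vis: "closed_segment i j \<subseteq> Q" "open_segment i j \<inter> X = {}" using chord_iff[of i j] X ang by auto
  have mQ: "m \<in> Q" using mo vis(1) segment_open_subset_closed by blast
  have k: "k = (1 / l) *\<^sub>R m" using ml l0 by simp
  have "1 \<le> 1 / l" by (rule scaled_vertex[OF mQ X(2,5) k]) (use l0 in simp)
  then have "l \<le> 1" using l0 by (simp add: field_simps)
  moreover have "l \<noteq> 1" using ml mo vis(2) X(2) by auto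
  ultimately show ?thesis using that[of l] l0 mo ml by simp
qed

text \<open>Both middle vertices lie beyond the other chord. Hence, on the two rays through \<open>k\<close> and \<open>j\<close>, the chords
  change their order, and the point \<open>z\<close> where they cross is computed in the basis \<open>k, j\<close>.\<close>

lemma chords_meet:
  assumes X: "i \<in> X" "k \<in> X" "j \<in> X" "l \<in> X" "i \<noteq> 0" "k \<noteq> 0" "j \<noteq> 0" "l \<noteq> 0"
    and ang: "Arg2pi i < Arg2pi k" "Arg2pi k < Arg2pi j" "Arg2pi j < Arg2pi l"
    and vis: "Arg2pi j < Arg2pi i + pi" "Arg2pi l < Arg2pi k + pi"
  shows "open_segment i j \<inter> open_segment k l \<noteq> {}"
proof -
  obtain a where a: "0 < a" "a < 1" "a *\<^sub>R k \<in> open_segment i j"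
    using beyond_chord[OF X(1,2,3,5,6,7) ang(1,2) vis(1)] by blast
  obtain b where b: "0 < b" "b < 1" "b *\<^sub>R j \<in> open_segment k l"
    using beyond_chord[OF X(2,3,4,6,7,8) ang(2,3) vis(2)] by blast
  obtain t where t: "a *\<^sub>R k = (1 - t) *\<^sub>R i + t *\<^sub>R j" "0 < t" "t < 1" "i \<noteq> j" using a(3) unfolding in_segment by blast
  obtain s where s: "b *\<^sub>R j = (1 - s) *\<^sub>R k + s *\<^sub>R l" "0 < s" "s < 1" "k \<noteq> l" using b(3) unfolding in_segment by blast
  have ab: "a * b < 1" using a b by (metis mult_strict_mono mult_1 less_imp_le zero_less_one)
  define q where "q = b * (1 - a) / (1 - a * b)"
  define p where "p = a * (1 - b) / (1 - a * b)"
  have q: "0 < q" "q < 1" and p: "0 < p" "p < 1" using a b ab by (auto simp: q_def p_def divide_simps algebra_simps)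
  have e: "(1 - q) * a = p" "(1 - p) * b = q" using ab by (simp_all add: q_def p_def divide_simps) (simp_all add: algebra_simps)
  define z where "z = p *\<^sub>R k + q *\<^sub>R j"
  have z1: "z = (1 - q) *\<^sub>R (a *\<^sub>R k) + q *\<^sub>R j" unfolding z_def scaleR_scaleR e ..
  have z2: "z = p *\<^sub>R k + (1 - p) *\<^sub>R (b *\<^sub>R j)" unfolding z_def scaleR_scaleR e ..
  have "z = (1 - (1 - (1 - q) * (1 - t))) *\<^sub>R i + (1 - (1 - q) * (1 - t)) *\<^sub>R j"
    unfolding z1 t(1) by (simp add: algebra_simps)
  moreover have "0 < (1 - q) * (1 - t)" "(1 - q) * (1 - t) < 1" using q t by (simp, smt (verit) mult_less_cancel_left2 mult_less_cancel_right2)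
  ultimately have "z \<in> open_segment i j" using osegI[of "1 - (1 - q) * (1 - t)" i j] t(4) by simp
  moreover have "z = (1 - (1 - p) * s) *\<^sub>R k + ((1 - p) * s) *\<^sub>R l"
    unfolding z2 s(1) by (simp add: algebra_simps)
  moreover have "0 < (1 - p) * s" "(1 - p) * s < 1" using p s by (simp, smt (verit) mult_less_cancel_left2 mult_less_cancel_right2)
  then have "(1 - (1 - p) * s) *\<^sub>R k + ((1 - p) * s) *\<^sub>R l \<in> open_segment k l" using osegI s(4) by blast
  ultimately show ?thesis by auto
qed

lemma spoke_meets_chord:
  assumes X: "k \<in> X" "j \<in> X" "l \<in> X" "k \<noteq> 0" "j \<noteq> 0" "l \<noteq> 0"
    and ang: "Arg2pi k < Arg2pi j" "Arg2pi j < Arg2pi l" "Arg2pi l < Arg2pi k + pi"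
  shows "open_segment 0 j \<inter> open_segment k l \<noteq> {}"
proof -
  obtain b where b: "0 < b" "b < 1" "b *\<^sub>R j \<in> open_segment k l" by (rule beyond_chord[OF X ang])
  then have "b *\<^sub>R j \<in> open_segment 0 j" using osegI[of b 0 j] X(5) by auto
  then show ?thesis using b by blast
qed

text \<open>The inner chord lies beyond the line through the outer one, since its ends do.\<close>

lemma nested_disjoint:
  assumes X: "i \<in> X" "k \<in> X" "l \<in> X" "j \<in> X" "i \<noteq> 0" "k \<noteq> 0" "l \<noteq> 0" "j \<noteq> 0"
    and ang: "Arg2pi i \<le> Arg2pi k" "Arg2pi k < Arg2pi l" "Arg2pi l \<le> Arg2pi j" "Arg2pi j < Arg2pi i + pi"
    and ne: "(i, j) \<noteq> (k, l)"
  shows "open_segment i j \<inter> open_segment k l = {}"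
proof -
  define h where "h z = cr (z - i) (j - i)" for z
  have ij: "0 < cr i j" using X ang by (auto simp: cr_polar zero_less_mult_iff intro!: sin_gt_zero)
  have comb: "h ((1 - t) *\<^sub>R x + t *\<^sub>R y) = (1 - t) * h x + t * h y" for t x y
    by (simp add: h_def cr_add cr_diff cr_scale algebra_simps)
  have h0: "h i = 0" "h j = 0" by (simp_all add: h_def)
  have on: "h m = 0" if mm: "m \<in> open_segment i j" for m
  proof -
    obtain t where "m = (1 - t) *\<^sub>R i + t *\<^sub>R j" using mm unfolding in_segment by blast
    then show ?thesis using comb h0 by simp
  qed
  have pos: "0 < h v" if v: "v \<in> X" "v \<noteq> 0" "Arg2pi i < Arg2pi v" "Arg2pi v < Arg2pi j" for v
  proof -
    obtain a where a: "0 < a" "a < 1" "a *\<^sub>R v \<in> open_segment i j"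
      using beyond_chord[OF X(1) v(1) X(4,5) v(2) X(8) v(3,4) ang(4)] by blast
    have "0 = (1 - a) * h 0 + a * h v" using on[OF a(3)] comb[of a 0 v] by simp
    moreover have "h 0 = - cr i j" by (simp add: h_def cr_diff)
    ultimately have "a * h v = (1 - a) * cr i j" by simp
    then have "0 < a * h v" using a ij by simp
    then show ?thesis using a by (simp add: zero_less_mult_iff)
  qed
  have k: "k = i \<or> 0 < h k" using pos[OF X(2,6)] Arg_inj[OF X(1,2,5,6)] ang by (cases "Arg2pi i = Arg2pi k") auto
  have l: "l = j \<or> 0 < h l" using pos[OF X(3,7)] Arg_inj[OF X(3,4,7,8)] ang by (cases "Arg2pi l = Arg2pi j") auto
  have "0 \<le> h k" "0 \<le> h l" "0 < h k \<or> 0 < h l" using k l h0 ne by auto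
  then have "0 < h m" if m: "m \<in> open_segment k l" for m
  proof -
    obtain t where t: "m = (1 - t) *\<^sub>R k + t *\<^sub>R l" "0 < t" "t < 1" using m unfolding in_segment by blast
    show ?thesis unfolding t(1) comb using t(2,3) \<open>0 \<le> h k\<close> \<open>0 \<le> h l\<close> \<open>0 < h k \<or> 0 < h l\<close>
      by (smt (verit) mult_nonneg_nonneg mult_pos_pos)
  qed
  then show ?thesis using on by force
qed

end

section \<open>Gadgets in balanced angle sequences\<close>

text \<open>A downward closed condition on the angles holds for an initial segment of the labels.\<close>

lemma cut_index:
  fixes th :: "int \<Rightarrow> real"
  assumes mono: "\<And>i j. 1 \<le> i \<Longrightarrow> i < j \<Longrightarrow> j \<le> m \<Longrightarrow> th i < th j" and m: "0 \<le> m"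
    and down: "\<And>x y. x \<le> y \<Longrightarrow> D y \<Longrightarrow> D x"
  shows "\<exists>k. 0 \<le> k \<and> k \<le> m \<and> (\<forall>i. 1 \<le> i \<and> i \<le> m \<longrightarrow> D (th i) = (i \<le> k))"
proof -
  define K where "K = insert 0 {i. 1 \<le> i \<and> i \<le> m \<and> D (th i)}"
  have fin: "finite K" unfolding K_def by (rule finite.insertI, rule finite_subset[of _ "{1..m}"]) auto
  have Kne: "K \<noteq> {}" by (auto simp: K_def)
  have M: "Max K \<in> K" and mx: "\<And>i. i \<in> K \<Longrightarrow> i \<le> Max K" using fin Kne Max_in Max_ge by blast+
  have "D (th i) = (i \<le> Max K)" if i: "1 \<le> i" "i \<le> m" for i
  proof
    assume "D (th i)" then show "i \<le> Max K" using mx i by (auto simp: K_def)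
  next
    assume le: "i \<le> Max K"
    then have k: "1 \<le> Max K" "Max K \<le> m" "D (th (Max K))" using M i by (auto simp: K_def)
    have "th i \<le> th (Max K)" using mono[OF i(1), of "Max K"] le k(2) by (cases "i = Max K") auto
    then show "D (th i)" using down k(3) by blast
  qed
  then show ?thesis using M m by (intro exI[of _ "Max K"]) (auto simp: K_def)
qed

text \<open>\<open>LT\<close> and \<open>LE\<close> turn angles into labels, so that half-planes become intervals of labels. The second block starts
  at the first label \<open>p + 1\<close> hidden from label \<open>1\<close>; the first block starts after \<open>a\<close>, the last label hidden
  from the end \<open>B\<close> of the second; the last vertex \<open>r + 1\<close> is the first one hidden from the end
  \<open>\<Lambda>\<close> of the first block; and the hub \<open>s + 1\<close> is the first label that sees \<open>r + 1\<close>. That these choices fit together follows from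
  the bounds for the half-planes whose boundary lines pass through these vertices.\<close>

lemma gadget_vertices:
  fixes th :: "int \<Rightarrow> real" and LT LE :: "real \<Rightarrow> int" and m c :: int and sees :: "int \<Rightarrow> int \<Rightarrow> bool"
  assumes mono: "\<And>i j. 1 \<le> i \<Longrightarrow> i < j \<Longrightarrow> j \<le> m \<Longrightarrow> th i < th j"
    and rng: "\<And>i. 1 \<le> i \<Longrightarrow> i \<le> m \<Longrightarrow> 0 < th i \<and> th i < 2 * pi"
    and LT: "\<And>x. 0 \<le> LT x \<and> LT x \<le> m" "\<And>x i. 1 \<le> i \<Longrightarrow> i \<le> m \<Longrightarrow> th i < x \<longleftrightarrow> i \<le> LT x"
    and LE: "\<And>x. 0 \<le> LE x \<and> LE x \<le> m" "\<And>x i. 1 \<le> i \<Longrightarrow> i \<le> m \<Longrightarrow> th i \<le> x \<longleftrightarrow> i \<le> LE x"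
    and front: "\<And>\<alpha>. 0 \<le> \<alpha> \<Longrightarrow> \<alpha> \<le> pi \<Longrightarrow> c \<le> LT (\<alpha> + pi) - LE \<alpha> \<and> 2 * (LT (\<alpha> + pi) - LE \<alpha>) \<le> 3 * c"
    and rear: "\<And>\<alpha>. 0 \<le> \<alpha> \<Longrightarrow> \<alpha> \<le> pi \<Longrightarrow> c \<le> LT \<alpha> + (m - LE (\<alpha> + pi))"
    and c: "223 \<le> c"
    and sees: "\<And>i j. sees i j \<longleftrightarrow> i = 0 \<or> i = 1 \<and> j \<le> 104 \<or> 2 \<le> i \<and> j \<le> 114 \<or> 104 \<le> i"
  shows "\<exists>y :: int \<Rightarrow> int. y 0 = 0 \<and> (\<forall>i. 1 \<le> i \<and> i \<le> 115 \<longrightarrow> 1 \<le> y i \<and> y i \<le> m) \<and>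
    (\<forall>i j. 1 \<le> i \<and> i < j \<and> j \<le> 115 \<longrightarrow> y i < y j \<and> (th (y j) < th (y i) + pi \<longleftrightarrow> sees i j))"
proof -
  have le_mono: "th i \<le> th j" if "1 \<le> i" "i \<le> j" "j \<le> m" for i j
    using mono[of i j] that by (cases "i = j") auto
  have LTth: "LT (th i) = i - 1" if "1 \<le> i" "i \<le> m" for i
  proof -
    have "LT (th i) < i" using LT(2)[OF that, of "th i"] by auto
    moreover have "i - 1 \<le> LT (th i)"
      using LT(2)[of "i - 1" "th i"] mono[of "i - 1" i] that LT(1)[of "th i"] by (cases "i = 1") auto
    ultimately show ?thesis by simp
  qed
  have LEth: "LE (th i) = i" if "1 \<le> i" "i \<le> m" for i
  proof -
    have "i \<le> LE (th i)" using LE(2)[OF that, of "th i"] by auto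
    moreover have "\<not> i + 1 \<le> LE (th i)"
      using LE(2)[of "i + 1" "th i"] mono[of i "i + 1"] that LE(1)[of "th i"] by auto
    ultimately show ?thesis by simp
  qed
  have LTLE: "LT x \<le> LE x" for x
    using LT(1)[of x] LT(2)[of "LT x" x] LE(2)[of "LT x" x] LE(1)[of x] by (cases "LT x = 0") auto
  have "c \<le> LT (0 + pi) - LE 0" using front[of 0] by simp
  then have half: "c \<le> LT pi" using LE(1)[of 0] by simp
  then have m1: "1 \<le> m" using LT(1)[of pi] c by linarith
  have th1: "0 < th 1" "th 1 < pi" using rng[of 1] LT(2)[of 1 pi] m1 half c by auto
  define p where "p = LT (th 1 + pi)"
  have "c \<le> LT (th 1) + (m - LE (th 1 + pi))" using rear[of "th 1"] th1 by simp
  then have pm: "p + c \<le> m" using LTth[of 1] m1 LTLE[of "th 1 + pi"] by (simp add: p_def)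
  have "2 * (p - 1) \<le> 3 * c" using front[of "th 1"] th1 LEth[of 1] m1 by (simp add: p_def)
  then have pu: "2 * p \<le> 3 * c + 2" by (simp add: algebra_simps)
  have p0: "0 \<le> p" using LT(1) by (simp add: p_def)
  have b: "th 1 + pi \<le> th i" if "p < i" "i \<le> m" for i
    using LT(2)[of i "th 1 + pi"] that p0 by (simp add: p_def not_less[symmetric] del: not_less)
  define B where "B = th (p + 10)"
  have B: "th 1 + pi \<le> B" "B < 2 * pi" using b[of "p + 10"] rng[of "p + 10"] pm c p0 by (auto simp: B_def)
  define a where "a = LE (B - pi)"
  have a0: "0 \<le> a" using LE(1) by (simp add: a_def)
  have "c \<le> LT B - a" using front[of "B - pi"] B th1 by (simp add: a_def)
  moreover have "LT B = p + 9" unfolding B_def using LTth[of "p + 10"] pm c p0 by simp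
  ultimately have pa: "a + c \<le> p + 9" by simp
  have aB: "B - pi < th i" if "a < i" "i \<le> m" for i
    using LE(2)[of i "B - pi"] that a0 by (simp add: a_def not_le[symmetric] del: not_le)
  define \<Lambda> where "\<Lambda> = th (a + 102)"
  have ap: "a + 102 \<le> p" using pa c by simp
  have LT\<Lambda>: "LT \<Lambda> = a + 101" and LE\<Lambda>: "LE \<Lambda> = a + 102"
    unfolding \<Lambda>_def using LTth[of "a + 102"] LEth[of "a + 102"] ap pm c a0 by simp_all
  have \<Lambda>B: "B - pi < \<Lambda>" unfolding \<Lambda>_def by (rule aB) (use ap pm c in auto)
  have \<Lambda>1: "\<Lambda> \<le> pi"
  proof (rule ccontr)
    assume "\<not> \<Lambda> \<le> pi"
    then have "LT pi \<le> LT \<Lambda>"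
      using LT(2)[of "LT pi" pi] LT(2)[of "LT pi" \<Lambda>] LT(1)[of pi] half c by auto
    then have "LT pi \<le> a + 101" using LT\<Lambda> by simp
    then have "c \<le> a + 101" using half by simp
    then have "4 * c \<le> 2 * p + 220" using pa by linarith
    then show False using pu c by linarith
  qed
  have \<Lambda>0: "0 \<le> \<Lambda>" using \<Lambda>B B th1 by linarith
  define r where "r = LT (\<Lambda> + pi)"
  have "c \<le> a + 101 + (m - LE (\<Lambda> + pi))" using rear[OF \<Lambda>0 \<Lambda>1] LT\<Lambda> by simp
  then have rm: "r + 1 \<le> m" using LTLE[of "\<Lambda> + pi"] pa pu c by (simp add: r_def)
  have rp: "p + 10 \<le> r" using LT(2)[of "p + 10" "\<Lambda> + pi"] \<Lambda>B pm c p0 by (simp add: r_def B_def)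
  have "2 * (r - (a + 102)) \<le> 3 * c" using front[OF \<Lambda>0 \<Lambda>1] LE\<Lambda> by (simp add: r_def)
  then have ru: "2 * r \<le> 3 * c + 2 * a + 204" by (simp add: algebra_simps)
  define \<omega> where "\<omega> = th (r + 1)"
  have \<omega>: "\<Lambda> + pi \<le> \<omega>" "\<omega> < 2 * pi"
    using LT(2)[of "r + 1" "\<Lambda> + pi"] rng[of "r + 1"] rm rp p0 by (auto simp: r_def \<omega>_def not_less[symmetric] simp del: not_less)
  define s where "s = LE (\<omega> - pi)"
  have "c \<le> LT \<omega> - s" using front[of "\<omega> - pi"] \<omega> \<Lambda>0 by (simp add: s_def)
  moreover have "LT \<omega> = r" unfolding \<omega>_def using LTth[of "r + 1"] rm rp p0 by simp
  ultimately have rs: "s + c \<le> r" by simp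
  have sa: "a + 102 \<le> s" using LE(2)[of "a + 102" "\<omega> - pi"] \<omega> ap pm c a0 by (simp add: s_def \<Lambda>_def)
  have sp: "s + 1 \<le> p" using rs ru pa c by linarith
  have s\<omega>: "\<omega> - pi < th i" if "s < i" "i \<le> m" for i
    using LE(2)[of i "\<omega> - pi"] that sa a0 by (simp add: s_def not_le[symmetric] del: not_le)
  define y where "y i = (if i \<le> 1 then i else if i \<le> 103 then a + (i - 1) else if i = 104 then s + 1
    else if i \<le> 114 then p + (i - 104) else r + 1)" for i :: int
  have low: "y i = a + (i - 1)" if "2 \<le> i" "i \<le> 103" for i using that by (simp add: y_def)
  have y1: "y 1 = 1" "y 104 = s + 1" "y 115 = r + 1" by (simp_all add: y_def)
  have hi: "y i = p + (i - 104)" if "105 \<le> i" "i \<le> 114" for i using that by (simp add: y_def)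
  have cases: "i = 1 \<or> 2 \<le> i \<and> i \<le> 103 \<or> i = 104 \<or> 105 \<le> i \<and> i \<le> 114 \<or> i = 115" if "1 \<le> i" "i \<le> 115" for i :: int
    using that by linarith
  have yrng: "1 \<le> y i \<and> y i \<le> m" if "1 \<le> i" "i \<le> 115" for i
    unfolding y_def using that a0 sa sp ap rp rm by simp
  have a1: "1 \<le> a"
    using LE(2)[of 1 "B - pi"] B m1 by (simp add: a_def)
  have ymono: "y i < y j" if ij: "1 \<le> i" "i < j" "j \<le> 115" for i j
    unfolding y_def using ij a1 sa sp ap rp by simp
  have th_le: "th (y i) \<le> th (y j)" if "1 \<le> i" "i \<le> j" "j \<le> 115" for i j
    using le_mono[of "y i" "y j"] yrng[of i] yrng[of j] ymono[of i j] that by (cases "i = j") auto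
  have "th (y j) < th (y i) + pi \<longleftrightarrow> sees i j" if ij: "1 \<le> i" "i < j" "j \<le> 115" for i j
  proof -
    consider "i = 1" "j \<le> 104" | "i = 1" "105 \<le> j" | "2 \<le> i" "j \<le> 114" | "2 \<le> i" "i \<le> 103" "j = 115" | "104 \<le> i"
      using ij by linarith
    then show ?thesis
    proof cases
      case 1
      have "th (y 104) < th 1 + pi" using LT(2)[of "s + 1" "th 1 + pi"] sp sa a0 pm c by (simp add: y1 p_def)
      then show ?thesis using th_le[of j 104] 1 ij y1(1) sees[of i j] by simp
    next
      case 2
      have "th 1 + pi \<le> th (y 105)" using b[of "p + 1"] hi[of 105] pm c by simp
      then show ?thesis using th_le[of 105 j] 2 ij y1(1) sees[of i j] by simp
    next
      case 3
      have "th (y 114) = B" using hi[of 114] by (simp add: B_def)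
      moreover have "B - pi < th (y 2)" using aB[of "a + 1"] low[of 2] ap pm c by simp
      ultimately show ?thesis using th_le[of 2 i] th_le[of j 114] 3 ij sees[of i j] by simp
    next
      case 4
      have "th (y 103) = \<Lambda>" using low[of 103] by (simp add: \<Lambda>_def)
      then show ?thesis using th_le[of i 103] 4 ij \<omega>(1) y1(3) sees[of i j] by (simp add: \<omega>_def)
    next
      case 5
      have "\<omega> - pi < th (y 104)" using s\<omega>[of "s + 1"] sp pm c y1 by simp
      then show ?thesis using th_le[of 104 i] th_le[of j 115] 5 ij y1(3) sees[of i j] by (simp add: \<omega>_def)
    qed
  qed
  moreover have "y 0 = 0" by (simp add: y_def)
  ultimately show ?thesis using yrng ymono by blast
qed

section \<open>From the Euclidean plane to the complex plane\<close>

definition dir :: "real \<Rightarrow> plane" where "dir \<theta> = vector [cos \<theta>, sin \<theta>]"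

lemma inner_dir: "u \<bullet> dir \<theta> = u $ 1 * cos \<theta> + u $ 2 * sin \<theta>"
  by (simp add: dir_def inner_vec_def sum_2)

lemma plane_polar: "u \<noteq> 0 \<Longrightarrow> \<exists>\<rho> \<phi>. 0 < \<rho> \<and> 0 \<le> \<phi> \<and> \<phi> < 2 * pi \<and> u = \<rho> *\<^sub>R dir \<phi>"
proof -
  assume u: "u \<noteq> 0"
  define z where "z = Complex (u $ 1) (u $ 2)"
  have z0: "z \<noteq> 0" using u by (auto simp: z_def complex_eq_iff vec_eq_iff forall_2)
  have "Re z = Re (norm z *\<^sub>R cis (Arg2pi z))" by (rule arg_cong[OF polar])
  then have "Re z = norm z * cos (Arg2pi z)" by simp
  moreover have "u $ 1 = Re z" "u $ 2 = Im z" by (simp_all add: z_def)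
  ultimately have "u $ 1 = norm z * cos (Arg2pi z)" "u $ 2 = norm z * sin (Arg2pi z)"
    using Im_polar[of z] by (simp_all only:)
  then have "u = norm z *\<^sub>R dir (Arg2pi z)" by (simp add: vec_eq_iff forall_2 dir_def)
  then show ?thesis using z0 Arg2pi_ge_0 Arg2pi_lt_2pi by (metis zero_less_norm_iff)
qed

definition half_dirs :: "plane \<Rightarrow> real set" where
  "half_dirs u = {\<theta> \<in> {0..<2 * pi}. 0 < u \<bullet> dir \<theta>}"

lemma continuous_dir: "continuous_on UNIV dir"
proof -
  have c: "continuous_on UNIV (\<lambda>\<theta>::real. if i = 1 then cos \<theta> else sin \<theta>)" for i :: 2
    using continuous_on_cos[of UNIV "\<lambda>x::real. x"] continuous_on_sin[of UNIV "\<lambda>x::real. x"]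
    by (cases "i = 1") (simp_all add: continuous_on_id)
  have "continuous_on UNIV (\<lambda>\<theta>::real. \<chi> i::2. if i = 1 then cos \<theta> else sin \<theta>)"
    by (rule continuous_on_vec_lambda) (rule c)
  moreover have "dir = (\<lambda>\<theta>::real. \<chi> i::2. if i = 1 then cos \<theta> else sin \<theta>)"
    by (rule ext) (simp add: dir_def vec_eq_iff forall_2)
  ultimately show ?thesis by (simp only:)
qed

lemma half_dirs_lebesgue: "half_dirs u \<in> sets lebesgue"
proof -
  have "open {\<theta>. 0 < u \<bullet> dir \<theta>}" by (intro open_Collect_less continuous_intros continuous_dir)
  then have "{\<theta>. 0 < u \<bullet> dir \<theta>} \<inter> {0..<2 * pi} \<in> sets borel" by (intro sets.Int) auto
  moreover have "half_dirs u = {\<theta>. 0 < u \<bullet> dir \<theta>} \<inter> {0..<2 * pi}" by (auto simp: half_dirs_def)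
  ultimately show ?thesis by (metis sets_completionI_sets sets_lborel)
qed

lemma circle_measure: "{0..<2 * pi} \<in> lmeasurable" "measure lebesgue {0..<2 * pi} = 2 * pi"
proof -
  show "{0..<2 * pi} \<in> lmeasurable" by (rule bounded_set_imp_lmeasurable) auto
  have "measure lebesgue {0..<2 * pi} = measure lborel {0..<2 * pi}" by (rule measure_completion) simp
  then show "measure lebesgue {0..<2 * pi} = 2 * pi" by simp
qed

lemma half_dirs_fmeasurable: "half_dirs u \<in> lmeasurable"
  by (rule fmeasurableI2[OF circle_measure(1) _ half_dirs_lebesgue]) (auto simp: half_dirs_def)

lemma two_intervals:
  assumes "a \<le> b" "b \<le> c" "c \<le> d" and S: "{a<..<b} \<union> {c<..<d} \<subseteq> S" "S \<in> lmeasurable"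
  shows "(b - a) + (d - c) \<le> measure lebesgue S"
proof -
  have "measure lebesgue ({a<..<b} \<union> {c<..<d}) = (b - a) + (d - c)"
  proof -
    have "measure lebesgue ({a<..<b} \<union> {c<..<d}) = measure lborel ({a<..<b} \<union> {c<..<d})"
      by (rule measure_completion) simp
    also have "\<dots> = measure lborel {a<..<b} + measure lborel {c<..<d}"
      by (rule measure_Union) (use assms(1-3) in auto)
    finally show ?thesis using assms(1-3) by simp
  qed
  moreover have "measure lebesgue ({a<..<b} \<union> {c<..<d}) \<le> measure lebesgue S"
    by (rule measure_mono_fmeasurable[OF S(1) _ S(2)]) simp
  ultimately show ?thesis by simp
qed

text \<open>Depending on the position of the normal, the half-circle is one interval or is cut into two at \<open>0\<close>.\<close>

lemma half_dirs_measure: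
  assumes u: "u \<noteq> 0" shows "pi \<le> measure lebesgue (half_dirs u)"
proof -
  obtain \<rho> \<phi> where p: "0 < \<rho>" "0 \<le> \<phi>" "\<phi> < 2 * pi" "u = \<rho> *\<^sub>R dir \<phi>" using plane_polar[OF u] by blast
  have mem: "\<theta> \<in> half_dirs u" if "0 \<le> \<theta>" "\<theta> < 2 * pi"
    "\<phi> - pi / 2 < \<theta> \<and> \<theta> < \<phi> + pi / 2 \<or> \<theta> < \<phi> - 3 * pi / 2 \<or> \<phi> + 3 * pi / 2 < \<theta>" for \<theta>
  proof -
    have "0 < cos (\<theta> - \<phi>)"
      using that(3)
    proof (elim disjE)
      assume "\<phi> - pi / 2 < \<theta> \<and> \<theta> < \<phi> + pi / 2" then show ?thesis by (intro cos_gt_zero_pi) linarith+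
    next
      assume "\<theta> < \<phi> - 3 * pi / 2"
      then have "0 < cos (\<theta> - \<phi> + 2 * pi)" using that(1) p(3) by (intro cos_gt_zero_pi) linarith+
      then show ?thesis by (simp only: cos_periodic)
    next
      assume "\<phi> + 3 * pi / 2 < \<theta>"
      then have "0 < cos (\<theta> - \<phi> - 2 * pi)" using that(2) p(2) by (intro cos_gt_zero_pi) linarith+
      then show ?thesis using cos_periodic[of "\<theta> - \<phi> - 2 * pi"] by simp
    qed
    moreover have "u \<bullet> dir \<theta> = \<rho> * cos (\<theta> - \<phi>)"
      unfolding inner_dir p(4) by (simp add: dir_def cos_diff algebra_simps)
    ultimately have "0 < u \<bullet> dir \<theta>" using p(1) by simp
    then show ?thesis using that by (simp add: half_dirs_def)
  qed
  note ti = two_intervals[OF _ _ _ _ half_dirs_fmeasurable[of u]]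
  consider "\<phi> < pi / 2" | "pi / 2 \<le> \<phi>" "\<phi> \<le> 3 * pi / 2" | "3 * pi / 2 < \<phi>" by linarith
  then show ?thesis
  proof cases
    case 1
    have "{0<..<\<phi> + pi / 2} \<union> {\<phi> + 3 * pi / 2<..<2 * pi} \<subseteq> half_dirs u"
      by (intro Un_least subsetI mem) (use 1 p(1-3) in auto)
    from ti[OF _ _ _ this] show ?thesis using 1 p(1-3) by simp
  next
    case 2
    have "{\<phi> - pi / 2<..<\<phi> + pi / 2} \<union> {2 * pi<..<2 * pi} \<subseteq> half_dirs u"
      by (intro Un_least subsetI mem) (use 2 p(1-3) in auto)
    from ti[OF _ _ _ this] show ?thesis using 2 p(1-3) by simp
  next
    case 3
    have "{0<..<\<phi> - 3 * pi / 2} \<union> {\<phi> - pi / 2<..<2 * pi} \<subseteq> half_dirs u"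
      by (intro Un_least subsetI mem) (use 3 p(1-3) in auto)
    from ti[OF _ _ _ this] show ?thesis using 3 p(1-3) by simp
  qed
qed

definition enters :: "plane set \<Rightarrow> plane \<Rightarrow> plane \<Rightarrow> bool" where
  "enters P v z \<longleftrightarrow> (\<exists>\<delta>>0. \<forall>t. 0 < t \<and> t < \<delta> \<longrightarrow> v + t *\<^sub>R z \<in> P)"

lemma interior_angle_enters:
  "interior_angle P v = measure lebesgue {\<theta> \<in> {0..<2 * pi}. enters P v (dir \<theta>)}"
  unfolding interior_angle_def enters_def dir_def ..

text \<open>The directions in which all points at positive distance less than \<open>1 / (n + 1)\<close> belong to \<open>P\<close>. For closed \<open>P\<close> this set is
  closed, which makes the directions entering \<open>P\<close> measurable.\<close>

definition enter_steps :: "plane set \<Rightarrow> plane \<Rightarrow> nat \<Rightarrow> real set" where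
  "enter_steps P v n = (\<Inter>t\<in>{0<..<inverse (real (Suc n))}. (\<lambda>\<theta>. v + t *\<^sub>R dir \<theta>) -` P)"

lemma closed_enter_steps: assumes "closed P" shows "closed (enter_steps P v n)"
proof -
  have d: "isCont dir \<theta>" for \<theta> using continuous_dir by (simp add: continuous_on_eq_continuous_at)
  have "isCont (\<lambda>\<theta>. v + t *\<^sub>R dir \<theta>) \<theta>" for t \<theta>
    by (rule continuous_add[OF continuous_const continuous_scaleR[OF continuous_const d]])
  then have "closed ((\<lambda>\<theta>. v + t *\<^sub>R dir \<theta>) -` P)" for t by (rule continuous_closed_vimage[OF assms])
  then show ?thesis unfolding enter_steps_def by (rule_tac closed_INT) simp
qed

lemma enters_iff_steps: "enters P v (dir \<theta>) \<longleftrightarrow> (\<exists>n. \<theta> \<in> enter_steps P v n)"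
proof
  assume "enters P v (dir \<theta>)"
  then obtain \<delta> where d: "0 < \<delta>" "\<forall>t. 0 < t \<and> t < \<delta> \<longrightarrow> v + t *\<^sub>R dir \<theta> \<in> P" unfolding enters_def by (elim exE conjE)
  obtain n where n: "inverse (real (Suc n)) < \<delta>" using reals_Archimedean[OF d(1)] by (elim exE)
  have "\<theta> \<in> enter_steps P v n"
    unfolding enter_steps_def
  proof (rule INT_I)
    fix t assume t: "t \<in> {0<..<inverse (real (Suc n))}"
    have "0 < t" "t < \<delta>" using t n unfolding greaterThanLessThan_iff by linarith+
    then show "\<theta> \<in> (\<lambda>\<theta>. v + t *\<^sub>R dir \<theta>) -` P" using d(2) by simp
  qed
  then show "\<exists>n. \<theta> \<in> enter_steps P v n" by (rule exI)
next
  assume "\<exists>n. \<theta> \<in> enter_steps P v n"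
  then obtain n where n: "\<theta> \<in> enter_steps P v n" by (elim exE)
  show "enters P v (dir \<theta>)"
    unfolding enters_def
  proof (intro exI conjI allI impI)
    show "0 < inverse (real (Suc n))" by simp
    fix t assume "0 < t \<and> t < inverse (real (Suc n))"
    then have "t \<in> {0<..<inverse (real (Suc n))}" unfolding greaterThanLessThan_iff .
    with n have "\<theta> \<in> (\<lambda>\<theta>. v + t *\<^sub>R dir \<theta>) -` P" unfolding enter_steps_def by (rule INT_D)
    then show "v + t *\<^sub>R dir \<theta> \<in> P" by simp
  qed
qed

lemma enters_lmeasurable:
  assumes "closed P" shows "{\<theta> \<in> {0..<2 * pi}. enters P v (dir \<theta>)} \<in> lmeasurable"
proof -
  have "enter_steps P v n \<in> sets borel" for n by (rule borel_closed[OF closed_enter_steps[OF assms]])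
  then have "(\<Union>n. enter_steps P v n) \<in> sets borel" by (intro sets.countable_UN image_subsetI)
  then have "(\<Union>n. enter_steps P v n) \<inter> {0..<2 * pi} \<in> sets borel" by (rule sets.Int) simp
  moreover have "{\<theta> \<in> {0..<2 * pi}. enters P v (dir \<theta>)} = (\<Union>n. enter_steps P v n) \<inter> {0..<2 * pi}"
    unfolding enters_iff_steps by blast
  ultimately have "{\<theta> \<in> {0..<2 * pi}. enters P v (dir \<theta>)} \<in> sets lebesgue" by (metis sets_completionI_sets sets_lborel)
  then show ?thesis by (intro fmeasurableI2[OF circle_measure(1)]) (rule Collect_restrict)
qed

lemma half_plane_angle_ge:
  assumes "closed P" "u \<noteq> 0" and h: "\<And>z. 0 \<le> u \<bullet> z \<Longrightarrow> z \<noteq> 0 \<Longrightarrow> enters P v z"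
  shows "pi \<le> interior_angle P v"
proof -
  have "dir \<theta> \<noteq> 0" for \<theta>
  proof
    assume "dir \<theta> = 0"
    then have "dir \<theta> $ 1 = 0" "dir \<theta> $ 2 = 0" by simp_all
    then have "cos \<theta> = 0" "sin \<theta> = 0" by (simp_all add: dir_def)
    then show False using sin_cos_squared_add[of \<theta>] by simp
  qed
  then have "half_dirs u \<subseteq> {\<theta> \<in> {0..<2 * pi}. enters P v (dir \<theta>)}" using h by (auto simp: half_dirs_def)
  then have "measure lebesgue (half_dirs u) \<le> interior_angle P v"
    unfolding interior_angle_enters by (rule measure_mono_fmeasurable[OF _ half_dirs_lebesgue enters_lmeasurable[OF assms(1)]])
  then show ?thesis using half_dirs_measure[OF assms(2)] by simp
qed

lemma half_plane_angle_le:
  assumes "closed P" "u \<noteq> 0" and h: "\<And>z. enters P v z \<Longrightarrow> 0 \<le> u \<bullet> z"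
  shows "interior_angle P v \<le> pi"
proof -
  let ?A = "{\<theta> \<in> {0..<2 * pi}. enters P v (dir \<theta>)}"
  have "?A \<inter> half_dirs (- u) = {}" using h by (force simp: half_dirs_def)
  then have "measure lebesgue (?A \<union> half_dirs (- u)) = measure lebesgue ?A + measure lebesgue (half_dirs (- u))"
    using measure_Un3[OF enters_lmeasurable[OF assms(1), of v] half_dirs_fmeasurable[of "- u"]] by simp
  moreover have "measure lebesgue (?A \<union> half_dirs (- u)) \<le> measure lebesgue {0..<2 * pi}"
  proof (rule measure_mono_fmeasurable[OF _ _ circle_measure(1)])
    show "?A \<union> half_dirs (- u) \<subseteq> {0..<2 * pi}" by (auto simp: half_dirs_def)
    show "?A \<union> half_dirs (- u) \<in> sets lebesgue"
      using fmeasurableD[OF enters_lmeasurable[OF assms(1), of v]] half_dirs_lebesgue[of "- u"] by (rule sets.Un)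
  qed
  ultimately show ?thesis unfolding interior_angle_enters
    using circle_measure(2) half_dirs_measure[of "- u"] assms(2) by simp
qed

definition lin :: "complex \<Rightarrow> plane \<Rightarrow> complex" where
  "lin \<kappa> z = \<kappa> * Complex (z $ 1) (z $ 2)"

definition unlin :: "complex \<Rightarrow> complex \<Rightarrow> plane" where
  "unlin \<kappa> w = vector [Re (cnj \<kappa> * w), Im (cnj \<kappa> * w)]"

text \<open>The isometry that takes \<open>x\<close> to the origin and rotates by the unit complex number \<open>\<kappa>\<close>.\<close>

definition emb :: "complex \<Rightarrow> plane \<Rightarrow> plane \<Rightarrow> complex" where
  "emb \<kappa> x v = lin \<kappa> (v - x)"

lemma lin_add: "lin \<kappa> (a + b) = lin \<kappa> a + lin \<kappa> b" "lin \<kappa> (a - b) = lin \<kappa> a - lin \<kappa> b"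
  "lin \<kappa> (t *\<^sub>R a) = t *\<^sub>R lin \<kappa> a"
  by (simp_all add: lin_def complex_eq_iff algebra_simps)

lemma emb_add: "emb \<kappa> x (v + t *\<^sub>R z) = emb \<kappa> x v + t *\<^sub>R lin \<kappa> z"
  by (simp add: emb_def lin_add)

lemma emb_affine: "emb \<kappa> x ((1 - t) *\<^sub>R a + t *\<^sub>R b) = (1 - t) *\<^sub>R emb \<kappa> x a + t *\<^sub>R emb \<kappa> x b"
  by (simp add: emb_def lin_add scaleR_diff_left scaleR_diff_right)

lemma emb_apex [simp]: "emb \<kappa> x x = 0"
  by (simp add: emb_def lin_def complex_eq_iff)

context fixes \<kappa> :: complex assumes \<kappa>: "norm \<kappa> = 1" begin

lemma cnj_unit: "cnj \<kappa> * \<kappa> = 1" "\<kappa> * cnj \<kappa> = 1"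
  using \<kappa> complex_norm_square[of \<kappa>] by (simp_all add: mult.commute)

lemma lin_unlin: "lin \<kappa> (unlin \<kappa> w) = w"
proof -
  have "lin \<kappa> (unlin \<kappa> w) = \<kappa> * (cnj \<kappa> * w)"
    unfolding lin_def unlin_def by (simp only: vector_2 complex.collapse)
  also have "\<dots> = w" unfolding mult.assoc[symmetric] cnj_unit by (rule mult_1)
  finally show ?thesis .
qed

lemma unlin_lin: "unlin \<kappa> (lin \<kappa> z) = z"
proof -
  have e: "cnj \<kappa> * lin \<kappa> z = Complex (z $ 1) (z $ 2)"
    unfolding lin_def mult.assoc[symmetric] cnj_unit by (rule mult_1)
  show ?thesis unfolding unlin_def e by (simp add: vec_eq_iff forall_2)
qed

lemma lin_inner: "lin \<kappa> a \<bullet> lin \<kappa> b = a \<bullet> b"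
proof -
  have n: "Re \<kappa> * Re \<kappa> + Im \<kappa> * Im \<kappa> = 1" using \<kappa> cmod_power2[of \<kappa>] by (simp add: power2_eq_square)
  have "lin \<kappa> a \<bullet> lin \<kappa> b = (Re \<kappa> * Re \<kappa> + Im \<kappa> * Im \<kappa>) * (a $ 1 * b $ 1 + a $ 2 * b $ 2)"
    by (simp add: lin_def inner_complex_def algebra_simps)
  then show ?thesis using n by (simp add: inner_vec_def sum_2)
qed

lemma dist_emb: "dist (emb \<kappa> x a) (emb \<kappa> x b) = dist a b"
proof -
  have "norm (lin \<kappa> z) = norm z" for z unfolding norm_eq_sqrt_inner lin_inner ..
  moreover have "emb \<kappa> x a - emb \<kappa> x b = lin \<kappa> (a - b)" by (simp add: emb_def lin_add)
  ultimately show ?thesis by (simp add: dist_norm)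
qed

lemma inj_emb: "inj (emb \<kappa> x)"
  by (rule injI) (metis dist_emb dist_eq_0_iff)

lemma emb_unlin: "emb \<kappa> x (x + unlin \<kappa> w) = w"
  by (simp add: emb_def lin_unlin)

lemma surj_emb: "surj (emb \<kappa> x)"
  by (rule surjI[of _ "\<lambda>w. x + unlin \<kappa> w"]) (rule emb_unlin)

lemma bij_emb: "bij (emb \<kappa> x)"
  by (simp add: bij_def inj_emb surj_emb)

lemma continuous_emb: "continuous_on S (emb \<kappa> x)"
  unfolding continuous_on_iff dist_emb by blast

lemma emb_ball: "emb \<kappa> x ` ball a r = ball (emb \<kappa> x a) r"
proof
  show "ball (emb \<kappa> x a) r \<subseteq> emb \<kappa> x ` ball a r"
  proof
    fix w assume w: "w \<in> ball (emb \<kappa> x a) r"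
    obtain b where "w = emb \<kappa> x b" using surj_emb by blast
    then show "w \<in> emb \<kappa> x ` ball a r" using w by (auto simp: dist_emb)
  qed
qed (auto simp: dist_emb)

lemma interior_emb: "interior (emb \<kappa> x ` S) = emb \<kappa> x ` interior S"
proof -
  have "emb \<kappa> x a \<in> interior (emb \<kappa> x ` S) \<longleftrightarrow> a \<in> interior S" for a
    unfolding mem_interior emb_ball[symmetric] inj_image_subset_iff[OF inj_emb] ..
  then show ?thesis using surj_emb[of x] interior_subset[of "emb \<kappa> x ` S"] by blast
qed

lemma frontier_emb: "frontier (emb \<kappa> x ` S) = emb \<kappa> x ` frontier S"
proof -
  have "closure (emb \<kappa> x ` S) = emb \<kappa> x ` closure S"
    unfolding closure_interior using bij_image_Compl_eq[OF bij_emb] interior_emb by metis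
  then show ?thesis unfolding frontier_def interior_emb by (simp add: image_set_diff[OF inj_emb])
qed

lemma closed_segment_emb: "emb \<kappa> x ` closed_segment a b = closed_segment (emb \<kappa> x a) (emb \<kappa> x b)"
  unfolding closed_segment_image_interval image_image emb_affine ..

lemma open_segment_emb: "emb \<kappa> x ` open_segment a b = open_segment (emb \<kappa> x a) (emb \<kappa> x b)"
  unfolding open_segment_def image_set_diff[OF inj_emb] closed_segment_emb by simp

lemma polygon_emb:
  assumes P: "simple_polygon P E" and R: "reflex_vertices P E = {x}"
  shows "polygon (emb \<kappa> x ` P) ((`) (emb \<kappa> x) ` E) (emb \<kappa> x ` edge_endpoints E) 0"
proof
  note P' = P[unfolded simple_polygon_def Jordan_curve_def]
  have cl: "closed P" using P' compact_imp_closed by blast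
  show "compact (emb \<kappa> x ` P)" by (rule compact_continuous_image[OF continuous_emb]) (use P' in blast)
  show "interior (emb \<kappa> x ` P) \<noteq> {}" unfolding interior_emb using P' by blast
  obtain g :: "real \<Rightarrow> plane" where g: "simple_path g" "pathfinish g = pathstart g" "path_image g = frontier P" using P' by blast
  show "\<exists>g :: real \<Rightarrow> complex. simple_path g \<and> pathfinish g = pathstart g \<and> path_image g = frontier (emb \<kappa> x ` P)"
  proof (intro exI conjI)
    show "simple_path (emb \<kappa> x \<circ> g)"
      by (rule simple_path_continuous_image[OF g(1) continuous_emb]) (rule inj_on_subset[OF inj_emb], simp)
    show "pathfinish (emb \<kappa> x \<circ> g) = pathstart (emb \<kappa> x \<circ> g)" using g(2) by (simp add: pathfinish_compose pathstart_compose)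
    show "path_image (emb \<kappa> x \<circ> g) = frontier (emb \<kappa> x ` P)" unfolding frontier_emb g(3)[symmetric] by (rule path_image_compose)
  qed
  show "finite ((`) (emb \<kappa> x) ` E)" using P' by blast
  show "\<exists>a b. a \<noteq> b \<and> e = closed_segment a b" if e: "e \<in> (`) (emb \<kappa> x) ` E" for e
  proof -
    obtain e' where e': "e = emb \<kappa> x ` e'" "e' \<in> E" using e by blast
    then obtain a b where "a \<noteq> b" "e' = closed_segment a b" using P' unfolding segments_def by blast
    then show ?thesis using e'(1) closed_segment_emb inj_emb[of x] by (metis injD)
  qed
  show "\<Union> ((`) (emb \<kappa> x) ` E) = frontier (emb \<kappa> x ` P)"
  proof -
    have "\<Union> ((`) (emb \<kappa> x) ` E) = emb \<kappa> x ` \<Union>E" by blast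
    then show ?thesis unfolding frontier_emb using P' by simp
  qed
  show "emb \<kappa> x ` edge_endpoints E = {a. \<exists>b. a \<noteq> b \<and> closed_segment a b \<in> (`) (emb \<kappa> x) ` E}"
  proof (intro equalityI subsetI)
    fix w assume "w \<in> emb \<kappa> x ` edge_endpoints E"
    then obtain a b where ab: "w = emb \<kappa> x a" "a \<noteq> b" "closed_segment a b \<in> E" by (auto simp: edge_endpoints_def)
    have "closed_segment w (emb \<kappa> x b) \<in> (`) (emb \<kappa> x) ` E" unfolding ab(1) closed_segment_emb[symmetric] using ab(3) by blast
    moreover have "w \<noteq> emb \<kappa> x b" using ab(1,2) inj_emb[of x] by (simp add: inj_eq)
    ultimately show "w \<in> {a. \<exists>b. a \<noteq> b \<and> closed_segment a b \<in> (`) (emb \<kappa> x) ` E}" by blast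
  next
    fix w assume "w \<in> {a. \<exists>b. a \<noteq> b \<and> closed_segment a b \<in> (`) (emb \<kappa> x) ` E}"
    then obtain w' e where w: "closed_segment w w' = emb \<kappa> x ` e" "e \<in> E" by blast
    obtain a b where ab: "a \<noteq> b" "e = closed_segment a b" using w(2) P' unfolding segments_def by blast
    have "closed_segment w w' = closed_segment (emb \<kappa> x a) (emb \<kappa> x b)" using w(1) ab(2) closed_segment_emb by simp
    then have "w = emb \<kappa> x a \<or> w = emb \<kappa> x b" by (auto simp: doubleton_eq_iff)
    moreover have "a \<in> edge_endpoints E" "b \<in> edge_endpoints E"
      using w(2) ab closed_segment_commute[of a b] unfolding edge_endpoints_def mem_Collect_eq by metis+
    ultimately show "w \<in> emb \<kappa> x ` edge_endpoints E" by blast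
  qed
  have xR: "x \<in> edge_endpoints E" "interior_angle P x > pi" using R unfolding reflex_vertices_def by blast+
  show "0 \<in> emb \<kappa> x ` edge_endpoints E" using xR(1) emb_apex[of \<kappa> x] by (metis imageI)
  have mem: "emb \<kappa> x v + t *\<^sub>R w \<in> emb \<kappa> x ` P \<longleftrightarrow> v + t *\<^sub>R unlin \<kappa> w \<in> P" for v t w
  proof -
    have "emb \<kappa> x v + t *\<^sub>R w = emb \<kappa> x (v + t *\<^sub>R unlin \<kappa> w)" by (simp add: emb_add lin_unlin)
    then show ?thesis by (simp add: inj_image_mem_iff[OF inj_emb])
  qed
  have inn: "w \<bullet> z = unlin \<kappa> w \<bullet> unlin \<kappa> z" for w z using lin_inner[of "unlin \<kappa> w" "unlin \<kappa> z"] by (simp add: lin_unlin)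
  have unz: "unlin \<kappa> w = 0 \<longleftrightarrow> w = 0" for w using lin_unlin[of w] by (auto simp: unlin_def lin_def complex_eq_iff vec_eq_iff forall_2)
  show "\<exists>z. 0 \<le> u \<bullet> z \<and> z \<noteq> 0 \<and> \<not> (\<exists>\<delta>>0. \<forall>t. 0 < t \<and> t < \<delta> \<longrightarrow> v + t *\<^sub>R z \<in> emb \<kappa> x ` P)"
    if v: "v \<in> emb \<kappa> x ` edge_endpoints E" "v \<noteq> 0" "u \<noteq> 0" for v u
  proof (rule ccontr)
    assume no: "\<not> ?thesis"
    obtain v' where v': "v = emb \<kappa> x v'" "v' \<in> edge_endpoints E" using v(1) by blast
    have "pi \<le> interior_angle P v'"
    proof (rule half_plane_angle_ge[OF cl])
      show "unlin \<kappa> u \<noteq> 0" using v(3) unz by simp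
      fix z assume z: "0 \<le> unlin \<kappa> u \<bullet> z" "z \<noteq> 0"
      have "0 \<le> u \<bullet> lin \<kappa> z" using z(1) inn[of u "lin \<kappa> z"] by (simp add: unlin_lin)
      moreover have "lin \<kappa> z \<noteq> 0" using z(2) unz[of "lin \<kappa> z"] by (simp add: unlin_lin)
      ultimately have "\<exists>\<delta>>0. \<forall>t. 0 < t \<and> t < \<delta> \<longrightarrow> v + t *\<^sub>R lin \<kappa> z \<in> emb \<kappa> x ` P" using no by blast
      then show "enters P v' z" unfolding enters_def v'(1) mem unlin_lin .
    qed
    moreover have "interior_angle P v' \<noteq> pi" using P' v'(2) by blast
    ultimately have "v' \<in> reflex_vertices P E" using v'(2) by (simp add: reflex_vertices_def)
    then show False using R v(2) v'(1) by simp
  qed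
  show "\<exists>z. u \<bullet> z < 0 \<and> (\<exists>\<delta>>0. \<forall>t. 0 < t \<and> t < \<delta> \<longrightarrow> 0 + t *\<^sub>R z \<in> emb \<kappa> x ` P)" if u: "u \<noteq> 0" for u
  proof (rule ccontr)
    assume no: "\<not> ?thesis"
    have "interior_angle P x \<le> pi"
    proof (rule half_plane_angle_le[OF cl])
      show "unlin \<kappa> u \<noteq> 0" using u unz by simp
      fix z assume "enters P x z"
      then have "\<exists>\<delta>>0. \<forall>t. 0 < t \<and> t < \<delta> \<longrightarrow> 0 + t *\<^sub>R lin \<kappa> z \<in> emb \<kappa> x ` P"
        unfolding enters_def using mem[of x _ "lin \<kappa> z"] by (simp add: unlin_lin)
      then have "0 \<le> u \<bullet> lin \<kappa> z" using no by (meson not_le)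
      then show "0 \<le> unlin \<kappa> u \<bullet> z" using inn[of u "lin \<kappa> z"] by (simp add: unlin_lin)
    qed
    then show False using xR(2) by simp
  qed
qed

end

text \<open>The isometry is used twice: without rotation to find a direction that avoids the polygon, and then
  with the rotation that takes this direction to the positive real axis.\<close>

lemma axis_polygon_emb:
  assumes P: "simple_polygon P E" and R: "reflex_vertices P E = {x}"
  shows "\<exists>\<kappa>. norm \<kappa> = 1 \<and> axis_polygon (emb \<kappa> x ` P) ((`) (emb \<kappa> x) ` E) (emb \<kappa> x ` edge_endpoints E)"
proof -
  interpret one: polygon "emb 1 x ` P" "(`) (emb 1 x) ` E" "emb 1 x ` edge_endpoints E" 0
    by (rule polygon_emb[OF _ P R]) simp
  obtain e where e: "norm e = 1" "\<And>t. 0 < t \<Longrightarrow> t *\<^sub>R e \<notin> emb 1 x ` P" using one.excluded_direction by auto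
  define \<kappa> where "\<kappa> = cnj e"
  have \<kappa>: "norm \<kappa> = 1" using e(1) by (simp add: \<kappa>_def)
  interpret polygon "emb \<kappa> x ` P" "(`) (emb \<kappa> x) ` E" "emb \<kappa> x ` edge_endpoints E" 0
    by (rule polygon_emb[OF \<kappa> P R])
  have "complex_of_real t \<notin> emb \<kappa> x ` P" if t: "0 < t" for t
  proof
    assume "complex_of_real t \<in> emb \<kappa> x ` P"
    then obtain v where v: "v \<in> P" "complex_of_real t = cnj e * emb 1 x v" by (auto simp: emb_def lin_def \<kappa>_def)
    have "e * complex_of_real t = (e * cnj e) * emb 1 x v" using v(2) by (simp add: mult.assoc)
    then have "t *\<^sub>R e = emb 1 x v" using cnj_unit(2)[OF e(1)] by (simp add: scaleR_conv_of_real mult.commute)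
    then show False using e(2)[OF t] v(1) by blast
  qed
  then have "axis_polygon (emb \<kappa> x ` P) ((`) (emb \<kappa> x) ` E) (emb \<kappa> x ` edge_endpoints E)"
    by unfold_locales
  then show ?thesis using \<kappa> by blast
qed

section \<open>Labelling the vertices by angle\<close>

lemma (in axis_polygon) labelling:
  "\<exists>(vs :: int \<Rightarrow> complex) m. 0 \<le> m \<and> bij_betw vs {0..m} X \<and> vs 0 = 0 \<and>
    (\<forall>i j. 1 \<le> i \<and> i < j \<and> j \<le> m \<longrightarrow> Arg2pi (vs i) < Arg2pi (vs j))"
proof -
  define Y where "Y = X - {0}"
  have inj: "inj_on Arg2pi Y" by (rule inj_onI) (use Arg_inj in \<open>auto simp: Y_def\<close>)
  have finY: "finite Y" using finite_X by (simp add: Y_def)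
  define L where "L = sorted_list_of_set (Arg2pi ` Y)"
  have L: "set L = Arg2pi ` Y" "sorted_wrt (<) L" "length L = card Y"
    using finY card_image[OF inj] by (simp_all add: L_def strict_sorted_list_of_set)
  define m where "m = int (card Y)"
  define vs where "vs i = (if i \<le> 0 then 0 else the_inv_into Y Arg2pi (L ! nat (i - 1)))" for i :: int
  have ith: "vs i \<in> Y \<and> Arg2pi (vs i) = L ! nat (i - 1)" if "1 \<le> i" "i \<le> m" for i
  proof -
    have "nat (i - 1) < length L" using that L(3) by (simp add: m_def)
    then have "L ! nat (i - 1) \<in> Arg2pi ` Y" using L(1) nth_mem by blast
    moreover have "vs i = the_inv_into Y Arg2pi (L ! nat (i - 1))" using that by (simp add: vs_def)
    ultimately show ?thesis using the_inv_into_into[OF inj] f_the_inv_into_f[OF inj] by simp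
  qed
  have less: "Arg2pi (vs i) < Arg2pi (vs j)" if "1 \<le> i" "i < j" "j \<le> m" for i j
  proof -
    have "nat (i - 1) < nat (j - 1)" "nat (j - 1) < length L" using that L(3) by (simp_all add: m_def)
    then have "L ! nat (i - 1) < L ! nat (j - 1)" using L(2) sorted_wrt_nth_less by blast
    then show ?thesis using ith[of i] ith[of j] that by simp
  qed
  have vs0: "vs 0 = 0" by (simp add: vs_def)
  have "inj_on vs {0..m}"
  proof (rule inj_onI)
    fix i j assume ij: "i \<in> {0..m}" "j \<in> {0..m}" "vs i = vs j"
    have z: "vs k \<noteq> 0" if "1 \<le> k" "k \<le> m" for k using ith[OF that] by (simp add: Y_def)
    show "i = j"
    proof (cases "i = 0 \<or> j = 0")
      case True then show ?thesis using ij vs0 z[of i] z[of j] by (cases "i = 0"; cases "j = 0") auto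
    next
      case False
      then show ?thesis using less[of i j] less[of j i] ij by (cases i j rule: linorder_cases) auto
    qed
  qed
  moreover have "vs ` {0..m} = X"
  proof
    show "vs ` {0..m} \<subseteq> X"
    proof
      fix v assume "v \<in> vs ` {0..m}"
      then obtain i where i: "v = vs i" "0 \<le> i" "i \<le> m" by auto
      show "v \<in> X"
      proof (cases "i = 0")
        case True then show ?thesis using i vs0 zero_X by simp
      next
        case False then show ?thesis using ith[of i] i by (simp add: Y_def)
      qed
    qed
    show "X \<subseteq> vs ` {0..m}"
    proof
      fix v assume v: "v \<in> X"
      show "v \<in> vs ` {0..m}"
      proof (cases "v = 0")
        case True then show ?thesis using vs0 by (intro rev_image_eqI[of 0]) (auto simp: m_def)
      next
        case False
        then have vY: "v \<in> Y" using v by (simp add: Y_def)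
        then have "Arg2pi v \<in> set L" using L(1) by blast
        then obtain k where k: "k < length L" "L ! k = Arg2pi v" by (auto simp: in_set_conv_nth)
        have r: "1 \<le> int k + 1" "int k + 1 \<le> m" using k(1) L(3) by (simp_all add: m_def)
        have "Arg2pi (vs (int k + 1)) = Arg2pi v" "vs (int k + 1) \<in> Y" using ith[OF r] k(2) by simp_all
        then have "vs (int k + 1) = v" using inj vY by (simp add: inj_on_def)
        then show ?thesis using r by (intro rev_image_eqI[of "int k + 1"]) auto
      qed
    qed
  qed
  ultimately have "bij_betw vs {0..m} X" by (simp add: bij_betw_def)
  moreover have "0 \<le> m" by (simp add: m_def)
  ultimately show ?thesis using vs0 less by blast
qed

text \<open>Label \<open>0\<close> is the apex, the others are sorted by argument.\<close>

locale labelled = axis_polygon Q E X for Q E X +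
  fixes vs :: "int \<Rightarrow> complex" and m :: int
  assumes m0: "0 \<le> m" and bij: "bij_betw vs {0..m} X" and vs0: "vs 0 = 0"
    and vs_less: "1 \<le> i \<Longrightarrow> i < j \<Longrightarrow> j \<le> m \<Longrightarrow> Arg2pi (vs i) < Arg2pi (vs j)"
begin

definition chords :: "(int \<times> int) set" where
  "chords = {(i, j). 0 \<le> i \<and> i < j \<and> j \<le> m \<and> (i = 0 \<or> Arg2pi (vs j) < Arg2pi (vs i) + pi)}"

lemma vs_X: "0 \<le> i \<Longrightarrow> i \<le> m \<Longrightarrow> vs i \<in> X"
  using bij by (auto simp: bij_betw_def)

lemma vs_eq: "0 \<le> i \<Longrightarrow> i \<le> m \<Longrightarrow> 0 \<le> j \<Longrightarrow> j \<le> m \<Longrightarrow> vs i = vs j \<longleftrightarrow> i = j"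
  using bij by (auto simp: bij_betw_def inj_on_eq_iff)

lemma vs_nonzero: "1 \<le> i \<Longrightarrow> i \<le> m \<Longrightarrow> vs i \<noteq> 0"
  using vs_eq[of i 0] vs0 m0 by auto

lemma vs_range: "v \<in> X \<Longrightarrow> \<exists>i. 0 \<le> i \<and> i \<le> m \<and> v = vs i"
  using bij by (auto simp: bij_betw_def)

lemma th_range: "1 \<le> i \<Longrightarrow> i \<le> m \<Longrightarrow> 0 < Arg2pi (vs i) \<and> Arg2pi (vs i) < 2 * pi"
  using Arg_pos[OF X_Q[OF vs_X] vs_nonzero] Arg2pi_lt_2pi by simp

lemma th_le: "1 \<le> i \<Longrightarrow> i \<le> j \<Longrightarrow> j \<le> m \<Longrightarrow> Arg2pi (vs i) \<le> Arg2pi (vs j)"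
  using vs_less[of i j] by (cases "i = j") auto

lemma chord_segment:
  assumes "0 \<le> i" "i < j" "j \<le> m"
  shows "closed_segment (vs i) (vs j) \<subseteq> Q \<and> open_segment (vs i) (vs j) \<inter> X = {} \<longleftrightarrow> (i, j) \<in> chords"
proof (cases "i = 0")
  case True
  then show ?thesis using spoke[of "vs j"] vs_X[of j] vs_nonzero[of j] assms vs0 by (simp add: chords_def)
next
  case False
  then show ?thesis
    using chord_iff[of "vs i" "vs j"] vs_X[of i] vs_X[of j] vs_nonzero[of i] vs_nonzero[of j] vs_less[of i j] assms
    by (simp add: chords_def)
qed

lemma spoke_range:
  assumes "z \<in> open_segment (vs 0) (vs j)" "1 \<le> j" "j \<le> m" shows "z \<noteq> 0 \<and> Arg2pi z = Arg2pi (vs j)"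
  using spoke_Arg[of z "vs j"] assms vs0 by simp

lemma chord_range:
  assumes "(i, j) \<in> chords" "i \<noteq> 0" "z \<in> open_segment (vs i) (vs j)"
  shows "z \<noteq> 0 \<and> Arg2pi (vs i) < Arg2pi z \<and> Arg2pi z < Arg2pi (vs j)"
proof -
  have ij: "1 \<le> i" "i < j" "j \<le> m" "Arg2pi (vs j) < Arg2pi (vs i) + pi" using assms by (auto simp: chords_def)
  show ?thesis
    using open_segment_Arg[OF vs_nonzero[of i] vs_nonzero[of j] vs_less[of i j] ij(4) assms(3)] ij by simp
qed

lemma crosses_meet:
  assumes "(i, j) \<in> chords" "(k, l) \<in> chords" "i < k" "k < j" "j < l"
  shows "open_segment (vs i) (vs j) \<inter> open_segment (vs k) (vs l) \<noteq> {}"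
proof -
  have kl: "1 \<le> k" "j \<le> m" "1 \<le> j" "l \<le> m" "Arg2pi (vs l) < Arg2pi (vs k) + pi" "0 \<le> i" using assms by (auto simp: chords_def)
  note X = vs_X[of k] vs_X[of j] vs_X[of l] vs_nonzero[of k] vs_nonzero[of j] vs_nonzero[of l] vs_less[of k j] vs_less[of j l]
  show ?thesis
  proof (cases "i = 0")
    case True
    show ?thesis unfolding True vs0
      by (rule spoke_meets_chord) (use X kl assms in simp_all)
  next
    case False
    then have i: "1 \<le> i" "Arg2pi (vs j) < Arg2pi (vs i) + pi" using assms by (auto simp: chords_def)
    show ?thesis
      by (rule chords_meet) (use X kl i assms vs_X[of i] vs_nonzero[of i] vs_less[of i k] in simp_all)
  qed
qed

lemma noncrossing_disjoint:
  assumes "(i, j) \<in> chords" "(k, l) \<in> chords" "(i, j) \<noteq> (k, l)" "j \<le> k \<or> i \<le> k \<and> l \<le> j"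
  shows "open_segment (vs i) (vs j) \<inter> open_segment (vs k) (vs l) = {}"
proof (rule equals0I)
  fix z assume "z \<in> open_segment (vs i) (vs j) \<inter> open_segment (vs k) (vs l)"
  then have z: "z \<in> open_segment (vs i) (vs j)" "z \<in> open_segment (vs k) (vs l)" by auto
  have r: "0 \<le> i" "i < j" "j \<le> m" "0 \<le> k" "k < l" "l \<le> m" using assms by (auto simp: chords_def)
  show False
  proof (cases "i = 0")
    case True
    have zj: "Arg2pi z = Arg2pi (vs j)" using spoke_range[of z j] z(1) r True by simp
    show False
    proof (cases "k = 0")
      case True
      then have "Arg2pi z = Arg2pi (vs l)" "l \<noteq> j" using spoke_range[of z l] z(2) r assms(3) \<open>i = 0\<close> by auto
      then show False using zj vs_less[of l j] vs_less[of j l] r by (cases l j rule: linorder_cases) auto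
    next
      case False
      then show False using chord_range[OF assms(2) False z(2)] zj assms(4) th_le[of j k] th_le[of l j] r \<open>i = 0\<close> by auto
    qed
  next
    case False
    note zi = chord_range[OF assms(1) False z(1)]
    have k0: "k \<noteq> 0" using assms(4) False r by auto
    note zk = chord_range[OF assms(2) k0 z(2)]
    show False
    proof (cases "j \<le> k")
      case True
      then show False using zi zk th_le[of j k] r by auto
    next
      case nest: False
      then have n: "i \<le> k" "l \<le> j" using assms(4) by auto
      have "Arg2pi (vs j) < Arg2pi (vs i) + pi" using assms(1) False by (auto simp: chords_def)
      moreover have "(vs i, vs j) \<noteq> (vs k, vs l)" using assms(3) vs_eq[of i k] vs_eq[of j l] r by auto
      ultimately have "open_segment (vs i) (vs j) \<inter> open_segment (vs k) (vs l) = {}"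
        by (intro nested_disjoint)
          (use vs_X vs_nonzero th_le[of i k] vs_less[of k l] th_le[of l j] n r False k0 in simp_all)
      then show False using z by blast
    qed
  qed
qed

lemma meet_iff:
  assumes "(i, j) \<in> chords" "(k, l) \<in> chords" "(i, j) \<noteq> (k, l)"
  shows "open_segment (vs i) (vs j) \<inter> open_segment (vs k) (vs l) \<noteq> {} \<longleftrightarrow> i < k \<and> k < j \<and> j < l \<or> k < i \<and> i < l \<and> l < j"
proof -
  have r: "i < j" "k < l" using assms by (auto simp: chords_def)
  have sym: "open_segment (vs k) (vs l) \<inter> open_segment (vs i) (vs j) = open_segment (vs i) (vs j) \<inter> open_segment (vs k) (vs l)" by blast
  have ne: "(k, l) \<noteq> (i, j)" by (rule not_sym[OF assms(3)])
  consider "i < k \<and> k < j \<and> j < l" | "k < i \<and> i < l \<and> l < j" | "j \<le> k \<or> i \<le> k \<and> l \<le> j" | "l \<le> i \<or> k \<le> i \<and> j \<le> l" by linarith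
  then show ?thesis
  proof cases
    case 1 then show ?thesis using crosses_meet[OF assms(1,2)] by blast
  next
    case 2 then show ?thesis using crosses_meet[OF assms(2,1)] sym by blast
  next
    case 3
    then have "\<not> (i < k \<and> k < j \<and> j < l \<or> k < i \<and> i < l \<and> l < j)" using r by auto
    then show ?thesis using noncrossing_disjoint[OF assms 3] by blast
  next
    case 4
    then have "\<not> (i < k \<and> k < j \<and> j < l \<or> k < i \<and> i < l \<and> l < j)" using r by auto
    then show ?thesis using noncrossing_disjoint[OF assms(2,1) ne 4] sym by blast
  qed
qed

text \<open>The number of vertices in the open half-plane to the left of the direction \<open>\<alpha>\<close>.\<close>

definition count :: "real \<Rightarrow> int" where
  "count \<alpha> = int (card {z \<in> X. 0 < cr (cis \<alpha>) z})"

lemma card_label: "card {z \<in> X. 0 < cr (cis \<alpha>) z} = card {i \<in> {1..m}. 0 < sin (Arg2pi (vs i) - \<alpha>)}"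
proof -
  have sgn: "0 < cr (cis \<alpha>) z \<longleftrightarrow> z \<noteq> 0 \<and> 0 < sin (Arg2pi z - \<alpha>)" for z
  proof -
    have "cr (cis \<alpha>) z = cr (1 *\<^sub>R cis \<alpha>) (norm z *\<^sub>R cis (Arg2pi z))" 
      by (simp only: scaleR_one polar[symmetric])
    then have "cr (cis \<alpha>) z = norm z * sin (Arg2pi z - \<alpha>)" unfolding cr_cis by simp
    then show ?thesis by (cases "z = 0") (auto simp: zero_less_mult_iff)
  qed
  have "{z \<in> X. 0 < cr (cis \<alpha>) z} = vs ` {i \<in> {1..m}. 0 < sin (Arg2pi (vs i) - \<alpha>)}"
  proof (intro equalityI subsetI)
    fix z assume "z \<in> {z \<in> X. 0 < cr (cis \<alpha>) z}"
    then have z: "z \<in> X" "z \<noteq> 0" "0 < sin (Arg2pi z - \<alpha>)" using sgn by auto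
    obtain i where i: "0 \<le> i" "i \<le> m" "z = vs i" using vs_range[OF z(1)] by blast
    have "i \<noteq> 0" using z(2) i vs0 by auto
    then show "z \<in> vs ` {i \<in> {1..m}. 0 < sin (Arg2pi (vs i) - \<alpha>)}" using i z(3) by auto
  next
    fix z assume "z \<in> vs ` {i \<in> {1..m}. 0 < sin (Arg2pi (vs i) - \<alpha>)}"
    then show "z \<in> {z \<in> X. 0 < cr (cis \<alpha>) z}" using vs_X vs_nonzero sgn by auto
  qed
  moreover have "inj_on vs {i \<in> {1..m}. 0 < sin (Arg2pi (vs i) - \<alpha>)}"
    using bij unfolding bij_betw_def by (elim conjE inj_on_subset) auto
  ultimately show ?thesis by (simp add: card_image)
qed

lemma count_cuts:
  fixes LT LE :: "real \<Rightarrow> int"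
  assumes LT: "\<And>x. 0 \<le> LT x \<and> LT x \<le> m" "\<And>x i. 1 \<le> i \<Longrightarrow> i \<le> m \<Longrightarrow> Arg2pi (vs i) < x \<longleftrightarrow> i \<le> LT x"
    and LE: "\<And>x. 0 \<le> LE x \<and> LE x \<le> m" "\<And>x i. 1 \<le> i \<Longrightarrow> i \<le> m \<Longrightarrow> Arg2pi (vs i) \<le> x \<longleftrightarrow> i \<le> LE x"
    and a: "0 \<le> \<alpha>" "\<alpha> \<le> pi"
  shows "count \<alpha> = LT (\<alpha> + pi) - LE \<alpha>" "count (\<alpha> + pi) = LT \<alpha> + (m - LE (\<alpha> + pi))"
proof -
  have cut1: "LE x \<le> LT y" if "x < y" for x y
  proof (cases "LE x = 0")
    case False
    then have l: "1 \<le> LE x" "LE x \<le> m" using LE(1)[of x] by auto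
    then have "Arg2pi (vs (LE x)) \<le> x" using LE(2) by blast
    then have "Arg2pi (vs (LE x)) < y" using that by linarith
    then show ?thesis using LT(2)[OF l] by blast
  qed (use LT(1) in simp)
  have cut2: "LT x \<le> LE y" if "x \<le> y" for x y
  proof (cases "LT x = 0")
    case False
    then have l: "1 \<le> LT x" "LT x \<le> m" using LT(1)[of x] by auto
    then have "Arg2pi (vs (LT x)) < x" using LT(2) by blast
    then have "Arg2pi (vs (LT x)) \<le> y" using that by linarith
    then show ?thesis using LE(2)[OF l] by blast
  qed (use LE(1) in simp)
  have s: "0 < sin (\<theta> - \<alpha>) \<longleftrightarrow> \<alpha> < \<theta> \<and> \<theta> < \<alpha> + pi" if t: "0 < \<theta>" "\<theta> < 2 * pi" for \<theta>
  proof
    assume "\<alpha> < \<theta> \<and> \<theta> < \<alpha> + pi" then show "0 < sin (\<theta> - \<alpha>)" by (intro sin_gt_zero) auto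
  next
    assume p: "0 < sin (\<theta> - \<alpha>)"
    show "\<alpha> < \<theta> \<and> \<theta> < \<alpha> + pi"
    proof (rule ccontr)
      assume n: "\<not> ?thesis"
      show False
      proof (cases "\<theta> \<le> \<alpha>")
        case True then show False using sin_nonpos[of "\<theta> - \<alpha>"] p t a by auto
      next
        case False then show False using sin_le_zero[of "\<theta> - \<alpha>"] p t a n by auto
      qed
    qed
  qed
  have s': "0 < sin (\<theta> - (\<alpha> + pi)) \<longleftrightarrow> \<theta> < \<alpha> \<or> \<alpha> + pi < \<theta>" if t: "0 < \<theta>" "\<theta> < 2 * pi" for \<theta>
  proof -
    have e: "sin (\<theta> - (\<alpha> + pi)) = - sin (\<theta> - \<alpha>)" using sin_minus_pi[of "\<theta> - \<alpha>"] by (simp add: algebra_simps)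
    show ?thesis unfolding e
    proof
      assume "\<theta> < \<alpha> \<or> \<alpha> + pi < \<theta>"
      then show "0 < - sin (\<theta> - \<alpha>)" using sin_neg[of "\<theta> - \<alpha>"] sin_lt_zero[of "\<theta> - \<alpha>"] t a by auto
    next
      assume p: "0 < - sin (\<theta> - \<alpha>)"
      show "\<theta> < \<alpha> \<or> \<alpha> + pi < \<theta>"
      proof (rule ccontr)
        assume "\<not> (\<theta> < \<alpha> \<or> \<alpha> + pi < \<theta>)"
        then have "0 \<le> \<theta> - \<alpha>" "\<theta> - \<alpha> \<le> pi" by linarith+
        then show False using sin_ge_zero[of "\<theta> - \<alpha>"] p by simp
      qed
    qed
  qed
  have "i \<in> {i \<in> {1..m}. 0 < sin (Arg2pi (vs i) - \<alpha>)} \<longleftrightarrow> i \<in> {LE \<alpha> + 1..LT (\<alpha> + pi)}" for i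
  proof (cases "1 \<le> i \<and> i \<le> m")
    case True
    then have "0 < sin (Arg2pi (vs i) - \<alpha>) \<longleftrightarrow> \<not> Arg2pi (vs i) \<le> \<alpha> \<and> Arg2pi (vs i) < \<alpha> + pi"
      using s[of "Arg2pi (vs i)"] th_range[of i] by (simp add: not_le)
    also have "\<dots> \<longleftrightarrow> \<not> i \<le> LE \<alpha> \<and> i \<le> LT (\<alpha> + pi)" using LT(2)[of i] LE(2)[of i] True by simp
    finally show ?thesis using True by auto
  next
    case False then show ?thesis using LT(1)[of "\<alpha> + pi"] LE(1)[of \<alpha>] by auto
  qed
  then have "{i \<in> {1..m}. 0 < sin (Arg2pi (vs i) - \<alpha>)} = {LE \<alpha> + 1..LT (\<alpha> + pi)}" by blast
  then have "count \<alpha> = int (card {LE \<alpha> + 1..LT (\<alpha> + pi)})" unfolding count_def card_label by simp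
  then show "count \<alpha> = LT (\<alpha> + pi) - LE \<alpha>" using cut1[of \<alpha> "\<alpha> + pi"] by simp
  have "i \<in> {i \<in> {1..m}. 0 < sin (Arg2pi (vs i) - (\<alpha> + pi))} \<longleftrightarrow> i \<in> {1..LT \<alpha>} \<union> {LE (\<alpha> + pi) + 1..m}" for i
  proof (cases "1 \<le> i \<and> i \<le> m")
    case True
    then have "0 < sin (Arg2pi (vs i) - (\<alpha> + pi)) \<longleftrightarrow> Arg2pi (vs i) < \<alpha> \<or> \<not> Arg2pi (vs i) \<le> \<alpha> + pi"
      using s'[of "Arg2pi (vs i)"] th_range[of i] by (simp add: not_le)
    also have "\<dots> \<longleftrightarrow> i \<le> LT \<alpha> \<or> \<not> i \<le> LE (\<alpha> + pi)" using LT(2)[of i] LE(2)[of i] True by simp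
    finally show ?thesis using True by auto
  next
    case False then show ?thesis using LT(1)[of \<alpha>] LE(1)[of "\<alpha> + pi"] by auto
  qed
  then have "{i \<in> {1..m}. 0 < sin (Arg2pi (vs i) - (\<alpha> + pi))} = {1..LT \<alpha>} \<union> {LE (\<alpha> + pi) + 1..m}" by blast
  moreover have "card ({1..LT \<alpha>} \<union> {LE (\<alpha> + pi) + 1..m}) = card {1..LT \<alpha>} + card {LE (\<alpha> + pi) + 1..m}"
    by (rule card_Un_disjoint) (use cut2[of \<alpha> "\<alpha> + pi"] in auto)
  ultimately have "count (\<alpha> + pi) = int (card {1..LT \<alpha>} + card {LE (\<alpha> + pi) + 1..m})" unfolding count_def card_label by simp
  then show "count (\<alpha> + pi) = LT \<alpha> + (m - LE (\<alpha> + pi))" using LT(1)[of \<alpha>] LE(1)[of "\<alpha> + pi"] by simp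
qed

end

section \<open>Triangulations and the flip graph\<close>

lemma vwalk_arcs_nth: "set (vwalk_arcs p) = {(p ! i, p ! Suc i) | i. Suc i < length p}"
proof (induction p rule: vwalk_arcs.induct)
  case (3 x y xs)
  have "{(( x # y # xs) ! i, (x # y # xs) ! Suc i) | i. Suc i < length (x # y # xs)} =
    insert (x, y) {((y # xs) ! i, (y # xs) ! Suc i) | i. Suc i < length (y # xs)}" (is "?L = insert _ ?R")
  proof (intro equalityI subsetI)
    fix e assume "e \<in> ?L"
    then obtain i where i: "e = ((x # y # xs) ! i, (x # y # xs) ! Suc i)" "Suc i < length (x # y # xs)" by blast
    show "e \<in> insert (x, y) ?R" using i by (cases i) auto
  next
    fix e assume "e \<in> insert (x, y) ?R"
    then show "e \<in> ?L"
    proof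
      assume "e = (x, y)" then show ?thesis by (auto intro!: exI[of _ 0])
    next
      assume "e \<in> ?R"
      then obtain i where "e = ((y # xs) ! i, (y # xs) ! Suc i)" "Suc i < length (y # xs)" by blast
      then show ?thesis by (auto intro!: exI[of _ "Suc i"])
    qed
  qed
  then show ?case using 3 by simp
qed auto

lemma arcs_ends_flip_graph:
  "arcs_ends (flip_graph P X) = {(S, T). S \<in> triangulations P X \<and> T \<in> triangulations P X \<and> flip S T}"
  by (auto simp: arcs_ends_def arc_to_ends_def flip_graph_def)

lemma vwalk_flip_graph:
  "vwalk p (flip_graph P X) \<longleftrightarrow> p \<noteq> [] \<and> (\<forall>i < length p. p ! i \<in> triangulations P X) \<and>
     (\<forall>i. Suc i < length p \<longrightarrow> flip (p ! i) (p ! Suc i))"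
proof -
  have v: "verts (flip_graph P X) = triangulations P X" by (simp add: flip_graph_def)
  have "set p \<subseteq> triangulations P X \<longleftrightarrow> (\<forall>i < length p. p ! i \<in> triangulations P X)"
    by (auto simp: set_conv_nth)
  then show ?thesis unfolding vwalk_def v vwalk_arcs_nth arcs_ends_flip_graph by fastforce
qed

context chord_model begin

context
  fixes S :: "int \<times> int \<Rightarrow> plane set" and P :: "plane set" and X :: "plane set"
  assumes inj: "inj_on S A" and arcs: "arcs_in P X = S ` A"
    and cross: "\<And>e f. e \<in> A \<Longrightarrow> f \<in> A \<Longrightarrow> e \<noteq> f \<Longrightarrow> crossing (S e) (S f) \<longleftrightarrow> crosses e f"
begin

lemma non_crossing_image:
  assumes "T \<subseteq> A" shows "non_crossing (S ` T) \<longleftrightarrow> (\<forall>e\<in>T. \<forall>f\<in>T. \<not> crosses e f)"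
proof -
  have self: "\<not> crosses e e" for e by (auto simp: crosses_def)
  have "non_crossing (S ` T) \<longleftrightarrow> (\<forall>e\<in>T. \<forall>f\<in>T. S e \<noteq> S f \<longrightarrow> \<not> crossing (S e) (S f))"
    unfolding non_crossing_def pairwise_def by blast
  also have "\<dots> \<longleftrightarrow> (\<forall>e\<in>T. \<forall>f\<in>T. \<not> crosses e f)"
  proof (intro ball_cong refl)
    fix e f assume "e \<in> T" "f \<in> T"
    then have A: "e \<in> A" "f \<in> A" using assms by auto
    show "(S e \<noteq> S f \<longrightarrow> \<not> crossing (S e) (S f)) \<longleftrightarrow> \<not> crosses e f"
      using cross[OF A] self[of e] inj_on_eq_iff[OF inj A] by (cases "e = f") auto
  qed
  finally show ?thesis .
qed

text \<open>Distinct arcs cross in the sense of relative interiors exactly when their labels interleave, so maximal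
  non-crossing sets correspond.\<close>

lemma triangulation_iff:
  assumes T: "T \<subseteq> A" shows "S ` T \<in> triangulations P X \<longleftrightarrow> tri T"
proof
  assume h: "S ` T \<in> triangulations P X"
  then have nc: "\<forall>e\<in>T. \<forall>f\<in>T. \<not> crosses e f"
    using non_crossing_image[OF T] by (simp add: triangulations_def)
  have "e \<in> T" if e: "e \<in> A" "\<forall>f\<in>T. \<not> crosses e f" for e
  proof -
    have "\<forall>g\<in>insert e T. \<forall>f\<in>insert e T. \<not> crosses g f"
      using nc e(2) crosses_sym by (metis crosses_def insertE less_irrefl)
    then have "non_crossing (S ` insert e T)" using non_crossing_image[of "insert e T"] T e(1) by blast
    moreover have "S ` insert e T \<subseteq> arcs_in P X" unfolding arcs using T e(1) by blast
    ultimately have "S ` insert e T = S ` T" using h unfolding triangulations_def by blast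
    then have "S e \<in> S ` T" by blast
    then show ?thesis using inj_on_image_mem_iff[OF inj e(1) T] by blast
  qed
  then show "tri T" using T nc by (auto simp: tri_def)
next
  assume h: "tri T"
  have nc: "non_crossing (S ` T)" using h non_crossing_image[OF T] by (auto simp: tri_def)
  have "T' = S ` T" if T': "T' \<subseteq> arcs_in P X" "non_crossing T'" "S ` T \<subseteq> T'" for T'
  proof -
    define U where "U = {e \<in> A. S e \<in> T'}"
    have U: "T' = S ` U" "U \<subseteq> A" using T'(1) unfolding arcs U_def by auto
    have TU: "T \<subseteq> U" using T T'(3) unfolding U_def by auto
    have ncU: "\<forall>e\<in>U. \<forall>f\<in>U. \<not> crosses e f" using T'(2) non_crossing_image[OF U(2)] U(1) by simp
    have "U \<subseteq> T"
    proof
      fix e assume e: "e \<in> U"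
      show "e \<in> T" by (rule tri_maximal[OF h]) (use e U(2) ncU TU in auto)
    qed
    then show ?thesis using U(1) TU by auto
  qed
  moreover have "S ` T \<subseteq> arcs_in P X" unfolding arcs using T by blast
  ultimately show "S ` T \<in> triangulations P X" using nc unfolding triangulations_def by blast
qed

lemma triangulation_image:
  assumes "R \<in> triangulations P X" shows "\<exists>T. T \<subseteq> A \<and> R = S ` T \<and> tri T"
proof -
  have "R \<subseteq> S ` A" using assms arcs by (auto simp: triangulations_def)
  then obtain T where "T \<subseteq> A" "R = S ` T" by (meson subset_imageE)
  then show ?thesis using triangulation_iff assms by blast
qed

lemma flip_iff:
  assumes T: "T \<subseteq> A" "T' \<subseteq> A" shows "flip (S ` T) (S ` T') \<longleftrightarrow> flip_step T T'"
proof
  have minus: "S ` (T - {e}) = S ` T - {S e}" if "e \<in> T" for e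
    using inj_on_image_set_diff[OF inj, of T "{e}"] T that by auto
  {
    assume "flip (S ` T) (S ` T')"
    then obtain e b where e: "e \<in> T" "b \<notin> S ` T" "S ` T' = insert b (S ` T - {S e})" unfolding flip_def by blast
    then obtain f where f: "f \<in> T'" "b = S f" by blast
    have "S ` T' = S ` insert f (T - {e})" using e(3) f(2) minus[OF e(1)] by simp
    then have "T' = insert f (T - {e})" using inj_on_image_eq_iff[OF inj T(2), of "insert f (T - {e})"] T f(1) by blast
    moreover have "f \<notin> T" using e(2) f(2) by blast
    ultimately show "flip_step T T'" unfolding flip_step_def using e(1) by blast
  next
    assume "flip_step T T'"
    then obtain e f where ef: "e \<in> T" "f \<notin> T" "T' = insert f (T - {e})" unfolding flip_step_def by blast
    have "f \<in> A" using ef(3) T(2) by blast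
    then have "S f \<notin> S ` T" using inj_on_image_mem_iff[OF inj _ T(1)] ef(2) by blast
    moreover have "S ` T' = insert (S f) (S ` T - {S e})" unfolding ef(3) using minus[OF ef(1)] by simp
    ultimately show "flip (S ` T) (S ` T')" unfolding flip_def using ef(1) by blast
  }
qed

lemma not_strongly_convex:
  assumes seg: "\<And>e. e \<in> A \<Longrightarrow> S e \<in> segments" and g: "gadget V A ap y"
  shows "\<exists>\<epsilon>\<in>segments. \<not> strongly_convex (flip_subgraph \<epsilon> P X) (flip_graph P X)"
proof -
  interpret gadget V A ap y by (rule g)
  obtain Ts n e where geo: "geodesic_walk Ts n" and e: "e \<in> Ts 0" "e \<in> Ts n" and out: "\<exists>k \<le> n. e \<notin> Ts k"
    using escaping_geodesic by blast
  obtain k where k: "k \<le> n" "e \<notin> Ts k" using out by blast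
  have W: "\<And>k. k \<le> n \<Longrightarrow> tri (Ts k)" "\<And>k. k < n \<Longrightarrow> flip_step (Ts k) (Ts (Suc k))"
    using geo by (auto simp: geodesic_walk_def walk_def)
  have TA: "Ts k \<subseteq> A" if "k \<le> n" for k using W(1)[OF that] by (simp add: tri_def)
  have eA: "e \<in> A" using e(1) TA[of 0] by auto
  define p where "p = map (\<lambda>k. S ` Ts k) [0..<Suc n]"
  have pn: "length p = Suc n" "\<And>k. k \<le> n \<Longrightarrow> p ! k = S ` Ts k" by (auto simp: p_def nth_append simp del: upt_Suc)
  have pne: "p \<noteq> []" using pn(1) by auto
  have hp: "hd p = S ` Ts 0" "last p = S ` Ts n" using pn hd_conv_nth[OF pne] last_conv_nth[OF pne] by auto
  have vp: "vwalk p (flip_graph P X)"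
    unfolding vwalk_flip_graph
  proof (intro conjI allI impI)
    fix i assume "i < length p"
    then show "p ! i \<in> triangulations P X" using pn triangulation_iff[OF TA, of i] W(1)[of i] by simp
  next
    fix i assume "Suc i < length p"
    then show "flip (p ! i) (p ! Suc i)" using pn flip_iff[OF TA TA, of i "Suc i"] W(2)[of i] by simp
  qed (rule pne)
  have "geodesic (flip_graph P X) p"
    unfolding geodesic_def
  proof (intro conjI allI impI vp)
    fix q assume q: "vwalk q (flip_graph P X) \<and> hd q = hd p \<and> last q = last p"
    then have qw: "q \<noteq> []" "\<And>i. i < length q \<Longrightarrow> q ! i \<in> triangulations P X"
      "\<And>i. Suc i < length q \<Longrightarrow> flip (q ! i) (q ! Suc i)" unfolding vwalk_flip_graph by blast+
    define Us where "Us i = (SOME T. T \<subseteq> A \<and> q ! i = S ` T \<and> tri T)" for i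
    have Us: "Us i \<subseteq> A \<and> q ! i = S ` Us i \<and> tri (Us i)" if "i < length q" for i
      unfolding Us_def by (rule someI_ex) (rule triangulation_image[OF qw(2)[OF that]])
    define l where "l = length q - 1"
    have l: "l < length q" "\<And>i. i \<le> l \<Longrightarrow> i < length q" 
    proof -
      have "0 < length q" using qw(1) by simp
      then show "l < length q" "\<And>i. i \<le> l \<Longrightarrow> i < length q" unfolding l_def by linarith+
    qed
    have "walk Us l" unfolding walk_def
    proof (intro conjI allI impI)
      fix i assume "i \<le> l" then show "tri (Us i)" using Us l(2) by blast
    next
      fix i assume "i < l"
      then have i: "i < length q" "Suc i < length q" by (auto simp: l_def)
      show "flip_step (Us i) (Us (Suc i))" using flip_iff[of "Us i" "Us (Suc i)"] Us[OF i(1)] Us[OF i(2)] qw(3)[OF i(2)] by simp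
    qed
    moreover have "Us 0 = Ts 0"
    proof -
      have "S ` Us 0 = S ` Ts 0" using q hp hd_conv_nth[OF qw(1)] Us[of 0] qw(1) by auto
      then show ?thesis using inj_on_image_eq_iff[OF inj] Us[of 0] TA[of 0] qw(1) by auto
    qed
    moreover have "Us l = Ts n"
    proof -
      have "S ` Us l = S ` Ts n" using q hp last_conv_nth[OF qw(1)] Us[OF l(1)] by (simp add: l_def)
      then show ?thesis using inj_on_image_eq_iff[OF inj] Us[OF l(1)] TA[of n] by auto
    qed
    ultimately have "n \<le> l" using geo unfolding geodesic_walk_def by blast
    then show "vwalk_length p \<le> vwalk_length q" using pn(1) by (simp add: l_def)
  qed
  moreover have ends: "hd p \<in> verts (flip_subgraph (S e) P X)" "last p \<in> verts (flip_subgraph (S e) P X)"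
    unfolding flip_subgraph_def hp using triangulation_iff[OF TA] W(1) e by auto
  moreover have "\<not> vwalk p (flip_subgraph (S e) P X)"
  proof
    assume "vwalk p (flip_subgraph (S e) P X)"
    then have "set p \<subseteq> {T. S e \<in> T}" unfolding vwalk_def flip_subgraph_def by auto
    moreover have "S ` Ts k \<in> set p" using pn k(1) by (metis le_imp_less_Suc nth_mem)
    ultimately have "S e \<in> S ` Ts k" by blast
    then show False using inj_on_image_mem_iff[OF inj eA TA[OF k(1)]] k(2) by blast
  qed
  ultimately have "\<not> strongly_convex (flip_subgraph (S e) P X) (flip_graph P X)" unfolding strongly_convex_def by blast
  then show ?thesis using seg[OF eA] by blast
qed

end
end

context labelled begin

lemma chord_model_chords: "chord_model {0..m} chords 0"
proof
  fix a b c d assume h: "(a, d) \<in> chords" "a \<noteq> 0" "a \<le> b" "b < c" "c \<le> d" "b \<in> {0..m}" "c \<in> {0..m}"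
  then have ad: "1 \<le> a" "d \<le> m" "Arg2pi (vs d) < Arg2pi (vs a) + pi" by (auto simp: chords_def)
  have "Arg2pi (vs c) \<le> Arg2pi (vs d)" "Arg2pi (vs a) \<le> Arg2pi (vs b)" using th_le h ad by auto
  then show "(b, c) \<in> chords" using h ad by (auto simp: chords_def)
qed (use m0 in \<open>auto simp: chords_def\<close>)

text \<open>Two opposite half-planes and the line between them cover all vertices, so many vertices force the
  minimum \<open>c\<close> to be large.\<close>

lemma gadget_exists:
  assumes c: "\<And>\<alpha>. c \<le> count \<alpha>" "\<And>\<alpha>. 2 * count \<alpha> \<le> 3 * c" and m: "999 \<le> m"
  shows "\<exists>y. gadget {0..m} chords 0 y"
proof -
  define th where "th i = Arg2pi (vs i)" for i
  have less: "1 \<le> i \<Longrightarrow> i < j \<Longrightarrow> j \<le> m \<Longrightarrow> th i < th j" for i j using vs_less by (simp add: th_def)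
  have "\<exists>k. 0 \<le> k \<and> k \<le> m \<and> (\<forall>i. 1 \<le> i \<and> i \<le> m \<longrightarrow> (th i < x) = (i \<le> k))" for x
    by (rule cut_index[OF less m0]) auto
  then obtain LT where LT: "\<And>x. 0 \<le> LT x \<and> LT x \<le> m \<and> (\<forall>i. 1 \<le> i \<and> i \<le> m \<longrightarrow> (th i < x) = (i \<le> LT x))" by metis
  have "\<exists>k. 0 \<le> k \<and> k \<le> m \<and> (\<forall>i. 1 \<le> i \<and> i \<le> m \<longrightarrow> (th i \<le> x) = (i \<le> k))" for x
    by (rule cut_index[OF less m0]) auto
  then obtain LE where LE: "\<And>x. 0 \<le> LE x \<and> LE x \<le> m \<and> (\<forall>i. 1 \<le> i \<and> i \<le> m \<longrightarrow> (th i \<le> x) = (i \<le> LE x))" by metis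
  have LT': "0 \<le> LT x \<and> LT x \<le> m" "1 \<le> i \<Longrightarrow> i \<le> m \<Longrightarrow> th i < x \<longleftrightarrow> i \<le> LT x" for x i using LT by blast+
  have LE': "0 \<le> LE x \<and> LE x \<le> m" "1 \<le> i \<Longrightarrow> i \<le> m \<Longrightarrow> th i \<le> x \<longleftrightarrow> i \<le> LE x" for x i using LE by blast+
  have cuts: "count \<alpha> = LT (\<alpha> + pi) - LE \<alpha>" "count (\<alpha> + pi) = LT \<alpha> + (m - LE (\<alpha> + pi))"
    if "0 \<le> \<alpha>" "\<alpha> \<le> pi" for \<alpha>
    by (rule count_cuts(1)[of LT LE \<alpha>] count_cuts(2)[of LT LE \<alpha>]; use LT' LE' that in \<open>simp add: th_def\<close>)+
  have front: "c \<le> LT (\<alpha> + pi) - LE \<alpha> \<and> 2 * (LT (\<alpha> + pi) - LE \<alpha>) \<le> 3 * c" if "0 \<le> \<alpha>" "\<alpha> \<le> pi" for \<alpha>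
    using c[of \<alpha>] cuts(1)[OF that] by simp
  have rear: "c \<le> LT \<alpha> + (m - LE (\<alpha> + pi))" if "0 \<le> \<alpha>" "\<alpha> \<le> pi" for \<alpha>
    using c(1)[of "\<alpha> + pi"] cuts(2)[OF that] by simp
  \<comment> \<open>at most one vertex lies at the angle \<open>\<pi>\<close>\<close>
  have c223: "223 \<le> c"
  proof -
    have "\<not> 1 \<le> LE 0"
      using LE'(1)[of 0] LE'(2)[of "LE 0" 0] th_range[of "LE 0"] unfolding th_def by fastforce
    moreover have "\<not> 1 \<le> LT 0"
      using LT'(1)[of 0] LT'(2)[of "LT 0" 0] th_range[of "LT 0"] unfolding th_def by fastforce
    ultimately have z: "LE 0 = 0" "LT 0 = 0" using LE'(1)[of 0] LT'(1)[of 0] by simp_all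
    have "LE pi \<le> LT pi + 1"
    proof (rule ccontr)
      assume "\<not> ?thesis"
      then have i: "1 \<le> LT pi + 1" "LT pi + 1 < LT pi + 2" "LT pi + 2 \<le> m" "LT pi + 2 \<le> LE pi" using LT'(1)[of pi] LE'(1)[of pi] by auto
      have "\<not> th (LT pi + 1) < pi" "th (LT pi + 2) \<le> pi" using LT'(2)[of "LT pi + 1" pi] LE'(2)[of "LT pi + 2" pi] i by auto
      then show False using less[OF i(1-3)] by linarith
    qed
    moreover have "2 * LT pi \<le> 3 * c" using front[of 0] z by simp
    moreover have "2 * (m - LE pi) \<le> 3 * c" using c(2)[of "0 + pi"] cuts(2)[of 0] z by simp
    then have "2 * m \<le> 3 * c + 2 * LE pi" by (simp add: algebra_simps)
    ultimately show ?thesis using m by linarith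
  qed
  have "\<exists>y :: int \<Rightarrow> int. y 0 = 0 \<and> (\<forall>i. 1 \<le> i \<and> i \<le> 115 \<longrightarrow> 1 \<le> y i \<and> y i \<le> m) \<and>
    (\<forall>i j. 1 \<le> i \<and> i < j \<and> j \<le> 115 \<longrightarrow> y i < y j \<and> (th (y j) < th (y i) + pi \<longleftrightarrow> sees i j))"
  proof (rule gadget_vertices[of m th LT LE c sees])
    show "0 < th i \<and> th i < 2 * pi" if "1 \<le> i" "i \<le> m" for i using th_range[OF that] by (simp add: th_def)
  qed (use less LT' LE' c223 sees_def front rear in \<open>simp_all\<close>)
  then obtain y where
    y: "y 0 = 0" "\<And>i. 1 \<le> i \<Longrightarrow> i \<le> 115 \<Longrightarrow> 1 \<le> y i \<and> y i \<le> m"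
    "\<And>i j. 1 \<le> i \<Longrightarrow> i < j \<Longrightarrow> j \<le> 115 \<Longrightarrow> y i < y j"
    "\<And>i j. 1 \<le> i \<Longrightarrow> i < j \<Longrightarrow> j \<le> 115 \<Longrightarrow> th (y j) < th (y i) + pi \<longleftrightarrow> sees i j"
    by blast
  interpret chord_model "{0..m}" chords 0 by (rule chord_model_chords)
  have "gadget {0..m} chords 0 y"
  proof
    fix i j :: int
    show "y i \<in> {0..m}" if "0 \<le> i" "i \<le> 115" using y(1) y(2)[of i] that m by (cases "i = 0") auto
    show lt: "y i < y j" if "0 \<le> i" "i < j" "j \<le> 115" using y(1) y(2)[of j] y(3)[of i j] that by (cases "i = 0") auto
    show "y 0 = 0" by (rule y(1))
    show "(y i, y j) \<in> chords \<longleftrightarrow> sees i j" if ij: "0 \<le> i" "i < j" "j \<le> 115"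
    proof (cases "i = 0")
      case True
      then show ?thesis using y(1) y(2)[of j] ij by (auto simp: chords_def sees_def)
    next
      case False
      then show ?thesis using y(2)[of i] y(2)[of j] y(3)[of i j] y(4)[of i j] ij by (auto simp: chords_def th_def)
    qed
  qed
  then show ?thesis by blast
qed

end

theorem theorem1p3:
  shows "\<exists>N :: nat. \<forall>(P :: plane set) (E :: plane set set) (X :: plane set) (x :: plane).
    simple_polygon P E \<and> X = edge_endpoints E \<and> \<not> convex P \<and>
    reflex_vertices P E = {x} \<and> balanced X x \<and> card X \<ge> N \<longrightarrow>
    (\<exists>\<epsilon> \<in> segments. \<not> strongly_convex (flip_subgraph \<epsilon> P X) (flip_graph P X))"
proof (intro exI[of _ 1000] allI impI)
  fix P :: "plane set" and E X x
  assume h: "simple_polygon P E \<and> X = edge_endpoints E \<and> \<not> convex P \<and>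
    reflex_vertices P E = {x} \<and> balanced X x \<and> card X \<ge> 1000"
  then have X: "X = edge_endpoints E" and bal: "balanced X x" and card: "1000 \<le> card X" by auto
  obtain \<kappa> where \<kappa>: "norm \<kappa> = 1" and ax: "axis_polygon (emb \<kappa> x ` P) ((`) (emb \<kappa> x) ` E) (emb \<kappa> x ` edge_endpoints E)"
    using axis_polygon_emb h by blast
  define f where "f = emb \<kappa> x"
  have injf: "inj f" unfolding f_def by (rule inj_emb[OF \<kappa>])
  interpret axis_polygon "f ` P" "(`) f ` E" "f ` X" using ax unfolding f_def X .
  obtain vs :: "int \<Rightarrow> complex" and m :: int where vs: "0 \<le> m" "bij_betw vs {0..m} (f ` X)" "vs 0 = 0"
    "\<And>i j. 1 \<le> i \<Longrightarrow> i < j \<Longrightarrow> j \<le> m \<Longrightarrow> Arg2pi (vs i) < Arg2pi (vs j)"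
    using labelling by blast
  interpret labelled "f ` P" "(`) f ` E" "f ` X" vs m by unfold_locales (use vs in auto)
  have "card (f ` X) = card X" using card_image[OF inj_on_subset[OF injf]] by blast
  then have m: "999 \<le> m" using bij_betw_same_card[OF vs(2)] card vs(1) by simp
  define M where "M = (INF H \<in> open_halfplanes x. card (X \<inter> H))"
  have cnt: "int M \<le> count \<alpha> \<and> 2 * count \<alpha> \<le> 3 * int M" for \<alpha>
  proof -
    define w where "w = Complex (- Im (cis \<alpha>)) (Re (cis \<alpha>))"
    define H where "H = {y. unlin \<kappa> w \<bullet> (y - x) > 0}"
    have side: "unlin \<kappa> w \<bullet> (y - x) = cr (cis \<alpha>) (f y)" for y
      using lin_inner[OF \<kappa>, of "unlin \<kappa> w" "y - x"] by (simp only: cr_inner(1) w_def lin_unlin[OF \<kappa>] f_def emb_def)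
    have "w \<noteq> 0"
    proof
      assume "w = 0"
      then have "sin \<alpha> = 0" "cos \<alpha> = 0" by (simp_all add: w_def complex_eq_iff)
      then show False using sin_cos_squared_add[of \<alpha>] by simp
    qed
    then have "unlin \<kappa> w \<noteq> 0" using lin_unlin[OF \<kappa>, of w] by (auto simp: lin_def complex_eq_iff)
    then have HH: "H \<in> open_halfplanes x" unfolding open_halfplanes_def H_def by blast
    have "f ` (X \<inter> H) = {z \<in> f ` X. 0 < cr (cis \<alpha>) z}" unfolding H_def side by blast
    moreover have "card (f ` (X \<inter> H)) = card (X \<inter> H)" using card_image[OF inj_on_subset[OF injf]] by blast
    ultimately have c: "count \<alpha> = int (card (X \<inter> H))" unfolding count_def by simp
    have "M \<le> card (X \<inter> H)" unfolding M_def by (rule cINF_lower[OF _ HH]) (rule bdd_below_bot)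
    moreover have "real (card (X \<inter> H)) \<le> 3 / 2 * real M" using bal HH unfolding balanced_def M_def by blast
    ultimately show ?thesis unfolding c by linarith
  qed
  obtain y where y: "gadget {0..m} chords 0 y" using gadget_exists[of "int M"] cnt m by blast
  interpret cm: chord_model "{0..m}" chords 0 by (rule chord_model_chords)
  define pv where "pv i = x + unlin \<kappa> (vs i)" for i
  have fpv: "f (pv i) = vs i" for i unfolding f_def pv_def by (rule emb_unlin[OF \<kappa>])
  define S where "S e = closed_segment (pv (fst e)) (pv (snd e))" for e
  have pvX: "pv i \<in> X" if "0 \<le> i" "i \<le> m" for i
    using vs_X[OF that] inj_image_mem_iff[OF injf, of "pv i" X] by (simp add: fpv)
  have pv_eq: "pv i = pv j \<longleftrightarrow> i = j" if "0 \<le> i" "i \<le> m" "0 \<le> j" "j \<le> m" for i j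
    using vs_eq[OF that] fpv by metis
  have segs: "f ` closed_segment a b = closed_segment (f a) (f b)" "f ` open_segment a b = open_segment (f a) (f b)" for a b
    unfolding f_def by (rule closed_segment_emb[OF \<kappa>] open_segment_emb[OF \<kappa>])+
  have arc: "closed_segment (pv i) (pv j) \<subseteq> P \<and> rel_interior (closed_segment (pv i) (pv j)) \<inter> X = {} \<longleftrightarrow> (i, j) \<in> chords"
    if ij: "0 \<le> i" "i < j" "j \<le> m" for i j
  proof -
    have ne: "pv i \<noteq> pv j" using pv_eq[of i j] ij by simp
    have "closed_segment (pv i) (pv j) \<subseteq> P \<longleftrightarrow> closed_segment (vs i) (vs j) \<subseteq> f ` P"
    proof -
      have "f ` closed_segment (pv i) (pv j) = closed_segment (vs i) (vs j)" unfolding segs(1) fpv ..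
      then show ?thesis using inj_image_subset_iff[OF injf, of "closed_segment (pv i) (pv j)" P] by simp
    qed
    moreover have "rel_interior (closed_segment (pv i) (pv j)) \<inter> X = {} \<longleftrightarrow> open_segment (vs i) (vs j) \<inter> f ` X = {}"
    proof -
      have "f ` (open_segment (pv i) (pv j) \<inter> X) = open_segment (vs i) (vs j) \<inter> f ` X"
        using image_Int[OF injf] segs(2)[of "pv i" "pv j"] by (simp add: fpv)
      then show ?thesis using ne by (auto simp: rel_interior_closed_segment)
    qed
    ultimately show ?thesis using chord_segment[OF ij] by blast
  qed
  have rng: "0 \<le> fst e \<and> fst e < snd e \<and> snd e \<le> m" if "e \<in> chords" for e using that by (auto simp: chords_def)
  have "inj_on S chords"
  proof (rule inj_onI)
    fix e g assume eg: "e \<in> chords" "g \<in> chords" "S e = S g"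
    have r: "0 \<le> fst e" "fst e < snd e" "snd e \<le> m" "0 \<le> fst g" "fst g < snd g" "snd g \<le> m"
      using rng[OF eg(1)] rng[OF eg(2)] by auto
    have "pv (fst e) = pv (fst g) \<and> pv (snd e) = pv (snd g) \<or> pv (fst e) = pv (snd g) \<and> pv (snd e) = pv (fst g)"
      using eg(3) unfolding S_def closed_segment_eq doubleton_eq_iff .
    then have "fst e = fst g \<and> snd e = snd g \<or> fst e = snd g \<and> snd e = fst g"
      using pv_eq[of "fst e" "fst g"] pv_eq[of "snd e" "snd g"] pv_eq[of "fst e" "snd g"] pv_eq[of "snd e" "fst g"] r by simp
    then show "e = g" using r by (auto simp: prod_eq_iff)
  qed
  moreover have "arcs_in P X = S ` chords"
  proof (intro equalityI subsetI)
    fix s assume "s \<in> arcs_in P X"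
    then obtain a b where ab: "s = closed_segment a b" "a \<in> X" "b \<in> X" "a \<noteq> b" "closed_segment a b \<subseteq> P"
      "rel_interior (closed_segment a b) \<inter> X = {}" unfolding arcs_in_def by blast
    have lab: "\<exists>i. 0 \<le> i \<and> i \<le> m \<and> a = pv i" if aX: "a \<in> X" for a
    proof -
      obtain i where "0 \<le> i" "i \<le> m" "f a = vs i" using vs_range[OF imageI[OF aX, of f]] by (elim exE conjE)
      moreover from this have "a = pv i" using fpv[of i] injD[OF injf, of a "pv i"] by simp
      ultimately show ?thesis by blast
    qed
    obtain i j where ij: "0 \<le> i" "i \<le> m" "a = pv i" "0 \<le> j" "j \<le> m" "b = pv j" using lab[OF ab(2)] lab[OF ab(3)] by blast
    have "i \<noteq> j" using ab(4) ij by auto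
    then consider "i < j" | "j < i" by linarith
    then show "s \<in> S ` chords"
    proof cases
      case 1
      then have "(i, j) \<in> chords" using arc[OF ij(1) 1 ij(5)] ab(5,6) unfolding ij(3,6) by blast
      moreover have "s = S (i, j)" unfolding ab(1) ij(3,6) S_def by simp
      ultimately show ?thesis by blast
    next
      case 2
      have sw: "closed_segment a b = closed_segment (pv j) (pv i)" unfolding ij(3,6) by (rule closed_segment_commute)
      have "(j, i) \<in> chords" using arc[OF ij(4) 2 ij(2)] ab(5,6) unfolding sw by blast
      moreover have "s = S (j, i)" unfolding ab(1) sw S_def by simp
      ultimately show ?thesis by blast
    qed
  next
    fix s assume "s \<in> S ` chords"
    then obtain i j where ij: "s = closed_segment (pv i) (pv j)" "(i, j) \<in> chords" by (auto simp: S_def)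
    have r: "0 \<le> i" "i < j" "j \<le> m" using rng[OF ij(2)] by auto
    show "s \<in> arcs_in P X"
    proof -
      have "pv i \<in> X" "pv j \<in> X" "pv i \<noteq> pv j" using pvX[of i] pvX[of j] pv_eq[of i j] r by simp_all
      moreover have "closed_segment (pv i) (pv j) \<subseteq> P" "rel_interior (closed_segment (pv i) (pv j)) \<inter> X = {}"
        using arc[OF r] ij(2) by simp_all
      ultimately show ?thesis unfolding arcs_in_def mem_Collect_eq ij(1)
        by (intro exI[of _ "pv i"] exI[of _ "pv j"] conjI refl)
    qed
  qed
  moreover have "crossing (S e) (S g) \<longleftrightarrow> crosses e g" if eg: "e \<in> chords" "g \<in> chords" "e \<noteq> g" for e g
  proof -
    obtain i j k l where e: "e = (i, j)" "g = (k, l)" by (cases e; cases g)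
    have r: "0 \<le> i" "i < j" "j \<le> m" "0 \<le> k" "k < l" "l \<le> m" using rng[OF eg(1)] rng[OF eg(2)] e by auto
    have ne: "pv i \<noteq> pv j" "pv k \<noteq> pv l" using pv_eq[of i j] pv_eq[of k l] r by auto
    have "f ` (open_segment (pv i) (pv j) \<inter> open_segment (pv k) (pv l)) = open_segment (vs i) (vs j) \<inter> open_segment (vs k) (vs l)"
      using image_Int[OF injf] segs(2) by (simp add: fpv)
    then have "crossing (S e) (S g) \<longleftrightarrow> open_segment (vs i) (vs j) \<inter> open_segment (vs k) (vs l) \<noteq> {}"
      using ne unfolding crossing_def S_def e by (auto simp: rel_interior_closed_segment)
    also have "\<dots> \<longleftrightarrow> crosses e g" using meet_iff[of i j k l] eg e by (simp add: crosses_def)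
    finally show ?thesis .
  qed
  moreover have "S e \<in> segments" if "e \<in> chords" for e
  proof -
    have "pv (fst e) \<noteq> pv (snd e)" using rng[OF that] pv_eq[of "fst e" "snd e"] by simp
    then show ?thesis unfolding segments_def S_def by blast
  qed
  ultimately show "\<exists>\<epsilon> \<in> segments. \<not> strongly_convex (flip_subgraph \<epsilon> P X) (flip_graph P X)"
    using cm.not_strongly_convex[of S P X y] y by blast
qed

end
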